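(* Let $\lambda\in L^*(\mathbb{R})+\mathcal{M}_c(\mathbb{R})\subset\mathcal{M}_+^{(-1)}(\mathbb{R})$, in the sense that $\lambda=\lambda_1+\lambda_2$ for a non-negative function $\lambda_1\in L^*(\mathbb{R})$ (identified with the measure $\lambda_1(s)\,ds$) and a measure $\lambda_2\in\mathcal{M}_c(\mathbb{R})$. Fix $c_0\in\mathbb{R}$ and $c_1\ge0$, and suppose that $$Z'=\big(N_0(\lambda)\cap\operatorname{supp}\lambda\big)\cup\{s\notin\operatorname{supp}\lambda\;|\;H_{\mathbb{R}}[\lambda](s)-\pi^{-1}(c_1s+c_0)=0\}$$ is discrete (i.e. it does not contain any of its limit points). Write $\lambda_c$ for the density of the continuous component of $\lambda$. Then $\mathcal{B}_{\mathbb{R}}[\lambda,c_0,c_1]=(\mu,\zeta_0,\zeta_1)$ is well-defined, and $$d\mu(s)=\mu_c(s)\,ds+\sum_{\alpha_i\in Z}\beta_i\,\delta(s-\alpha_i)\,ds,$$ where the continuous part is given by $$\mu_c(s)=\frac{\lambda_c(s)}{\lambda_c(s)^2+\big(H_{\mathbb{R}}[\lambda](s)-\pi^{-1}(c_1s+c_0)\big)^2}\in L^1(\mathbb{R}),$$ and the discrete part has weights $$\beta_i=\pi^2\left(c_1+\int\frac{d\lambda(\tau)}{(\tau-\alpha_i)^2}\right)^{-1}$$ for all $\alpha_i\in Z$ in the discrete set $$Z=N_0(\lambda)\cap\{s\in\mathbb{R}\;|\;H_{\mathbb{R}}[\lambda](s)-\pi^{-1}(c_1s+c_0)=0\}.$$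 If $c_1\ne0$, then $\zeta_0=\zeta_1=0$. If $c_1=0$ but $c_0\neq0$, then $\zeta_1=0$ and $\zeta_0=-\pi^2/c_0$. Finally, if $c_0=c_1=0$, then $$\zeta_0=-\frac{\pi^2}{\|\lambda\|^2}\int\tau\,d\lambda(\tau),\qquad\zeta_1=\frac{\pi^2}{\|\lambda\|},$$ where $\|\lambda\|=\int d\lambda$ is the variation norm of $\lambda$.
   Context: For $n\in\mathbb{R}$, $\mathcal{M}_+^{(n)}(\mathbb{R})$ is the set of non-negative Borel measures $\lambda$ on $\mathbb{R}$ of locally bounded variation, excluding the zero measure, with $\int(1+s^2)^{-n/2}\,d\lambda(s)<\infty$. $\mathcal{M}_c(\mathbb{R})$ is the set of finite, non-negative, compactly supported Borel measures on $\mathbb{R}$, excluding the zero measure. A non-negative $f\in L^1(\mathbb{R})$ belongs to $L^*(\mathbb{R})$ if $(1+s^2)^{1/2}f(s)\in L^1(\mathbb{R})$ and $\mathcal{F}[s\mapsto s^2f(s)]\in L^1(\mathbb{R})$, with $\mathcal{F}$ the Fourier transform. For $\lambda\in\mathcal{M}_+^{(1)}(\mathbb{R})$ and $z\in\mathbb{H}=\{\operatorname{Im}z>0\}$, $$Q_{\mathbb{R}}[\lambda](z)=\int\frac{i\,d\lambda(s)}{\pi(z-s)},\qquad H_{\mathbb{R}}[\lambda](t)=\lim_{\varepsilon\to0^+}\operatorname{Im}Q_{\mathbb{R}}[\lambda](t+i\varepsilon)=\mathrm{p.v.}\!\int\frac{d\lambda(s)}{\pi(t-s)}$$ (the latter defined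 for almost every $t$). $\operatorname{supp}\lambda$ is the closed support of $\lambda$. The zero set of $\lambda$ is $$N_0(\lambda)=\bigcap_{\varepsilon>0}\operatorname{clos}\Big\{s\in\mathbb{R}\;\Big|\;\limsup_{\delta\to0}\lambda([s-\delta,s+\delta])/2\delta<\varepsilon\Big\}.$$ $\mathcal{B}_{\mathbb{R}}[\lambda,c_0,c_1]=(\mu,\zeta_0,\zeta_1)$ is well-defined if there are (necessarily unique) $\mu\in\mathcal{M}_+^{(1)}(\mathbb{R})$, $\zeta_0\in\mathbb{R}$, $\zeta_1\ge0$ with $$\big(Q_{\mathbb{R}}[\lambda](z)-i\pi^{-1}c_0-i\pi^{-1}c_1z\big)\big(Q_{\mathbb{R}}[\mu](z)-i\pi^{-1}\zeta_0-i\pi^{-1}\zeta_1z\big)\equiv1\quad\text{on }\mathbb{H}.$$ $\delta(s-\alpha)\,ds$ is the unit point mass at $\alpha$. If the integral in the formula for $\beta_i$ diverges, $\beta_i=0$.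
   Formalization: Excludes c_0=c_1=0 with λ a single point mass (there μ would be 0, so B is not well-defined); μ_c∈L^1 is claimed only if c_0≠0, c_1≠0 or ∫s²dλ<∞, since for c_0=c_1=0 it fails e.g. for λ=((1+s²)^{-5/4}+1_{[-1,1]})ds. *)

theory Defs
  imports "HOL-Analysis.Analysis"
begin

section \<open>Classes of measures and functions\<close>

text \<open>The classes are sets of Isabelle measures whose \<open>\<sigma>\<close>-algebra is the Borel one. Non-negativity is
  built into the type; locally bounded variation means finiteness on compact sets.\<close>

definition M_plus :: "real \<Rightarrow> real measure set" where
  "M_plus n = {M. sets M = sets borel \<and> emeasure M UNIV \<noteq> 0 \<and>
      (\<forall>K. compact K \<longrightarrow> emeasure M K < \<infinity>) \<and>
      (\<integral>\<^sup>+s. ennreal ((1 + s\<^sup>2) powr (- n / 2)) \<partial>M) < \<infinity>}"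

definition msupp :: "real measure \<Rightarrow> real set" where
  "msupp M = {s. \<forall>U. open U \<and> s \<in> U \<longrightarrow> emeasure M U \<noteq> 0}"

definition M_c :: "real measure set" where
  "M_c = {M. sets M = sets borel \<and> emeasure M UNIV \<noteq> 0 \<and> emeasure M UNIV < \<infinity> \<and>
      compact (msupp M)}"

definition schwartz :: "(real \<Rightarrow> complex) \<Rightarrow> bool" where
  "schwartz \<phi> \<longleftrightarrow> (\<exists>D :: nat \<Rightarrow> real \<Rightarrow> complex. D 0 = \<phi> \<and>
      (\<forall>k x. (D k has_vector_derivative D (Suc k) x) (at x)) \<and>
      (\<forall>k m. bounded (range (\<lambda>x. of_real (x ^ m) * D k x))))"

definition fourier :: "(real \<Rightarrow> complex) \<Rightarrow> real \<Rightarrow> complex" where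
  "fourier \<phi> t = (LINT s|lborel. exp (- \<i> * of_real (s * t)) * \<phi> s)"

text \<open>\<open>\<F>[u] \<in> L\<^sup>1(\<real>)\<close>, where \<open>u\<close> is a function of at most polynomial growth in the mean and \<open>\<F>[u]\<close> is
  its Fourier transform as a tempered distribution. In the definition of \<open>L\<^sup>*(\<real>)\<close> it is applied to
  \<open>u(s) = s\<^sup>2 f(s)\<close>, which the other conditions on \<open>f\<close> do not force to be integrable, so the
  Fourier integral alone would not do. For integrable \<open>u\<close> the two transforms agree, and the
  normalization of \<open>\<F>\<close> is immaterial.\<close>

definition fourier_in_L1 :: "(real \<Rightarrow> real) \<Rightarrow> bool" where
  "fourier_in_L1 u \<longleftrightarrow> (\<exists>k::nat. integrable lborel (\<lambda>s. u s / (1 + s\<^sup>2) ^ k)) \<and>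
      (\<exists>g :: real \<Rightarrow> complex. integrable lborel g \<and>
        (\<forall>\<phi>. schwartz \<phi> \<longrightarrow>
          (LINT s|lborel. of_real (u s) * fourier \<phi> s) = (LINT s|lborel. g s * \<phi> s)))"

definition L_star :: "(real \<Rightarrow> real) set" where
  "L_star = {f. (\<forall>s. 0 \<le> f s) \<and> integrable lborel f \<and>
      integrable lborel (\<lambda>s. (1 + s\<^sup>2) powr (1 / 2) * f s) \<and>
      fourier_in_L1 (\<lambda>s. s\<^sup>2 * f s)}"

definition L_star_plus_M_c :: "real measure set" where
  "L_star_plus_M_c = {M. sets M = sets borel \<and> (\<exists>f \<in> L_star. \<exists>\<nu> \<in> M_c.
      \<forall>A \<in> sets borel. emeasure M A = emeasure (density lborel (\<lambda>s. ennreal (f s))) A + emeasure \<nu> A)}"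

text \<open>\<open>f\<close> is a version of the density of the absolutely continuous part in the Lebesgue decomposition
  of \<open>M\<close>; \<open>\<nu>\<close> is the singular part.\<close>

definition continuous_density :: "real measure \<Rightarrow> (real \<Rightarrow> real) \<Rightarrow> bool" where
  "continuous_density M f \<longleftrightarrow> f \<in> borel_measurable borel \<and> (\<forall>s. 0 \<le> f s) \<and>
      (\<exists>\<nu> N. sets \<nu> = sets borel \<and> N \<in> null_sets lborel \<and> emeasure \<nu> (- N) = 0 \<and>
        (\<forall>A \<in> sets borel. emeasure M A = emeasure (density lborel (\<lambda>s. ennreal (f s))) A + emeasure \<nu> A))"


section \<open>Transforms and zero sets\<close>

definition Q_trans :: "real measure \<Rightarrow> complex \<Rightarrow> complex" where
  "Q_trans M z = (LINT s|M. \<i> / (of_real pi * (z - of_real s)))"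

text \<open>The Hilbert transform is taken as the boundary limit of \<open>Im Q\<close>. \<open>hilbert M t\<close> carries information
  only where that limit exists; in pointwise conditions existence is required separately.\<close>

definition has_hilbert :: "real measure \<Rightarrow> real \<Rightarrow> real \<Rightarrow> bool" where
  "has_hilbert M t h \<longleftrightarrow> ((\<lambda>\<epsilon>. Im (Q_trans M (Complex t \<epsilon>))) \<longlongrightarrow> h) (at_right 0)"

definition hilbert :: "real measure \<Rightarrow> real \<Rightarrow> real" where
  "hilbert M t = Lim (at_right 0) (\<lambda>\<epsilon>. Im (Q_trans M (Complex t \<epsilon>)))"

definition hilbert_zeros :: "real measure \<Rightarrow> real \<Rightarrow> real \<Rightarrow> real set" where
  "hilbert_zeros M c0 c1 =
     {s. (\<exists>h. has_hilbert M s h) \<and> hilbert M s - (c1 * s + c0) / pi = 0}"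

definition zero_set :: "real measure \<Rightarrow> real set" where
  "zero_set M = (\<Inter>\<epsilon>\<in>{0::real<..}. closure
     {s. Limsup (at_right 0) (\<lambda>\<delta>. emeasure M {s - \<delta>..s + \<delta>} / ennreal (2 * \<delta>)) < ennreal \<epsilon>})"

definition Z_prime :: "real measure \<Rightarrow> real \<Rightarrow> real \<Rightarrow> real set" where
  "Z_prime M c0 c1 = (zero_set M \<inter> msupp M) \<union> {s. s \<notin> msupp M \<and> s \<in> hilbert_zeros M c0 c1}"

definition Z_atoms :: "real measure \<Rightarrow> real \<Rightarrow> real \<Rightarrow> real set" where
  "Z_atoms M c0 c1 = zero_set M \<inter> hilbert_zeros M c0 c1"


section \<open>The transform B\<close>

text \<open>\<open>is_B M c0 c1 \<mu> \<zeta>0 \<zeta>1\<close> stands for \<open>\<B>[M,c0,c1] = (\<mu>,\<zeta>0,\<zeta>1)\<close>.\<close>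

definition is_B :: "real measure \<Rightarrow> real \<Rightarrow> real \<Rightarrow> real measure \<Rightarrow> real \<Rightarrow> real \<Rightarrow> bool" where
  "is_B M c0 c1 \<mu> \<zeta>0 \<zeta>1 \<longleftrightarrow> \<mu> \<in> M_plus 1 \<and> 0 \<le> \<zeta>1 \<and>
     (\<forall>z. 0 < Im z \<longrightarrow>
        (Q_trans M z - \<i> * of_real c0 / of_real pi - \<i> * of_real c1 * z / of_real pi) *
        (Q_trans \<mu> z - \<i> * of_real \<zeta>0 / of_real pi - \<i> * of_real \<zeta>1 * z / of_real pi) = 1)"

definition B_well_defined :: "real measure \<Rightarrow> real \<Rightarrow> real \<Rightarrow> bool" where
  "B_well_defined M c0 c1 \<longleftrightarrow> (\<exists>\<mu> \<zeta>0 \<zeta>1. is_B M c0 c1 \<mu> \<zeta>0 \<zeta>1)"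

text \<open>If \<open>c0 = c1 = 0\<close> and \<open>M\<close> is a single point mass, then \<open>1 / Q_trans M\<close> is affine, which forces
  \<open>\<mu> = 0\<close>. As \<open>M_plus 1\<close> excludes the zero measure, \<open>B\<close> is then not well-defined; this is the only
  case the non-degeneracy hypothesis of the theorem removes.

  For \<open>c0 = c1 = 0\<close> the density below behaves like \<open>\<pi>\<^sup>2 s\<^sup>2 \<rho>(s) / \<parallel>M\<parallel>\<^sup>2\<close> at infinity, so it is integrable
  only if \<open>M\<close> has a finite second moment. \<open>M \<in> M_plus (-1)\<close> gives only a first moment.\<close>

definition mu_density ::
  "real measure \<Rightarrow> (real \<Rightarrow> real) \<Rightarrow> real \<Rightarrow> real \<Rightarrow> real \<Rightarrow> real" where
  "mu_density M \<rho> c0 c1 s =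
     \<rho> s / ((\<rho> s)\<^sup>2 + (hilbert M s - (c1 * s + c0) / pi)\<^sup>2)"

text \<open>In \<open>ennreal\<close>, \<open>inverse 0 = \<infinity>\<close>, so an atom of \<open>M\<close> at \<open>\<alpha>\<close> makes the integral diverge, as it should.\<close>

definition mu_weight :: "real measure \<Rightarrow> real \<Rightarrow> real \<Rightarrow> real" where
  "mu_weight M c1 \<alpha> =
     (let I = (\<integral>\<^sup>+\<tau>. inverse (ennreal ((\<tau> - \<alpha>)\<^sup>2)) \<partial>M)
      in if I = \<infinity> then 0 else pi\<^sup>2 * inverse (c1 + enn2real I))"

end

theory Submission
  imports Defs "HOL-Probability.Helly_Selection" "HOL-Probability.Sinc_Integral"
    "HOL-Complex_Analysis.Complex_Analysis"
begin

text \<open>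
  Write \<open>F\<close> for the first factor in the equation defining \<open>\<B>\<close>. It maps the upper half-plane into the
  right half-plane, hence so does \<open>1 / F\<close>, and Herglotz' theorem represents \<open>1 / F\<close> by a measure \<open>\<mu>\<close>.
  A finite first moment of \<open>M\<close> controls \<open>F(i y)\<close> for \<open>y \<rightarrow> \<infinity>\<close> well enough to give
  \<open>\<integral> (1 + s\<^sup>2) powr (-1/2) d\<mu> < \<infinity>\<close>, so that no regularization of the Cauchy kernel is needed, and to
  determine \<open>\<zeta>\<^sub>0\<close> and \<open>\<zeta>\<^sub>1\<close>.

  By Fatou's theorem \<open>F\<close> and \<open>1 / F\<close> have finite boundary values almost everywhere, and their real parts
  are the densities of \<open>M\<close> and \<open>\<mu>\<close>; this yields the continuous part of \<open>\<mu>\<close>. Every point outside \<open>Z'\<close>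
  has a neighbourhood in which \<open>Re (1 / F)\<close> stays bounded along a sequence of heights tending to \<open>0\<close>,
  and a covering argument shows that \<open>\<mu>\<close> is dominated there by a multiple of Lebesgue measure. Since \<open>Z'\<close>
  is discrete, hence countable, the singular part of \<open>\<mu>\<close> consists of atoms, and the mass at \<open>\<alpha>\<close> is the limit
  of \<open>\<pi> \<epsilon> / F(\<alpha> + i \<epsilon>)\<close>.
\<close>

text \<open>The set \<open>Z'\<close> has two pieces because there are two ways to keep F away from
  zero near the real axis. Always Re (1 / F) \<le> 1 / |F|. Near a point of positive upper density
  of M the real part of F is bounded below, at least along suitable heights. Off the support F
  extends continuously to the axis, and its imaginary part there is nonzero unless the Hilbert
  transform meets the line \<open>(c1 * t + c0) / pi\<close>.

  The delicate case is c0 = c1 = 0. Then F(i y) decays like m / (pi y), where m is the total mass of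
  M, so 1 / F grows linearly. The linear term has to be identified and removed exactly before the
  size of \<mu> becomes visible. What remains is governed by a cut-off second moment of M. Its
  values at y = 2 ^ k have a sum controlled by the first moment, while y times its value at y is
  controlled by the second moment. The former yields \<open>M_plus 1\<close>, the latter the
  integrability of the density.

  A priori \<mu> only integrates \<open>1 / (1 + s\<^sup>2)\<close>, so the differentiation theory
  is set up for such measures, and statements about finite measures are transferred through this
  weight.\<close>

section \<open>Differentiation of measures on the line\<close>

text \<open>Take a subfamily of minimal cardinality with the same union: of three intervals with a common point,
  one is contained in the union of the other two.\<close>

lemma subfamily_overlap_le_2:
  fixes P :: "(real \<times> real) set"
  assumes "finite P"
  obtains Q where "Q \<subseteq> P" "(\<Union>p\<in>Q. {fst p<..<snd p}) = (\<Union>p\<in>P. {fst p<..<snd p})"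
    "\<And>x. card {p\<in>Q. x \<in> {fst p<..<snd p}} \<le> 2"
proof -
  define good where "good Q \<longleftrightarrow> Q \<subseteq> P \<and> (\<Union>p\<in>Q. {fst p<..<snd p}) = (\<Union>p\<in>P. {fst p<..<snd p})" for Q
  have "good P" by (simp add: good_def)
  then obtain Q where Q: "good Q" and min: "\<And>R. good R \<Longrightarrow> card Q \<le> card R"
    using ex_has_least_nat[of good P card] by auto
  have finQ: "finite Q" using Q assms finite_subset good_def by blast
  have "card {p\<in>Q. x \<in> {fst p<..<snd p}} \<le> 2" for x
  proof (rule ccontr)
    define S where "S = {p\<in>Q. x \<in> {fst p<..<snd p}}"
    assume "\<not> card {p\<in>Q. x \<in> {fst p<..<snd p}} \<le> 2"
    then have card: "card S > 2" by (simp add: S_def)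
    have fin: "finite S" using finQ by (simp add: S_def)
    have ne: "S \<noteq> {}" using card by auto
    \<comment> \<open>All members of S contain x, so the interval reaching furthest left and the one
      reaching furthest right together cover every other member.\<close>
    obtain A where A: "A \<in> S" "\<And>p. p \<in> S \<Longrightarrow> fst A \<le> fst p"
      using fin ne by (metis arg_min_if_finite(1) arg_min_least)
    obtain B where B: "B \<in> S" "\<And>p. p \<in> S \<Longrightarrow> snd p \<le> snd B"
    proof -
      have "Max (snd ` S) \<in> snd ` S" using fin ne by simp
      then obtain B where "B \<in> S" "snd B = Max (snd ` S)" by force
      then show ?thesis using that fin by simp
    qed
    have "card {A, B} \<le> 2" by (simp add: card_insert_if)
    then have "\<not> S \<subseteq> {A, B}" using card card_mono[of "{A,B}" S] by auto
    then obtain C where C: "C \<in> S" "C \<noteq> A" "C \<noteq> B" by auto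
    have sub: "{fst C<..<snd C} \<subseteq> {fst A<..<snd A} \<union> {fst B<..<snd B}"
      using A(1) B(1) A(2)[OF C(1)] B(2)[OF C(1)] C(1) unfolding S_def by auto
    have "good (Q - {C})"
      unfolding good_def
    proof (intro conjI)
      show "Q - {C} \<subseteq> P" using Q by (auto simp: good_def)
      have "A \<in> Q - {C}" "B \<in> Q - {C}" using A B C by (auto simp: S_def)
      then have "(\<Union>p\<in>Q - {C}. {fst p<..<snd p}) = (\<Union>p\<in>Q. {fst p<..<snd p})"
        using sub by blast
      then show "(\<Union>p\<in>Q - {C}. {fst p<..<snd p}) = (\<Union>p\<in>P. {fst p<..<snd p})"
        using Q by (simp add: good_def)
    qed
    from min[OF this] show False
      using C(1) finQ card_Diff1_less[of Q C] by (auto simp: S_def)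
  qed
  then show ?thesis using that Q unfolding good_def by blast
qed

text \<open>Bounded overlap replaces Vitali's disjoint subfamilies, because \<open>\<beta>\<close> need not be doubling.\<close>

lemma emeasure_le_of_interval_cover:
  fixes \<alpha> \<beta> :: "real measure"
  assumes [simp, measurable_cong]: "sets \<alpha> = sets borel" "sets \<beta> = sets borel" and "open W"
    and cover: "\<And>t. t \<in> W \<Longrightarrow> \<exists>a b. a < t \<and> t < b \<and> {a<..<b} \<subseteq> W \<and>
      emeasure \<beta> {a<..<b} \<le> c * emeasure \<alpha> {a<..<b}"
  shows "emeasure \<beta> W \<le> 2 * c * emeasure \<alpha> W"
proof -
  have [measurable]: "W \<in> sets borel" using \<open>open W\<close> by simp
  \<comment> \<open>Compactness is what gives a finite family; the open set is exhausted by compact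
    subsets at the end.\<close>
  have K: "emeasure \<beta> K \<le> 2 * c * emeasure \<alpha> W" if "compact K" "K \<subseteq> W" for K
  proof -
    from cover have "\<forall>t. \<exists>a b. t \<in> W \<longrightarrow> a < t \<and> t < b \<and> {a<..<b} \<subseteq> W \<and>
      emeasure \<beta> {a<..<b} \<le> c * emeasure \<alpha> {a<..<b}" by blast
    then obtain a b where ab: "\<And>t. t \<in> W \<Longrightarrow> a t < t \<and> t < b t \<and> {a t<..<b t} \<subseteq> W \<and>
      emeasure \<beta> {a t<..<b t} \<le> c * emeasure \<alpha> {a t<..<b t}" by metis
    obtain T where T: "T \<subseteq> K" "finite T" "K \<subseteq> (\<Union>t\<in>T. {a t<..<b t})"
      proof (rule compactE_image[OF \<open>compact K\<close>, of K "\<lambda>t. {a t<..<b t}"])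
      show "K \<subseteq> (\<Union>t\<in>K. {a t<..<b t})" using ab \<open>K \<subseteq> W\<close> by fastforce
    qed auto
    obtain Q where Q: "Q \<subseteq> (\<lambda>t. (a t, b t)) ` T"
      "(\<Union>p\<in>Q. {fst p<..<snd p}) = (\<Union>p\<in>(\<lambda>t. (a t, b t)) ` T. {fst p<..<snd p})"
      and ov: "\<And>x. card {p\<in>Q. x \<in> {fst p<..<snd p}} \<le> 2"
      using subfamily_overlap_le_2[of "(\<lambda>t. (a t, b t)) ` T"] T(2) by auto
    have finQ: "finite Q" using Q(1) T(2) finite_subset by blast
    have QW: "{fst p<..<snd p} \<subseteq> W \<and> emeasure \<beta> {fst p<..<snd p} \<le> c * emeasure \<alpha> {fst p<..<snd p}" if "p \<in> Q" for p
      using that Q(1) ab T(1) \<open>K \<subseteq> W\<close> by fastforce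
    have "emeasure \<beta> K \<le> emeasure \<beta> (\<Union>p\<in>Q. {fst p<..<snd p})"
      by (rule emeasure_mono) (use T(3) Q(2) in \<open>auto intro!: borel_open open_UN\<close>)
    also have "\<dots> \<le> (\<Sum>p\<in>Q. emeasure \<beta> {fst p<..<snd p})"
      by (rule emeasure_subadditive_finite) (use finQ in auto)
    also have "\<dots> \<le> (\<Sum>p\<in>Q. c * emeasure \<alpha> {fst p<..<snd p})"
      using QW by (intro sum_mono) auto
    also have "\<dots> = c * (\<Sum>p\<in>Q. \<integral>\<^sup>+x. indicator {fst p<..<snd p} x \<partial>\<alpha>)"
      by (simp add: sum_distrib_left)
    also have "\<dots> = c * (\<integral>\<^sup>+x. (\<Sum>p\<in>Q. indicator {fst p<..<snd p} x) \<partial>\<alpha>)"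
      by (subst nn_integral_sum) auto
    also have "\<dots> \<le> c * (\<integral>\<^sup>+x. 2 * indicator W x \<partial>\<alpha>)"
    proof (intro mult_left_mono nn_integral_mono)
      fix x
      have "(\<Sum>p\<in>Q. indicator {fst p<..<snd p} x :: ennreal) = of_nat (card {p\<in>Q. x \<in> {fst p<..<snd p}})"
        using finQ by (simp add: indicator_def sum.If_cases Int_def)
      also have "\<dots> \<le> 2"
        using ov[of x] by (metis of_nat_mono of_nat_numeral)
      finally have "(\<Sum>p\<in>Q. indicator {fst p<..<snd p} x :: ennreal) \<le> 2" .
      moreover have "(\<Sum>p\<in>Q. indicator {fst p<..<snd p} x :: ennreal) = 0" if "x \<notin> W"
        using that QW by (intro sum.neutral) (auto simp: indicator_def subset_iff)
      ultimately show "(\<Sum>p\<in>Q. indicator {fst p<..<snd p} x :: ennreal) \<le> 2 * indicator W x"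
        by (cases "x \<in> W") auto
    qed auto
    also have "\<dots> = 2 * c * emeasure \<alpha> W"
      by (subst nn_integral_cmult) (auto simp: mult_ac)
    finally show ?thesis .
  qed
  obtain C where C: "\<And>n. compact (C n)" "\<And>n. C n \<subseteq> W" "\<And>n. C n \<subseteq> interior (C (Suc n))" "\<Union>(range C) = W"
    using open_Union_compact_subsets[OF \<open>open W\<close>] by metis
  have "incseq C" using C(3) interior_subset by (intro incseq_SucI) blast
  then have "emeasure \<beta> W = (SUP n. emeasure \<beta> (C n))"
    using C by (subst SUP_emeasure_incseq) (auto simp: borel_compact)
  also have "\<dots> \<le> 2 * c * emeasure \<alpha> W"
    using C K by (intro SUP_least) auto
  finally show ?thesis .
qed

text \<open>Outer regularity encloses E in open sets of small \<kappa>-mass. The intervals inside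
  such a set on which \<kappa> exceeds \<open>a * d\<close> are short compared with their
  \<kappa>-mass, so the covering lemma, with Lebesgue measure as the dominated measure, makes their
  union small.\<close>

lemma AE_symmetric_density_zero_finite:
  fixes \<kappa> :: "real measure"
  assumes [simp]: "sets \<kappa> = sets borel" and fin: "emeasure \<kappa> UNIV < \<infinity>"
    and E: "E \<in> sets borel" "emeasure \<kappa> E = 0"
  shows "AE t in lborel. t \<in> E \<longrightarrow>
    (\<forall>a>0. \<exists>d0>0. \<forall>d. 0 < d \<and> d < d0 \<longrightarrow> emeasure \<kappa> {t-d<..<t+d} \<le> ennreal (a * d))"
proof -
  have sp: "space \<kappa> = UNIV" using sets_eq_imp_space_eq[of \<kappa> borel] by simp
  have main: "AE t in lborel. t \<in> E \<longrightarrow>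
    (\<exists>d0>0. \<forall>d. 0 < d \<and> d < d0 \<longrightarrow> emeasure \<kappa> {t-d<..<t+d} \<le> ennreal (a * d))" if "a > 0" for a :: real
  proof -
    have "\<exists>O'. open O' \<and> E \<subseteq> O' \<and> emeasure \<kappa> O' < ennreal (1 / Suc n)" for n
    proof -
      have "(INF U \<in> {U. E \<subseteq> U \<and> open U}. emeasure \<kappa> U) < ennreal (1 / Suc n)"
        using outer_regular[of \<kappa> E] E fin sp by simp
      then show ?thesis unfolding INF_less_iff by auto
    qed
    then obtain Os where Os: "\<And>n. open (Os n)" "\<And>n. E \<subseteq> Os n" "\<And>n. emeasure \<kappa> (Os n) < ennreal (1 / Suc n)"
      by metis
    \<comment> \<open>All bad intervals inside \<open>Os n\<close> are collected, wherever their
      centres lie. A point of E outside \<open>W n\<close> is therefore the centre of no bad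
      interval that fits into \<open>Os n\<close>.\<close>
    define W where "W n = \<Union>{{t-d<..<t+d} | t d. 0 < d \<and> {t-d<..<t+d} \<subseteq> Os n \<and> ennreal (a*d) < emeasure \<kappa> {t-d<..<t+d}}" for n
    have oW: "open (W n)" for n unfolding W_def by (intro open_Union) auto
    have WO: "W n \<subseteq> Os n" for n unfolding W_def by auto
    have Wle: "emeasure lborel (W n) \<le> 2 * ennreal (2 / a) * ennreal (1 / Suc n)" for n
    proof -
      have "emeasure lborel (W n) \<le> 2 * ennreal (2/a) * emeasure \<kappa> (W n)"
      proof (rule emeasure_le_of_interval_cover)
        fix x assume "x \<in> W n"
        then obtain t d where td: "0 < d" "{t-d<..<t+d} \<subseteq> Os n" "ennreal (a*d) < emeasure \<kappa> {t-d<..<t+d}" "x \<in> {t-d<..<t+d}"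
          unfolding W_def by auto
        have "{t-d<..<t+d} \<subseteq> W n" using td unfolding W_def by blast
        moreover have "emeasure lborel {t-d<..<t+d} \<le> ennreal (2/a) * emeasure \<kappa> {t-d<..<t+d}"
        proof -
          have "emeasure lborel {t-d<..<t+d} = ennreal (2/a) * ennreal (a*d)"
            using td \<open>a > 0\<close> by (simp add: ennreal_mult[symmetric] field_simps)
          also have "\<dots> \<le> ennreal (2/a) * emeasure \<kappa> {t-d<..<t+d}"
            using td by (intro mult_left_mono) auto
          finally show ?thesis .
        qed
        ultimately show "\<exists>a' b. a' < x \<and> x < b \<and> {a'<..<b} \<subseteq> W n \<and> emeasure lborel {a'<..<b} \<le> ennreal (2/a) * emeasure \<kappa> {a'<..<b}"
          using td(4) by (intro exI[of _ "t-d"] exI[of _ "t+d"]) auto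
      qed (use oW in auto)
      also have "\<dots> \<le> 2 * ennreal (2/a) * ennreal (1 / Suc n)"
        using Os(3)[of n] emeasure_mono[OF WO, of n \<kappa>] Os(1)
        by (intro mult_left_mono) (auto dest: order.strict_trans1 intro: less_imp_le)
      finally show ?thesis .
    qed
    define N where "N = (\<Inter>n. W n)"
    have N: "N \<in> sets borel" using oW unfolding N_def by auto
    have "emeasure lborel N \<le> ennreal e" if "e > 0" for e
    proof -
      obtain n where n: "1 / Suc n < e * a / 4" using nat_approx_posE[of "e * a / 4"] \<open>a > 0\<close> \<open>e > 0\<close> by auto
      have "emeasure lborel N \<le> emeasure lborel (W n)"
        using oW by (intro emeasure_mono) (auto simp: N_def)
      also have "\<dots> \<le> ennreal (4 / a * (1 / Suc n))"
        using Wle[of n] \<open>a > 0\<close> by (simp add: ennreal_mult'[symmetric] flip: ennreal_numeral)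
      also have "\<dots> \<le> ennreal e"
        using n \<open>a > 0\<close> by (intro ennreal_leI) (simp add: field_simps del: of_nat_Suc)
      finally show ?thesis .
    qed
    then have "emeasure lborel N = 0"
      by (metis ennreal_le_epsilon add.left_neutral le_zero_eq)
    then have "AE t in lborel. t \<notin> N"
      using N by (intro AE_not_in) (auto simp: null_sets_def)
    then show ?thesis
    proof (rule AE_mp, intro AE_I2 impI)
      fix t assume t: "t \<notin> N" "t \<in> E"
      then obtain n where n: "t \<notin> W n" by (auto simp: N_def)
      obtain d0 where d0: "d0 > 0" "ball t d0 \<subseteq> Os n"
        using Os(1,2) t(2) by (meson openE subsetD)
      have "emeasure \<kappa> {t-d<..<t+d} \<le> ennreal (a*d)" if "0 < d" "d < d0" for d
      proof (rule ccontr)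
        assume "\<not> ?thesis"
        moreover have "{t-d<..<t+d} \<subseteq> Os n"
          using that d0 by (auto simp: ball_eq_greaterThanLessThan subset_iff)
        ultimately have "t \<in> W n"
          using that unfolding W_def by (simp add: not_le) (rule exI[of _ "{t-d<..<t+d}"], auto)
        then show False using n by simp
      qed
      then show "\<exists>d0>0. \<forall>d. 0 < d \<and> d < d0 \<longrightarrow> emeasure \<kappa> {t-d<..<t+d} \<le> ennreal (a*d)"
        using d0(1) by blast
    qed
  qed
  have "AE t in lborel. \<forall>k::nat. t \<in> E \<longrightarrow>
    (\<exists>d0>0. \<forall>d. 0 < d \<and> d < d0 \<longrightarrow> emeasure \<kappa> {t-d<..<t+d} \<le> ennreal (1 / Suc k * d))"
    unfolding AE_all_countable by (intro allI main) simp
  then show ?thesis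
  proof (rule AE_mp, intro AE_I2 impI allI)
    fix t and a :: real assume H: "\<forall>k::nat. t \<in> E \<longrightarrow>
      (\<exists>d0>0. \<forall>d. 0 < d \<and> d < d0 \<longrightarrow> emeasure \<kappa> {t-d<..<t+d} \<le> ennreal (1 / Suc k * d))" "t \<in> E" "0 < a"
    obtain k where k: "1 / Suc k < a" using nat_approx_posE[OF \<open>0 < a\<close>] by auto
    obtain d0 where d0: "d0>0" "\<forall>d. 0 < d \<and> d < d0 \<longrightarrow> emeasure \<kappa> {t-d<..<t+d} \<le> ennreal (1 / Suc k * d)"
      using H by blast
    have "emeasure \<kappa> {t-d<..<t+d} \<le> ennreal (a * d)" if "0 < d" "d < d0" for d
    proof -
      have "emeasure \<kappa> {t-d<..<t+d} \<le> ennreal (1 / Suc k * d)" using d0 that by blast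
      also have "\<dots> \<le> ennreal (a * d)" using k that by (intro ennreal_leI mult_right_mono) auto
      finally show ?thesis .
    qed
    then show "\<exists>d0>0. \<forall>d. 0 < d \<and> d < d0 \<longrightarrow> emeasure \<kappa> {t-d<..<t+d} \<le> ennreal (a * d)"
      using d0(1) by blast
  qed
qed


section \<open>Boundary behaviour of Poisson integrals\<close>

text \<open>This is the real part of \<i> / (pi (z - s)) at z = t + \<i> \<epsilon>, the kernel of
  \<open>Q_trans\<close>; with the factor 1 / pi its Lebesgue integral is 1.\<close>

definition poisson_kernel :: "real \<Rightarrow> real \<Rightarrow> real \<Rightarrow> real" where
  "poisson_kernel t \<epsilon> s = \<epsilon> / (pi * ((t - s)\<^sup>2 + \<epsilon>\<^sup>2))"

definition poisson :: "real measure \<Rightarrow> real \<Rightarrow> real \<Rightarrow> real" where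
  "poisson \<nu> t \<epsilon> = (LINT s|\<nu>. poisson_kernel t \<epsilon> s)"

text \<open>The growth condition under which Poisson integrals converge. The measure produced by
  Herglotz' theorem satisfies it at once, whereas its membership in \<open>M_plus 1\<close> needs an
  argument.\<close>

definition poisson_measure :: "real measure \<Rightarrow> bool" where
  "poisson_measure \<nu> \<longleftrightarrow> sets \<nu> = sets borel \<and> integrable \<nu> (\<lambda>s. 1 / (1 + s\<^sup>2))"

lemma poisson_measureD [dest]:
  assumes "poisson_measure \<nu>"
  shows "sets \<nu> = sets borel" "space \<nu> = UNIV" "integrable \<nu> (\<lambda>s. 1 / (1 + s\<^sup>2))"
  using assms sets_eq_imp_space_eq[of \<nu> borel] by (auto simp: poisson_measure_def)

lemma poisson_kernel_nonneg: "0 \<le> \<epsilon> \<Longrightarrow> 0 \<le> poisson_kernel t \<epsilon> s"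
  by (simp add: poisson_kernel_def)

lemma poisson_kernel_measurable [measurable]: "poisson_kernel t \<epsilon> \<in> borel_measurable borel"
  unfolding poisson_kernel_def by measurable

text \<open>The difference of the two sides of
  \<open>s\<^sup>2 \<le> 2 * (t - s)\<^sup>2 + 2 * t\<^sup>2\<close> is the square of s - 2 t. The
  remaining constant \<open>1 + 2 * t\<^sup>2\<close> is absorbed into a multiple of
  \<open>\<epsilon>\<^sup>2\<close>. In this way Poisson and Cauchy kernels at any point are
  compared with one fixed weight.\<close>

lemma one_plus_square_le:
  fixes s t \<epsilon> :: real
  assumes "\<epsilon> \<noteq> 0"
  shows "1 + s\<^sup>2 \<le> (2 + (1 + 2*t\<^sup>2) / \<epsilon>\<^sup>2) * ((t - s)\<^sup>2 + \<epsilon>\<^sup>2)"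
proof -
  have "1 + s\<^sup>2 \<le> 2 * (t-s)\<^sup>2 + (1 + 2*t\<^sup>2)"
    using zero_le_power2[of "s - 2*t"] by (simp add: power2_eq_square algebra_simps)
  moreover have "1 + 2*t\<^sup>2 = (1 + 2*t\<^sup>2) / \<epsilon>\<^sup>2 * \<epsilon>\<^sup>2" using assms by simp
  moreover have "0 \<le> (1 + 2*t\<^sup>2) / \<epsilon>\<^sup>2 * (t-s)\<^sup>2" by simp
  moreover have "0 \<le> 2 * \<epsilon>\<^sup>2" by simp
  ultimately show ?thesis unfolding distrib_left distrib_right by linarith
qed

lemma inverse_shifted_square_le:
  fixes s t \<epsilon> :: real
  assumes "\<epsilon> \<noteq> 0"
  shows "1 / ((t - s)\<^sup>2 + \<epsilon>\<^sup>2) \<le> (2 + (1 + 2*t\<^sup>2) / \<epsilon>\<^sup>2) * (1 / (1 + s\<^sup>2))"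
proof -
  have "0 < (t - s)\<^sup>2 + \<epsilon>\<^sup>2" "0 < 1 + s\<^sup>2" using assms by (simp_all add: add_nonneg_pos add_pos_nonneg)
  then show ?thesis using one_plus_square_le[OF assms, of s t] by (simp add: field_simps)
qed

lemma integrable_poisson_kernel:
  assumes "poisson_measure \<nu>"
  shows "integrable \<nu> (poisson_kernel t \<epsilon>)"
proof (cases "\<epsilon> = 0")
  case True
  then show ?thesis by (simp add: poisson_kernel_def[abs_def])
next
  case False
  note [simp, measurable_cong] = poisson_measureD(1)[OF assms]
  show ?thesis
  proof (rule Bochner_Integration.integrable_bound)
    show "integrable \<nu> (\<lambda>s. \<bar>\<epsilon>\<bar> / pi * ((2 + (1 + 2*t\<^sup>2) / \<epsilon>\<^sup>2) * (1 / (1 + s\<^sup>2))))"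
      using poisson_measureD(3)[OF assms] by (intro integrable_mult_right)
    show "AE s in \<nu>. norm (poisson_kernel t \<epsilon> s) \<le> norm (\<bar>\<epsilon>\<bar> / pi * ((2 + (1 + 2*t\<^sup>2) / \<epsilon>\<^sup>2) * (1 / (1 + s\<^sup>2))))"
    proof (intro AE_I2)
      fix s
      have "norm (poisson_kernel t \<epsilon> s) = \<bar>\<epsilon>\<bar> / pi * (1 / ((t - s)\<^sup>2 + \<epsilon>\<^sup>2))"
        by (simp add: poisson_kernel_def abs_mult)
      also have "\<dots> \<le> \<bar>\<epsilon>\<bar> / pi * ((2 + (1 + 2*t\<^sup>2) / \<epsilon>\<^sup>2) * (1 / (1 + s\<^sup>2)))"
        by (intro mult_left_mono inverse_shifted_square_le False) simp
      finally show "norm (poisson_kernel t \<epsilon> s) \<le> norm (\<bar>\<epsilon>\<bar> / pi * ((2 + (1 + 2*t\<^sup>2) / \<epsilon>\<^sup>2) * (1 / (1 + s\<^sup>2))))"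
        by simp
    qed
    show "poisson_kernel t \<epsilon> \<in> borel_measurable \<nu>" by measurable
  qed
qed

lemma ennreal_poisson:
  assumes "poisson_measure \<nu>" "0 \<le> \<epsilon>"
  shows "ennreal (poisson \<nu> t \<epsilon>) = (\<integral>\<^sup>+s. ennreal (poisson_kernel t \<epsilon> s) \<partial>\<nu>)"
  unfolding poisson_def using assms
  by (subst nn_integral_eq_integral) (auto intro: integrable_poisson_kernel poisson_kernel_nonneg)

lemma poisson_nonneg: "0 \<le> \<epsilon> \<Longrightarrow> 0 \<le> poisson \<nu> t \<epsilon>"
  unfolding poisson_def by (simp add: poisson_kernel_nonneg)

text \<open>The measure \<kappa> with density \<open>1 / (1 + s\<^sup>2)\<close> is finite, and
  within distance 1 of t this density is at least 1 / C. Hence vanishing density of \<kappa> at t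
  carries over to \<nu>.\<close>

lemma AE_symmetric_density_zero:
  assumes \<nu>: "poisson_measure \<nu>" and E: "E \<in> sets borel" "emeasure \<nu> E = 0"
  shows "AE t in lborel. t \<in> E \<longrightarrow>
    (\<forall>a>0. \<exists>d0>0. \<forall>d. 0 < d \<and> d < d0 \<longrightarrow> emeasure \<nu> {t-d<..<t+d} \<le> ennreal (a * d))"
proof -
  note [measurable_cong] = poisson_measureD(1)[OF \<nu>] and [simp] = poisson_measureD(1,2)[OF \<nu>]
  define \<kappa> where "\<kappa> = density \<nu> (\<lambda>s. ennreal (1 / (1 + s\<^sup>2)))"
  have sets [simp]: "sets \<kappa> = sets borel" by (simp add: \<kappa>_def)
  have em: "emeasure \<kappa> A = (\<integral>\<^sup>+s\<in>A. ennreal (1 / (1 + s\<^sup>2)) \<partial>\<nu>)" if "A \<in> sets borel" for A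
    unfolding \<kappa>_def using that by (subst emeasure_density) auto
  have "emeasure \<kappa> UNIV < \<infinity>"
    using poisson_measureD(3)[OF \<nu>] by (simp add: em nn_integral_eq_integral)
  moreover have "emeasure \<kappa> E = 0"
    using E by (simp add: em nn_integral_null_set null_sets_def)
  ultimately have "AE t in lborel. t \<in> E \<longrightarrow>
    (\<forall>a>0. \<exists>d0>0. \<forall>d. 0 < d \<and> d < d0 \<longrightarrow> emeasure \<kappa> {t-d<..<t+d} \<le> ennreal (a * d))"
    using E by (intro AE_symmetric_density_zero_finite) auto
  then show ?thesis
  proof (rule AE_mp, intro AE_I2 impI allI)
    fix t a :: real
    assume H: "t \<in> E \<longrightarrow> (\<forall>a>0. \<exists>d0>0. \<forall>d. 0 < d \<and> d < d0 \<longrightarrow> emeasure \<kappa> {t-d<..<t+d} \<le> ennreal (a * d))"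
      and "t \<in> E" "0 < a"
    define C where "C = 1 + (\<bar>t\<bar> + 1)\<^sup>2"
    have C: "C > 0" by (simp add: C_def add_pos_nonneg)
    obtain d0 where d0: "d0 > 0" "\<And>d. 0 < d \<Longrightarrow> d < d0 \<Longrightarrow> emeasure \<kappa> {t-d<..<t+d} \<le> ennreal (a / C * d)"
      using H \<open>t \<in> E\<close> \<open>0 < a\<close> C by (metis divide_pos_pos)
    have "emeasure \<nu> {t-d<..<t+d} \<le> ennreal (a * d)" if "0 < d" "d < min d0 1" for d
    proof -
      have "emeasure \<nu> {t-d<..<t+d} = (\<integral>\<^sup>+s. indicator {t-d<..<t+d} s \<partial>\<nu>)" by simp
      also have "\<dots> \<le> (\<integral>\<^sup>+s. ennreal C * (ennreal (1 / (1 + s\<^sup>2)) * indicator {t-d<..<t+d} s) \<partial>\<nu>)"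
      proof (intro nn_integral_mono)
        fix s
        have "1 \<le> C * (1 / (1 + s\<^sup>2))" if "s \<in> {t-d<..<t+d}"
        proof -
          have "\<bar>s\<bar> \<le> \<bar>t\<bar> + 1" using that \<open>d < min d0 1\<close> by auto
          then have "s\<^sup>2 \<le> (\<bar>t\<bar> + 1)\<^sup>2" by (metis abs_ge_zero power2_abs power_mono)
          then show ?thesis by (simp add: C_def field_simps add_pos_nonneg)
        qed
        then show "indicator {t-d<..<t+d} s \<le> ennreal C * (ennreal (1 / (1 + s\<^sup>2)) * indicator {t-d<..<t+d} s)"
          using C by (auto simp: indicator_def ennreal_mult[symmetric] simp flip: ennreal_1)
      qed
      also have "\<dots> = ennreal C * emeasure \<kappa> {t-d<..<t+d}"
        by (subst nn_integral_cmult) (auto simp: em)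
      also have "\<dots> \<le> ennreal C * ennreal (a / C * d)"
        using d0(2)[of d] that by (intro mult_left_mono) auto
      also have "\<dots> = ennreal (a * d)" using C \<open>0 < a\<close> that by (simp add: ennreal_mult[symmetric])
      finally show ?thesis .
    qed
    then show "\<exists>d0>0. \<forall>d. 0 < d \<and> d < d0 \<longrightarrow> emeasure \<nu> {t-d<..<t+d} \<le> ennreal (a * d)"
      using d0(1) by (intro exI[of _ "min d0 1"]) auto
  qed
qed

section \<open>From vanishing density to vanishing Poisson integrals\<close>

lemma four_power_eq: "(4::real)^k = 2^k * 2^k"
  by (simp flip: power_mult_distrib)

text \<open>One term of the series suffices: the least k with |t - s| < 2 ^ k \<epsilon>. If k = 0,
  the kernel is at most 1 / \<epsilon>. Otherwise |t - s| is at least 2 ^ (k - 1) \<epsilon>, which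
  costs the factor 4 in the bound.\<close>

lemma poisson_kernel_le_dyadic_sum:
  assumes "0 < \<epsilon>"
  shows "ennreal (\<epsilon> / ((t - s)\<^sup>2 + \<epsilon>\<^sup>2)) \<le>
    (\<Sum>k. ennreal (4 / (4^k * \<epsilon>)) * indicator {t - 2^k*\<epsilon><..<t + 2^k*\<epsilon>} s)"
proof -
  define P where "P k \<longleftrightarrow> \<bar>t - s\<bar> < 2^k * \<epsilon>" for k :: nat
  have "\<exists>k. P k"
    using real_arch_pow[of 2 "\<bar>t - s\<bar> / \<epsilon>"] assms by (auto simp: P_def field_simps)
  define k where "k = (LEAST k. P k)"
  have Pk: "P k" unfolding k_def using \<open>\<exists>k. P k\<close> by (rule LeastI_ex)
  have "\<epsilon> / ((t - s)\<^sup>2 + \<epsilon>\<^sup>2) \<le> 4 / (4^k * \<epsilon>)"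
  proof (cases k)
    case 0
    have "\<epsilon> / ((t - s)\<^sup>2 + \<epsilon>\<^sup>2) \<le> \<epsilon> / \<epsilon>\<^sup>2"
      using assms by (intro divide_left_mono) (auto intro!: mult_pos_pos add_nonneg_pos)
    also have "\<dots> \<le> 4 / \<epsilon>" using assms by (simp add: power2_eq_square field_simps)
    finally show ?thesis using 0 by simp
  next
    case (Suc j)
    then have "\<not> P j" unfolding k_def using not_less_Least by (metis lessI)
    then have "2^j * \<epsilon> \<le> \<bar>t - s\<bar>" by (simp add: P_def)
    then have le: "(2^j * \<epsilon>)\<^sup>2 \<le> (t - s)\<^sup>2"
      using assms by (metis abs_le_square_iff abs_of_pos mult_pos_pos zero_less_numeral zero_less_power)
    have "\<epsilon> / ((t - s)\<^sup>2 + \<epsilon>\<^sup>2) \<le> \<epsilon> / (2^j * \<epsilon>)\<^sup>2"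
      using assms le by (intro divide_left_mono) (auto intro: add_increasing2 mult_pos_pos simp: add_nonneg_pos)
    also have "(2^j * \<epsilon>)\<^sup>2 = 4^j * \<epsilon>\<^sup>2"
      by (simp add: power_mult_distrib power2_eq_square four_power_eq)
    also have "\<epsilon> / (4^j * \<epsilon>\<^sup>2) = 4 / (4^k * \<epsilon>)"
      using assms Suc by (simp add: power2_eq_square)
    finally show ?thesis .
  qed
  then have "ennreal (\<epsilon> / ((t - s)\<^sup>2 + \<epsilon>\<^sup>2)) \<le> ennreal (4 / (4^k * \<epsilon>)) * indicator {t - 2^k*\<epsilon><..<t + 2^k*\<epsilon>} s"
    using Pk by (auto simp: P_def indicator_def intro!: ennreal_leI)
  also have "\<dots> \<le> (\<Sum>k. ennreal (4 / (4^k * \<epsilon>)) * indicator {t - 2^k*\<epsilon><..<t + 2^k*\<epsilon>} s)"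
    using sum_le_suminf[of "\<lambda>k. ennreal (4 / (4^k * \<epsilon>)) * indicator {t - 2^k*\<epsilon><..<t + 2^k*\<epsilon>} s" "{k}"]
    by (simp del: sum_mult_indicator)
  finally show ?thesis .
qed

text \<open>By the dyadic bound, shell k contributes at most 4 / (4 ^ k \<epsilon>) times a 2 ^ k
  \<epsilon>, that is 4 a / 2 ^ k, and these terms add up to 8 a. The radii are cut off at r because
  the density bound is only available up to there.\<close>

lemma nn_integral_poisson_kernel_near_le:
  assumes sets [simp, measurable_cong]: "sets \<nu> = sets borel" and "0 < \<epsilon>" "0 < r" "0 \<le> a"
    and dens: "\<And>d. 0 < d \<Longrightarrow> d \<le> r \<Longrightarrow> emeasure \<nu> {t-d<..<t+d} \<le> ennreal (a * d)"
  shows "(\<integral>\<^sup>+s\<in>{t-r<..<t+r}. ennreal (\<epsilon> / ((t - s)\<^sup>2 + \<epsilon>\<^sup>2)) \<partial>\<nu>) \<le> ennreal (8 * a)"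
proof -
  have "(\<integral>\<^sup>+s\<in>{t-r<..<t+r}. ennreal (\<epsilon> / ((t - s)\<^sup>2 + \<epsilon>\<^sup>2)) \<partial>\<nu>) \<le>
    (\<integral>\<^sup>+s. (\<Sum>k. ennreal (4 / (4^k * \<epsilon>)) * indicator {t - min (2^k*\<epsilon>) r<..<t + min (2^k*\<epsilon>) r} s) \<partial>\<nu>)"
  proof (intro nn_integral_mono)
    fix s
    show "ennreal (\<epsilon> / ((t - s)\<^sup>2 + \<epsilon>\<^sup>2)) * indicator {t-r<..<t+r} s
      \<le> (\<Sum>k. ennreal (4 / (4^k * \<epsilon>)) * indicator {t - min (2^k*\<epsilon>) r<..<t + min (2^k*\<epsilon>) r} s)"
    proof (cases "s \<in> {t-r<..<t+r}")
      case True
      then have "indicator {t - min (2^k*\<epsilon>) r<..<t + min (2^k*\<epsilon>) r} s = (indicator {t - 2^k*\<epsilon><..<t + 2^k*\<epsilon>} s :: ennreal)" for k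
        by (auto simp: indicator_def)
      then show ?thesis using True poisson_kernel_le_dyadic_sum[OF \<open>0 < \<epsilon>\<close>, of t s] by simp
    qed simp
  qed
  also have "\<dots> = (\<Sum>k. ennreal (4 / (4^k * \<epsilon>)) * emeasure \<nu> {t - min (2^k*\<epsilon>) r<..<t + min (2^k*\<epsilon>) r})"
    by (subst nn_integral_suminf) (auto simp: nn_integral_cmult)
  also have "\<dots> \<le> (\<Sum>k. ennreal (4 * a * (1/2)^k))"
  proof (intro suminf_le)
    fix k :: nat
    have "emeasure \<nu> {t - min (2^k*\<epsilon>) r<..<t + min (2^k*\<epsilon>) r} \<le> ennreal (a * min (2^k*\<epsilon>) r)"
      using assms by (intro dens) auto
    also have "\<dots> \<le> ennreal (a * (2^k*\<epsilon>))"
      using assms by (intro ennreal_leI mult_left_mono) auto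
    finally have "ennreal (4 / (4^k * \<epsilon>)) * emeasure \<nu> {t - min (2^k*\<epsilon>) r<..<t + min (2^k*\<epsilon>) r}
      \<le> ennreal (4 / (4^k * \<epsilon>)) * ennreal (a * (2^k*\<epsilon>))" by (intro mult_left_mono) auto
    also have "\<dots> = ennreal (4 / (4^k * \<epsilon>) * (a * (2^k*\<epsilon>)))"
      using assms by (intro ennreal_mult[symmetric]) auto
    also have "4 / (4^k * \<epsilon>) * (a * (2^k*\<epsilon>)) = 4 * a * (1/2)^k"
      using assms by (simp add: four_power_eq power_divide)
    finally show "ennreal (4 / (4^k * \<epsilon>)) * emeasure \<nu> {t - min (2^k*\<epsilon>) r<..<t + min (2^k*\<epsilon>) r}
      \<le> ennreal (4 * a * (1/2)^k)" .
  qed auto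
  also have "\<dots> = ennreal (\<Sum>k. 4 * a * (1/2)^k)"
    using assms by (intro suminf_ennreal2 summable_mult summable_geometric) auto
  also have "(\<Sum>k. 4 * a * (1/2)^k) = 8 * a"
    by (subst suminf_mult) (auto simp: suminf_geometric)
  finally show ?thesis .
qed

text \<open>At distance at least r from t this trades \<open>\<epsilon>\<^sup>2\<close> for the
  fixed \<open>r\<^sup>2\<close>, so that bounds for the far part become uniform in
  \<epsilon>.\<close>

lemma inverse_sum_le:
  fixes x y z :: real
  assumes "0 < y" "y \<le> x" "0 \<le> z"
  shows "1 / (x + z) \<le> 2 * (1 / (x + y))"
proof -
  have "0 < x + z" "0 < x + y" using assms by linarith+
  moreover have "x + y \<le> 2 * (x + z)" using assms unfolding distrib_left by linarith
  ultimately show ?thesis by (simp add: field_simps)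
qed

lemma poisson_tendsto_zero:
  assumes \<nu>: "poisson_measure \<nu>"
    and dens: "\<And>a. a > 0 \<Longrightarrow> \<exists>d0>0. \<forall>d. 0 < d \<and> d < d0 \<longrightarrow> emeasure \<nu> {t-d<..<t+d} \<le> ennreal (a * d)"
  shows "((\<lambda>\<epsilon>. poisson \<nu> t \<epsilon>) \<longlongrightarrow> 0) (at_right 0)"
proof (rule tendstoI)
  fix e :: real assume "e > 0"
  note [measurable_cong] = poisson_measureD(1)[OF \<nu>] and [simp] = poisson_measureD(1,2)[OF \<nu>]
  \<comment> \<open>With this constant the part near t contributes at most 8 (e / 16) = e / 2; the
    part beyond r is of order \<epsilon>.\<close>
  obtain d0 where d0: "d0 > 0" "\<And>d. 0 < d \<Longrightarrow> d < d0 \<Longrightarrow> emeasure \<nu> {t-d<..<t+d} \<le> ennreal (e/16 * d)"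
    using dens[of "e/16"] \<open>e > 0\<close> by auto
  define r where "r = d0/2"
  have r: "0 < r" "r < d0" using d0 by (auto simp: r_def)
  define I where "I = (LINT s|\<nu>. 1 / (1 + s\<^sup>2))"
  define C where "C = 2 * (2 + (1 + 2*t\<^sup>2) / r\<^sup>2) * I"
  have I0: "I \<ge> 0" by (simp add: I_def)
  have C0: "C \<ge> 0" unfolding C_def using I0 by (intro mult_nonneg_nonneg add_nonneg_nonneg divide_nonneg_nonneg) auto
  have bound: "poisson \<nu> t \<epsilon> \<le> (e / 2 + \<epsilon> * C) / pi" if "0 < \<epsilon>" for \<epsilon>
  proof -
    have far: "ennreal (\<epsilon> / ((t - s)\<^sup>2 + \<epsilon>\<^sup>2)) * indicator (- {t-r<..<t+r}) s
       \<le> ennreal (\<epsilon> * (2 * (2 + (1 + 2*t\<^sup>2) / r\<^sup>2))) * ennreal (1 / (1 + s\<^sup>2))" for s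
    proof (cases "s \<in> {t-r<..<t+r}")
      case False
      then have "r \<le> \<bar>t - s\<bar>" by auto
      then have "r\<^sup>2 \<le> (t - s)\<^sup>2" using r(1) by (metis abs_le_square_iff abs_of_pos)
      have rpos: "0 < r\<^sup>2" using r by simp
      have "1 / ((t - s)\<^sup>2 + \<epsilon>\<^sup>2) \<le> 2 * (1 / ((t - s)\<^sup>2 + r\<^sup>2))"
        using \<open>r\<^sup>2 \<le> (t - s)\<^sup>2\<close> rpos by (intro inverse_sum_le) simp_all
      also have "\<dots> \<le> 2 * ((2 + (1 + 2*t\<^sup>2) / r\<^sup>2) * (1 / (1 + s\<^sup>2)))"
        using r by (intro mult_left_mono inverse_shifted_square_le) auto
      finally have "\<epsilon> * (1 / ((t - s)\<^sup>2 + \<epsilon>\<^sup>2)) \<le> \<epsilon> * (2 * ((2 + (1 + 2*t\<^sup>2) / r\<^sup>2) * (1 / (1 + s\<^sup>2))))"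
        using that by (intro mult_left_mono) auto
      then have "ennreal (\<epsilon> / ((t - s)\<^sup>2 + \<epsilon>\<^sup>2)) \<le> ennreal (\<epsilon> * (2 * (2 + (1 + 2*t\<^sup>2) / r\<^sup>2)) * (1 / (1 + s\<^sup>2)))"
        by (intro ennreal_leI) (simp add: mult.assoc)
      also have "\<dots> = ennreal (\<epsilon> * (2 * (2 + (1 + 2*t\<^sup>2) / r\<^sup>2))) * ennreal (1 / (1 + s\<^sup>2))"
        using that by (intro ennreal_mult) (auto intro!: mult_nonneg_nonneg add_nonneg_nonneg divide_nonneg_nonneg)
      finally show ?thesis using False by simp
    qed simp
    have "(\<integral>\<^sup>+s. ennreal (\<epsilon> / ((t - s)\<^sup>2 + \<epsilon>\<^sup>2)) \<partial>\<nu>) =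
      (\<integral>\<^sup>+s. ennreal (\<epsilon> / ((t - s)\<^sup>2 + \<epsilon>\<^sup>2)) * indicator {t-r<..<t+r} s +
         ennreal (\<epsilon> / ((t - s)\<^sup>2 + \<epsilon>\<^sup>2)) * indicator (- {t-r<..<t+r}) s \<partial>\<nu>)"
      by (intro nn_integral_cong) (auto simp: indicator_def)
    also have "\<dots> = (\<integral>\<^sup>+s\<in>{t-r<..<t+r}. ennreal (\<epsilon> / ((t - s)\<^sup>2 + \<epsilon>\<^sup>2)) \<partial>\<nu>) +
       (\<integral>\<^sup>+s\<in>- {t-r<..<t+r}. ennreal (\<epsilon> / ((t - s)\<^sup>2 + \<epsilon>\<^sup>2)) \<partial>\<nu>)"
      by (intro nn_integral_add) auto
    also have "\<dots> \<le> ennreal (8 * (e/16)) + (\<integral>\<^sup>+s. ennreal (\<epsilon> * (2 * (2 + (1 + 2*t\<^sup>2) / r\<^sup>2))) * ennreal (1 / (1 + s\<^sup>2)) \<partial>\<nu>)"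
      using d0 r \<open>e > 0\<close> that far
      by (intro add_mono nn_integral_poisson_kernel_near_le nn_integral_mono) auto
    also have "(\<integral>\<^sup>+s. ennreal (\<epsilon> * (2 * (2 + (1 + 2*t\<^sup>2) / r\<^sup>2))) * ennreal (1 / (1 + s\<^sup>2)) \<partial>\<nu>) =
       ennreal (\<epsilon> * (2 * (2 + (1 + 2*t\<^sup>2) / r\<^sup>2))) * ennreal I"
      unfolding I_def using poisson_measureD(3)[OF \<nu>]
      by (subst nn_integral_cmult) (auto simp: nn_integral_eq_integral)
    also have "\<dots> = ennreal (\<epsilon> * C)"
      unfolding C_def using I0 that
      by (subst ennreal_mult[symmetric]) (auto intro!: mult_nonneg_nonneg add_nonneg_nonneg divide_nonneg_nonneg simp: mult_ac)
    finally have *: "(\<integral>\<^sup>+s. ennreal (\<epsilon> / ((t - s)\<^sup>2 + \<epsilon>\<^sup>2)) \<partial>\<nu>) \<le> ennreal (e / 2 + \<epsilon> * C)"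
      using \<open>e > 0\<close> that C0 by (simp add: ennreal_plus[symmetric] del: ennreal_plus)
    have "ennreal (poisson \<nu> t \<epsilon>) = (\<integral>\<^sup>+s. ennreal (1/pi) * ennreal (\<epsilon> / ((t - s)\<^sup>2 + \<epsilon>\<^sup>2)) \<partial>\<nu>)"
      using that by (subst ennreal_poisson[OF \<nu>])
        (auto simp: poisson_kernel_def ennreal_mult[symmetric] intro!: nn_integral_cong)
    also have "\<dots> = ennreal (1/pi) * (\<integral>\<^sup>+s. ennreal (\<epsilon> / ((t - s)\<^sup>2 + \<epsilon>\<^sup>2)) \<partial>\<nu>)"
      by (intro nn_integral_cmult) auto
    also have "\<dots> \<le> ennreal (1/pi) * ennreal (e / 2 + \<epsilon> * C)" using * by (intro mult_left_mono) auto
    also have "\<dots> = ennreal ((e / 2 + \<epsilon> * C) / pi)"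
      using \<open>e > 0\<close> that C0 by (subst ennreal_mult[symmetric]) auto
    finally show ?thesis using \<open>e > 0\<close> that C0 by (simp add: ennreal_le_iff)
  qed
  have "((\<lambda>\<epsilon>. (e/2 + \<epsilon> * C) / pi) \<longlongrightarrow> (e/2 + 0 * C) / pi) (at_right 0)"
    by (intro tendsto_intros) auto
  moreover have "(e/2 + 0 * C) / pi < e"
    using \<open>e > 0\<close> pi_gt3 by (simp add: field_simps)
  ultimately have "\<forall>\<^sub>F \<epsilon> in at_right 0. (e/2 + \<epsilon> * C) / pi < e" by (rule order_tendstoD(2))
  then show "\<forall>\<^sub>F \<epsilon> in at_right 0. dist (poisson \<nu> t \<epsilon>) 0 < e"
    using eventually_at_right_less[of "0::real"]
  proof eventually_elim
    case (elim \<epsilon>)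
    then show ?case using bound[of \<epsilon>] poisson_nonneg[of \<epsilon> \<nu> t] by auto
  qed
qed

lemma AE_poisson_tendsto_zero:
  assumes "poisson_measure \<nu>" "E \<in> sets borel" "emeasure \<nu> E = 0"
  shows "AE t in lborel. t \<in> E \<longrightarrow> ((\<lambda>\<epsilon>. poisson \<nu> t \<epsilon>) \<longlongrightarrow> 0) (at_right 0)"
  using AE_symmetric_density_zero[OF assms]
  by eventually_elim (auto intro: poisson_tendsto_zero[OF assms(1)])

section \<open>Additivity of Poisson integrals in the measure\<close>

lemma nn_integral_measure_add:
  assumes [measurable_cong]: "sets \<nu> = sets borel" "sets \<nu>1 = sets borel" "sets \<nu>2 = sets borel"
    and add: "\<And>A. A \<in> sets borel \<Longrightarrow> emeasure \<nu> A = emeasure \<nu>1 A + emeasure \<nu>2 A"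
    and h: "h \<in> borel_measurable borel"
  shows "(\<integral>\<^sup>+s. h s \<partial>\<nu>) = (\<integral>\<^sup>+s. h s \<partial>\<nu>1) + (\<integral>\<^sup>+s. h s \<partial>\<nu>2)"
  using h
proof (induction rule: borel_measurable_induct)
  case (cong f g)
  then show ?case by (simp add: space_borel cong: nn_integral_cong)
next
  case (set A)
  then show ?case using assms by simp
next
  case (mult u c)
  then have [measurable]: "u \<in> borel_measurable borel" by simp
  show ?case using mult by (simp add: nn_integral_cmult distrib_left)
next
  case (add u v)
  then have [measurable]: "u \<in> borel_measurable borel" "v \<in> borel_measurable borel" by simp_all
  show ?case using add by (simp add: nn_integral_add ac_simps)
next
  case (seq U)
  then have [measurable]: "\<And>i. U i \<in> borel_measurable borel" by simp
  have m: "(\<lambda>i. \<integral>\<^sup>+s. U i s \<partial>M) \<longlonglongrightarrow> (\<integral>\<^sup>+s. Sup (range U) s \<partial>M)" if [measurable_cong]: "sets M = sets borel" for M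
  proof -
    have "(\<integral>\<^sup>+s. Sup (range U) s \<partial>M) = (SUP i. \<integral>\<^sup>+s. U i s \<partial>M)"
      using nn_integral_monotone_convergence_SUP[OF seq(3), of M] by (simp add: image_comp)
    moreover have "incseq (\<lambda>i. \<integral>\<^sup>+s. U i s \<partial>M)"
      using seq(3) by (auto simp: incseq_def le_fun_def intro!: nn_integral_mono)
    ultimately show ?thesis by (metis LIMSEQ_SUP)
  qed
  have "(\<lambda>i. (\<integral>\<^sup>+s. U i s \<partial>\<nu>1) + (\<integral>\<^sup>+s. U i s \<partial>\<nu>2)) \<longlonglongrightarrow>
      (\<integral>\<^sup>+s. Sup (range U) s \<partial>\<nu>1) + (\<integral>\<^sup>+s. Sup (range U) s \<partial>\<nu>2)"
    using assms by (intro tendsto_add m) auto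
  moreover have "(\<lambda>i. (\<integral>\<^sup>+s. U i s \<partial>\<nu>1) + (\<integral>\<^sup>+s. U i s \<partial>\<nu>2)) \<longlonglongrightarrow> (\<integral>\<^sup>+s. Sup (range U) s \<partial>\<nu>)"
    using m[of \<nu>] assms seq(4) by (simp only: flip: seq.IH)
  ultimately show ?case by (metis LIMSEQ_unique)
qed

lemma poisson_measure_iff:
  "poisson_measure \<nu> \<longleftrightarrow> sets \<nu> = sets borel \<and> (\<integral>\<^sup>+s. ennreal (1 / (1 + s\<^sup>2)) \<partial>\<nu>) < \<infinity>"
proof -
  have "integrable \<nu> (\<lambda>s. 1 / (1 + s\<^sup>2)) \<longleftrightarrow> (\<integral>\<^sup>+s. ennreal (1 / (1 + s\<^sup>2)) \<partial>\<nu>) < \<infinity>"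
    if [measurable_cong]: "sets \<nu> = sets borel"
    by (subst integrable_iff_bounded) auto
  then show ?thesis by (auto simp: poisson_measure_def)
qed

lemma poisson_measure_add:
  assumes "sets \<nu> = sets borel" "sets \<nu>1 = sets borel" "sets \<nu>2 = sets borel"
    and add: "\<And>A. A \<in> sets borel \<Longrightarrow> emeasure \<nu> A = emeasure \<nu>1 A + emeasure \<nu>2 A"
  shows "poisson_measure \<nu> \<longleftrightarrow> poisson_measure \<nu>1 \<and> poisson_measure \<nu>2"
  unfolding poisson_measure_iff using assms
  by (subst nn_integral_measure_add[OF assms]) auto

lemma poisson_add:
  assumes add: "\<And>A. A \<in> sets borel \<Longrightarrow> emeasure \<nu> A = emeasure \<nu>1 A + emeasure \<nu>2 A"
    and pm: "poisson_measure \<nu>" "poisson_measure \<nu>1" "poisson_measure \<nu>2" and "0 \<le> \<epsilon>"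
  shows "poisson \<nu> t \<epsilon> = poisson \<nu>1 t \<epsilon> + poisson \<nu>2 t \<epsilon>"
proof -
  have "ennreal (poisson \<nu> t \<epsilon>) = ennreal (poisson \<nu>1 t \<epsilon>) + ennreal (poisson \<nu>2 t \<epsilon>)"
    using pm \<open>0 \<le> \<epsilon>\<close> by (simp add: ennreal_poisson poisson_measureD nn_integral_measure_add[OF _ _ _ add])
  then show ?thesis
    using poisson_nonneg[OF \<open>0 \<le> \<epsilon>\<close>]
    by (simp add: ennreal_plus[symmetric] add_nonneg_nonneg del: ennreal_plus)
qed

section \<open>Fatou's theorem for Poisson integrals and the Lebesgue decomposition\<close>

lemma poisson_measure_lborel: "poisson_measure lborel"
  and poisson_lborel: "0 < \<epsilon> \<Longrightarrow> poisson lborel t \<epsilon> = 1"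
proof -
  have int: "integrable lborel (\<lambda>x::real. inverse (1 + x\<^sup>2))" "(LINT x|lborel. inverse (1 + x\<^sup>2 :: real)) = pi"
    using integrable_inverse_1_plus_square LBINT_inverse_1_plus_square
    by (simp_all add: set_integrable_def interval_lebesgue_integral_def set_lebesgue_integral_def)
  then show "poisson_measure lborel" by (simp add: poisson_measure_def inverse_eq_divide)
  assume "0 < \<epsilon>"
  have "poisson lborel t \<epsilon> = \<bar>\<epsilon>\<bar> *\<^sub>R (LINT x|lborel. poisson_kernel t \<epsilon> (t + \<epsilon> * x))"
    unfolding poisson_def using \<open>0 < \<epsilon>\<close> by (subst lborel_integral_real_affine[of \<epsilon> _ t]) auto
  also have "\<dots> = (LINT x|lborel. inverse (1 + x\<^sup>2) / pi)"
    unfolding integral_scaleR_right[symmetric]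
  proof (intro Bochner_Integration.integral_cong)
    fix x :: real
    have "(\<epsilon> * x)\<^sup>2 + \<epsilon>\<^sup>2 = \<epsilon> * (\<epsilon> * (1 + x\<^sup>2))" by (simp add: power2_eq_square algebra_simps)
    moreover have "1 + x\<^sup>2 > 0" by (simp add: add_pos_nonneg)
    ultimately show "\<bar>\<epsilon>\<bar> *\<^sub>R poisson_kernel t \<epsilon> (t + \<epsilon> * x) = inverse (1 + x\<^sup>2) / pi"
      using \<open>0 < \<epsilon>\<close> by (simp add: poisson_kernel_def inverse_eq_divide)
  qed simp
  finally show "poisson lborel t \<epsilon> = 1" using int by simp
qed

text \<open>For rational \<open>q\<close> the measure with density \<open>max 0 (f - q)\<close> vanishes on \<open>{f \<le> q}\<close>, so its Poisson integral
  tends to \<open>0\<close> almost everywhere there; this bounds the Poisson integral of \<open>f\<close> from above by \<open>q\<close>.\<close>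

lemma AE_poisson_density_tendsto:
  assumes [measurable]: "f \<in> borel_measurable borel" and nn: "\<And>s. 0 \<le> f s"
    and pm: "poisson_measure (density lborel (\<lambda>s. ennreal (f s)))"
  shows "AE t in lborel. ((\<lambda>\<epsilon>. poisson (density lborel (\<lambda>s. ennreal (f s))) t \<epsilon>) \<longlongrightarrow> f t) (at_right 0)"
proof -
  define D where "D g = density lborel (\<lambda>s. ennreal (g s))" for g :: "real \<Rightarrow> real"
  have [simp]: "sets (D g) = sets borel" for g by (simp add: D_def)
  have Dadd: "emeasure (D (\<lambda>s. g s + h s)) A = emeasure (D g) A + emeasure (D h) A"
    if [measurable]: "g \<in> borel_measurable borel" "h \<in> borel_measurable borel" "A \<in> sets borel"
      and "\<And>s. 0 \<le> g s" "\<And>s. 0 \<le> h s" for g h A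
    unfolding D_def using that
    by (simp add: emeasure_density distrib_right nn_integral_add)
  have Dconst: "poisson_measure (D (\<lambda>s. q))" "0 \<le> q \<Longrightarrow> 0 < \<epsilon> \<Longrightarrow> poisson (D (\<lambda>s. q)) t \<epsilon> = q" for q t \<epsilon>
  proof -
    have "(\<integral>\<^sup>+s. ennreal (1 / (1 + s\<^sup>2)) \<partial>D (\<lambda>s. q)) = ennreal q * (\<integral>\<^sup>+s. ennreal (1 / (1 + s\<^sup>2)) \<partial>lborel)"
      unfolding D_def by (simp add: nn_integral_density nn_integral_cmult)
    also have "\<dots> < \<infinity>"
      using poisson_measure_lborel by (simp add: poisson_measure_iff ennreal_mult_less_top)
    finally show "poisson_measure (D (\<lambda>s. q))" by (simp add: poisson_measure_iff)
    assume "0 \<le> q" "0 < \<epsilon>"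
    have "poisson (D (\<lambda>s. q)) t \<epsilon> = q * poisson lborel t \<epsilon>"
      unfolding D_def poisson_def using \<open>0 \<le> q\<close> by (subst integral_density) auto
    then show "poisson (D (\<lambda>s. q)) t \<epsilon> = q" using \<open>0 < \<epsilon>\<close> by (simp add: poisson_lborel)
  qed
  define Bq where "Bq q s = max 0 (q - f s)" for q s :: real
  define Cq where "Cq q s = max 0 (f s - q)" for q s :: real
  have [measurable]: "Bq q \<in> borel_measurable borel" "Cq q \<in> borel_measurable borel" for q
    unfolding Bq_def[abs_def] Cq_def[abs_def] by measurable
  have nnB: "0 \<le> Bq q s" "0 \<le> Cq q s" for q s by (auto simp: Bq_def Cq_def)
  \<comment> \<open>Both sides are the maximum of f and q. The Poisson integral of f is thus
    compared with q by adding nonnegative measures only, without subtracting measures.\<close>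
  have eq: "(\<lambda>s. f s + Bq q s) = (\<lambda>s. q + Cq q s)" for q by (auto simp: Bq_def Cq_def)
  have pmf: "poisson_measure (D f)" using pm by (simp add: D_def)
  have mono: "poisson_measure (D g)" if "poisson_measure (D h)" "\<And>s. g s \<le> h s"
     and [measurable]: "g \<in> borel_measurable borel" "h \<in> borel_measurable borel" for g h
  proof -
    have "(\<integral>\<^sup>+s. ennreal (1 / (1 + s\<^sup>2)) \<partial>D g) \<le> (\<integral>\<^sup>+s. ennreal (1 / (1 + s\<^sup>2)) \<partial>D h)"
      unfolding D_def using that(2)
      by (simp add: nn_integral_density) (auto intro!: nn_integral_mono mult_right_mono ennreal_leI)
    then show ?thesis using that(1) by (auto simp: poisson_measure_iff)
  qed
  have pmB: "poisson_measure (D (Bq q))" and pmC: "poisson_measure (D (Cq q))" if "0 \<le> q" for q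
    using mono[OF Dconst(1)[of q], of "Bq q"] mono[OF pmf, of "Cq q"] that nn
    by (auto simp: Bq_def Cq_def max_def intro: order_trans) 
  have id: "poisson (D f) t \<epsilon> + poisson (D (Bq q)) t \<epsilon> = q + poisson (D (Cq q)) t \<epsilon>" if "0 \<le> q" "0 < \<epsilon>" for q t \<epsilon>
  proof -
    have "poisson_measure (D (\<lambda>s. f s + Bq q s))"
      using poisson_measure_add[of "D (\<lambda>s. f s + Bq q s)" "D f" "D (Bq q)"] Dadd[of f "Bq q"] nn nnB pmf pmB that by simp
    then have "poisson (D (\<lambda>s. f s + Bq q s)) t \<epsilon> = poisson (D f) t \<epsilon> + poisson (D (Bq q)) t \<epsilon>"
      using that nn nnB pmf pmB by (intro poisson_add Dadd) auto
    moreover have "poisson (D (\<lambda>s. q + Cq q s)) t \<epsilon> = poisson (D (\<lambda>s. q)) t \<epsilon> + poisson (D (Cq q)) t \<epsilon>"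
      using \<open>poisson_measure (D (\<lambda>s. f s + Bq q s))\<close> that nnB Dconst(1) pmC unfolding eq
      by (intro poisson_add Dadd) auto
    ultimately show ?thesis using Dconst(2)[OF that] unfolding eq by simp
  qed
  \<comment> \<open>Restricting q to rationals makes the exceptional null set independent of q; an
    arbitrary real bound on the limit is then approached through rationals at each remaining
    point.\<close>
  have AE: "AE t in lborel. \<forall>q\<in>\<rat> \<inter> {0..}.
     (t \<in> {t. f t \<le> q} \<longrightarrow> ((\<lambda>\<epsilon>. poisson (D (Cq q)) t \<epsilon>) \<longlongrightarrow> 0) (at_right 0)) \<and>
     (t \<in> {t. q \<le> f t} \<longrightarrow> ((\<lambda>\<epsilon>. poisson (D (Bq q)) t \<epsilon>) \<longlongrightarrow> 0) (at_right 0))"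
  proof (intro AE_ball_countable' AE_conjI AE_poisson_tendsto_zero)
    fix q :: real assume q: "q \<in> \<rat> \<inter> {0..}"
    show "poisson_measure (D (Cq q))" "poisson_measure (D (Bq q))" using pmB pmC q by auto
    show "{t. f t \<le> q} \<in> sets borel" "{t. q \<le> f t} \<in> sets borel" by measurable
    show "emeasure (D (Cq q)) {t. f t \<le> q} = 0"
      unfolding D_def by (subst emeasure_density) (auto simp: Cq_def indicator_def ennreal_neg nn_integral_0_iff_AE)
    show "emeasure (D (Bq q)) {t. q \<le> f t} = 0"
      unfolding D_def by (subst emeasure_density) (auto simp: Bq_def indicator_def ennreal_neg nn_integral_0_iff_AE)
  next
    show "countable (\<rat> \<inter> {0..} :: real set)" using countable_rat by blast
  qed
  have pos: "\<forall>\<^sub>F \<epsilon> in at_right (0::real). 0 < \<epsilon>" by (rule eventually_at_right_less)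
  from AE have "AE t in lborel. ((\<lambda>\<epsilon>. poisson (D f) t \<epsilon>) \<longlongrightarrow> f t) (at_right 0)"
  proof (rule AE_mp, intro AE_I2 impI)
    fix t assume H: "\<forall>q\<in>\<rat> \<inter> {0..}.
     (t \<in> {t. f t \<le> q} \<longrightarrow> ((\<lambda>\<epsilon>. poisson (D (Cq q)) t \<epsilon>) \<longlongrightarrow> 0) (at_right 0)) \<and>
     (t \<in> {t. q \<le> f t} \<longrightarrow> ((\<lambda>\<epsilon>. poisson (D (Bq q)) t \<epsilon>) \<longlongrightarrow> 0) (at_right 0))"
    show "((\<lambda>\<epsilon>. poisson (D f) t \<epsilon>) \<longlongrightarrow> f t) (at_right 0)"
    proof (rule order_tendstoI)
      fix a assume a: "f t < a"
      obtain q where q: "q \<in> \<rat>" "f t < q" "q < a" using Rats_dense_in_real[OF a] by blast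
      then have q0: "0 \<le> q" using nn[of t] by linarith
      have "((\<lambda>\<epsilon>. poisson (D (Cq q)) t \<epsilon>) \<longlongrightarrow> 0) (at_right 0)" using H q q0 by auto
      then have "\<forall>\<^sub>F \<epsilon> in at_right 0. poisson (D (Cq q)) t \<epsilon> < a - q"
        by (rule order_tendstoD) (use q in simp)
      with pos show "\<forall>\<^sub>F \<epsilon> in at_right 0. poisson (D f) t \<epsilon> < a"
      proof eventually_elim
        case (elim \<epsilon>)
        then show ?case using id[OF q0 elim(1), of t] poisson_nonneg[of \<epsilon> "D (Bq q)" t] by simp
      qed
    next
      fix a assume a: "a < f t"
      show "\<forall>\<^sub>F \<epsilon> in at_right 0. a < poisson (D f) t \<epsilon>"
      proof (cases "a < 0")
        case True
        from pos show ?thesis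
          by eventually_elim (use True poisson_nonneg[of _ "D f" t] in \<open>auto intro: less_le_trans less_imp_le\<close>)
      next
        case False
        obtain q where q: "q \<in> \<rat>" "a < q" "q < f t" using Rats_dense_in_real[OF a] by blast
        then have q0: "0 \<le> q" using False by linarith
        have "((\<lambda>\<epsilon>. poisson (D (Bq q)) t \<epsilon>) \<longlongrightarrow> 0) (at_right 0)" using H q q0 by auto
        then have "\<forall>\<^sub>F \<epsilon> in at_right 0. poisson (D (Bq q)) t \<epsilon> < q - a"
          by (rule order_tendstoD) (use q in simp)
        with pos show "\<forall>\<^sub>F \<epsilon> in at_right 0. a < poisson (D f) t \<epsilon>"
        proof eventually_elim
          case (elim \<epsilon>)
          then show ?case using id[OF q0 elim(1), of t] poisson_nonneg[of \<epsilon> "D (Cq q)" t] by simp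
        qed
      qed
    qed
  qed
  then show ?thesis by (simp add: D_def)
qed

text \<open>The singular part does not charge the complement of the null set N, so its Poisson
  integral tends to 0 at almost every point of that complement, hence almost everywhere.\<close>

lemma AE_poisson_tendsto_density:
  assumes cd: "continuous_density \<nu> f" and pm: "poisson_measure \<nu>"
  shows "AE t in lborel. ((\<lambda>\<epsilon>. poisson \<nu> t \<epsilon>) \<longlongrightarrow> f t) (at_right 0)"
proof -
  obtain \<sigma> N where f [measurable]: "f \<in> borel_measurable borel" and nn: "\<And>s. 0 \<le> f s"
    and \<sigma>: "sets \<sigma> = sets borel" and N: "N \<in> null_sets lborel" and N0: "emeasure \<sigma> (- N) = 0"
    and add: "\<And>A. A \<in> sets borel \<Longrightarrow> emeasure \<nu> A = emeasure (density lborel (\<lambda>s. ennreal (f s))) A + emeasure \<sigma> A"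
    using cd unfolding continuous_density_def by auto
  define D where "D = density lborel (\<lambda>s. ennreal (f s))"
  have "poisson_measure D" and pm\<sigma>: "poisson_measure \<sigma>"
    using poisson_measure_add[of \<nu> D \<sigma>] add \<sigma> pm by (auto simp: D_def)
  have "AE t in lborel. ((\<lambda>\<epsilon>. poisson D t \<epsilon>) \<longlongrightarrow> f t) (at_right 0)"
    unfolding D_def using \<open>poisson_measure D\<close> nn by (intro AE_poisson_density_tendsto) (auto simp: D_def)
  moreover have "AE t in lborel. t \<in> - N \<longrightarrow> ((\<lambda>\<epsilon>. poisson \<sigma> t \<epsilon>) \<longlongrightarrow> 0) (at_right 0)"
    using N N0 pm\<sigma> by (intro AE_poisson_tendsto_zero) auto
  moreover have "AE t in lborel. t \<notin> N" using N by (rule AE_not_in)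
  ultimately show ?thesis
  proof eventually_elim
    case (elim t)
    then have "((\<lambda>\<epsilon>. poisson D t \<epsilon> + poisson \<sigma> t \<epsilon>) \<longlongrightarrow> f t + 0) (at_right 0)"
      by (intro tendsto_add) auto
    moreover have "\<forall>\<^sub>F \<epsilon> in at_right 0. poisson D t \<epsilon> + poisson \<sigma> t \<epsilon> = poisson \<nu> t \<epsilon>"
      using eventually_at_right_less[of "0::real"]
      by eventually_elim (use add pm pm\<sigma> \<open>poisson_measure D\<close> in \<open>auto simp: D_def intro!: poisson_add[symmetric]\<close>)
    ultimately show ?case by (simp add: tendsto_cong)
  qed
qed

lemma emeasure_compact_poisson_measure:
  assumes pm: "poisson_measure \<nu>" and "compact K"
  shows "emeasure \<nu> K < \<infinity>"
proof -
  note [measurable_cong] = poisson_measureD(1)[OF pm] and [simp] = poisson_measureD(1,2)[OF pm]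
  obtain r where r: "\<And>s. s \<in> K \<Longrightarrow> \<bar>s\<bar> \<le> r"
    using compact_imp_bounded[OF \<open>compact K\<close>] by (auto simp: bounded_iff)
  have [measurable]: "K \<in> sets borel" using \<open>compact K\<close> by (rule borel_compact)
  have "emeasure \<nu> K = (\<integral>\<^sup>+s. indicator K s \<partial>\<nu>)" by simp
  also have "\<dots> \<le> (\<integral>\<^sup>+s. ennreal (1 + r\<^sup>2) * ennreal (1 / (1 + s\<^sup>2)) \<partial>\<nu>)"
  proof (intro nn_integral_mono)
    fix s
    have "1 \<le> (1 + r\<^sup>2) * (1 / (1 + s\<^sup>2))" if "s \<in> K"
    proof -
      have "\<bar>s\<bar> \<le> \<bar>r\<bar>" using r[OF that] by linarith
      then have "s\<^sup>2 \<le> r\<^sup>2" by (simp add: abs_le_square_iff)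
      then show ?thesis by (simp add: field_simps add_pos_nonneg)
    qed
    then show "indicator K s \<le> ennreal (1 + r\<^sup>2) * ennreal (1 / (1 + s\<^sup>2))"
      by (auto simp: indicator_def ennreal_mult[symmetric] simp del: ennreal_plus simp flip: ennreal_1)
  qed
  also have "\<dots> = ennreal (1 + r\<^sup>2) * (\<integral>\<^sup>+s. ennreal (1 / (1 + s\<^sup>2)) \<partial>\<nu>)"
    by (intro nn_integral_cmult) auto
  also have "\<dots> < \<infinity>" using pm by (simp add: poisson_measure_iff ennreal_mult_less_top)
  finally show ?thesis .
qed

lemma sigma_finite_poisson_measure:
  assumes pm: "poisson_measure \<nu>"
  shows "sigma_finite_measure \<nu>"
proof
  have "\<exists>n. - real n \<le> x \<and> x \<le> real n" for x
    using real_arch_simple[of "\<bar>x\<bar>"] by (auto simp: abs_le_iff minus_le_iff)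
  then show "\<exists>A. countable A \<and> A \<subseteq> sets \<nu> \<and> \<Union>A = space \<nu> \<and> (\<forall>a\<in>A. emeasure \<nu> a \<noteq> \<infinity>)"
    using poisson_measureD(1,2)[OF pm] emeasure_compact_poisson_measure[OF pm]
    by (intro exI[of _ "range (\<lambda>n. {- real n..real n})"]) (auto simp: less_top)
qed

text \<open>The carrier N of the singular part is a Lebesgue null set on which the finite measure
  \<kappa>, equivalent to \<nu>, attains its supremum over null sets. Any null set charged by \<nu>
  outside N would enlarge that supremum, so off N the Radon-Nikodym theorem applies.\<close>

lemma ex_continuous_density:
  assumes pm: "poisson_measure \<nu>"
  shows "\<exists>f. continuous_density \<nu> f"
proof -
  note [measurable_cong] = poisson_measureD(1)[OF pm] and [simp] = poisson_measureD(1,2)[OF pm]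
  define \<kappa> where "\<kappa> = density \<nu> (\<lambda>s. ennreal (1 / (1 + s\<^sup>2)))"
  have [simp]: "sets \<kappa> = sets borel" "space \<kappa> = UNIV" by (simp_all add: \<kappa>_def)
  interpret \<kappa>: finite_measure \<kappa>
    using pm by (intro finite_measureI) (simp add: \<kappa>_def emeasure_density poisson_measure_iff)
  define c where "c = Sup (measure \<kappa> ` null_sets lborel)"
  have bdd: "bdd_above (measure \<kappa> ` null_sets lborel)"
    using \<kappa>.bounded_measure by (intro bdd_aboveI2[where M="measure \<kappa> UNIV"]) auto
  have ne: "measure \<kappa> ` null_sets lborel \<noteq> {}" by auto
  have "\<exists>N\<in>null_sets lborel. c - 1 / Suc n < measure \<kappa> N" for n
    using less_cSupD[OF ne, of "c - 1 / Suc n"] by (auto simp: c_def)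
  then obtain Ns where Ns: "\<And>n. Ns n \<in> null_sets lborel" "\<And>n. c - 1 / Suc n < measure \<kappa> (Ns n)" by metis
  define N where "N = (\<Union>n. Ns n)"
  have N: "N \<in> null_sets lborel" using Ns(1) by (auto simp: N_def)
  then have [measurable]: "N \<in> sets borel" by auto
  have Ns_le: "c - 1 / Suc n \<le> measure \<kappa> N" for n
  proof -
    have "measure \<kappa> (Ns n) \<le> measure \<kappa> N"
      by (rule \<kappa>.finite_measure_mono) (use \<open>N \<in> sets borel\<close> in \<open>auto simp: N_def\<close>)
    then show ?thesis using Ns(2)[of n] by linarith
  qed
  have cN: "c \<le> measure \<kappa> N"
  proof (rule field_le_epsilon)
    fix e :: real assume "0 < e"
    then obtain n where "1 / Suc n < e" using nat_approx_posE by blast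
    then show "c \<le> measure \<kappa> N + e" using Ns_le[of n] by linarith
  qed
  have zero: "emeasure \<nu> (A - N) = 0" if A: "A \<in> null_sets lborel" for A
  proof -
    have [measurable]: "A \<in> sets borel" using A by auto
    have "measure \<kappa> (N \<union> (A - N)) = measure \<kappa> N + measure \<kappa> (A - N)"
      by (intro \<kappa>.finite_measure_Union) auto
    moreover have "N \<union> (A - N) \<in> null_sets lborel" using N A by auto
    then have "measure \<kappa> (N \<union> (A - N)) \<le> c" unfolding c_def by (intro cSUP_upper bdd)
    ultimately have "measure \<kappa> (A - N) = 0" using cN measure_nonneg[of \<kappa> "A - N"] by linarith
    then have "emeasure \<kappa> (A - N) = 0" by (simp add: \<kappa>.emeasure_eq_measure)
    then have "AE s in \<nu>. ennreal (1 / (1 + s\<^sup>2)) * indicator (A - N) s = 0"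
      unfolding \<kappa>_def by (subst (asm) emeasure_density) (auto simp: nn_integral_0_iff_AE)
    then have "AE s in \<nu>. s \<notin> A - N"
    proof (rule AE_mp, intro AE_I2 impI)
      fix s assume "ennreal (1 / (1 + s\<^sup>2)) * indicator (A - N) s = 0"
      moreover have "0 < 1 / (1 + s\<^sup>2)" by (simp add: add_pos_nonneg)
      then have "0 < ennreal (1 / (1 + s\<^sup>2))" by (simp only: ennreal_less_zero_iff)
      ultimately show "s \<notin> A - N" by (auto simp: indicator_def split: if_splits)
    qed
    moreover have "{s \<in> space \<nu>. \<not> s \<notin> A - N} = A - N" by auto
    ultimately show ?thesis using AE_iff_measurable[of "A - N" \<nu> "\<lambda>s. s \<notin> A - N"] by simp
  qed
  define \<nu>1 where "\<nu>1 = density \<nu> (indicator (- N))"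
  define \<sigma> where "\<sigma> = density \<nu> (indicator N)"
  have ac: "absolutely_continuous (lborel :: real measure) \<nu>1"
    unfolding absolutely_continuous_def
  proof
    fix A :: "real set" assume A: "A \<in> null_sets lborel"
    then have [measurable]: "A \<in> sets borel" by auto
    have "emeasure \<nu>1 A = emeasure \<nu> (A - N)"
      unfolding \<nu>1_def by (subst emeasure_density)
       (auto simp: indicator_inter_arith[symmetric] Int_commute Diff_eq)
    then show "A \<in> null_sets \<nu>1" using zero[OF A] by (auto simp: null_sets_def \<nu>1_def)
  qed
  obtain g where g [measurable]: "g \<in> borel_measurable lborel" and dg: "density lborel g = \<nu>1"
    using sigma_finite_measure.Radon_Nikodym[OF lborel.sigma_finite_measure_axioms ac] by (auto simp: \<nu>1_def)
  have decomp: "emeasure \<nu> A = emeasure \<nu>1 A + emeasure \<sigma> A" if [measurable]: "A \<in> sets borel" for A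
  proof -
    have "emeasure \<nu> A = emeasure \<nu> (A \<inter> - N) + emeasure \<nu> (A \<inter> N)"
      by (subst plus_emeasure) (auto intro!: arg_cong[where f="emeasure \<nu>"])
    moreover have "emeasure \<nu> (A \<inter> - N) = emeasure \<nu>1 A" "emeasure \<nu> (A \<inter> N) = emeasure \<sigma> A"
      unfolding \<nu>1_def \<sigma>_def
      by (subst emeasure_density; simp add: indicator_inter_arith[symmetric] Int_commute)+
    ultimately show ?thesis by simp
  qed
  \<comment> \<open>Convergence of the weighted integral makes the derivative g finite almost
    everywhere, so it has a real-valued version.\<close>
  have "poisson_measure \<nu>1"
    using poisson_measure_add[of \<nu> \<nu>1 \<sigma>] decomp pm by (auto simp: \<nu>1_def \<sigma>_def)
  then have "(\<integral>\<^sup>+s. g s * ennreal (1 / (1 + s\<^sup>2)) \<partial>lborel) \<noteq> \<infinity>"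
    unfolding dg[symmetric] by (simp add: poisson_measure_iff nn_integral_density)
  then have "AE s in lborel. g s * ennreal (1 / (1 + s\<^sup>2)) \<noteq> \<infinity>"
    by (intro nn_integral_PInf_AE) auto
  then have AEg: "AE s in lborel. g s = ennreal (enn2real (g s))"
  proof (rule AE_mp, intro AE_I2 impI)
    fix s assume "g s * ennreal (1 / (1 + s\<^sup>2)) \<noteq> \<infinity>"
    moreover have "0 < 1 / (1 + s\<^sup>2)" by (simp add: add_pos_nonneg)
    ultimately have "g s \<noteq> top" by (auto simp: ennreal_mult_eq_top_iff)
    then show "g s = ennreal (enn2real (g s))" by (simp add: less_top)
  qed
  have "density lborel (\<lambda>s. ennreal (enn2real (g s))) = \<nu>1"
    unfolding dg[symmetric] using AEg by (intro density_cong) auto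
  moreover have "emeasure \<sigma> (- N) = 0"
    unfolding \<sigma>_def by (subst emeasure_density) (auto simp: indicator_inter_arith[symmetric])
  ultimately show ?thesis
    using decomp N unfolding continuous_density_def
    by (intro exI[of _ "\<lambda>s. enn2real (g s)"] conjI allI exI[of _ \<sigma>] exI[of _ N]) (auto simp: \<sigma>_def)
qed

section \<open>Herglotz' representation theorem\<close>

text \<open>The same parametrization of the unit circle over [0, 1] as
  \<open>circlepath 0 1\<close>, so contour integrals turn into integrals over [0, 1]
  directly.\<close>

definition circ :: "real \<Rightarrow> complex" where
  "circ t = exp (2 * of_real pi * \<i> * of_real t)"

lemma norm_circ [simp]: "norm (circ t) = 1"
  by (simp add: circ_def norm_exp_eq_Re)

lemma circ_nonzero [simp]: "circ t \<noteq> 0"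
  by (simp add: circ_def)

lemma cnj_circ: "cnj (circ t) = 1 / circ t"
  using complex_norm_square[of "circ t"] by (simp add: field_simps)

lemma isCont_circ [continuous_intros]: "isCont circ t"
  unfolding circ_def[abs_def] by (intro continuous_intros)

lemma circ_measurable [measurable]: "circ \<in> borel_measurable borel"
  by (intro borel_measurable_continuous_onI continuous_at_imp_continuous_on ballI isCont_circ)

lemma circ_minus_nonzero: "norm w < 1 \<Longrightarrow> circ t - w \<noteq> 0"
  by (metis norm_circ eq_iff_diff_eq_0 less_irrefl)

lemma circle_Cauchy_has_integral:
  assumes "continuous_on (cball 0 1) h" "h holomorphic_on ball 0 1" "norm w < 1"
  shows "((\<lambda>t. h (circ t) * (circ t / (circ t - w))) has_integral h w) {0..1}"
proof -
  have "((\<lambda>u. h u / (u - w)) has_contour_integral (2 * of_real pi * \<i> * h w)) (circlepath 0 1)"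
    using Cauchy_integral_circlepath[of 0 1 h w] assms by simp
  then have "((\<lambda>t. h (circ t) / (circ t - w) * (2 * of_real pi * \<i> * circ t)) has_integral (2 * of_real pi * \<i> * h w)) {0..1}"
    unfolding has_contour_integral_def
    by (rule has_integral_cong[THEN iffD1, rotated])
       (simp add: vector_derivative_circlepath01, simp add: circlepath circ_def)
  from has_integral_mult_right[OF this, of "1 / (2 * of_real pi * \<i>)"]
  show ?thesis by (simp add: field_simps)
qed

text \<open>Cauchy's formula at 0 for h(u) / (1 - cnj w u), conjugated, produces the same Cauchy
  kernel with cnj h in place of h, because conjugation is inversion on the circle. Adding it to
  Cauchy's formula for h leaves twice the real part of h; subtracting the mean value of Re h turns 2
  u / (u - w) into (u + w) / (u - w).\<close>

lemma Schwarz_has_integral: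
  assumes "continuous_on (cball 0 1) h" "h holomorphic_on ball 0 1" "norm w < 1"
  shows "((\<lambda>t. of_real (Re (h (circ t))) * ((circ t + w) / (circ t - w))) has_integral (h w - \<i> * of_real (Im (h 0)))) {0..1}"
proof -
  have nz: "1 - cnj w * u \<noteq> 0" if "norm u \<le> 1" for u
  proof
    assume "1 - cnj w * u = 0"
    then have "norm (cnj w * u) = 1" by (metis eq_iff_diff_eq_0 norm_one)
    moreover have "norm (cnj w * u) \<le> norm w * 1" using that by (simp add: norm_mult mult_left_le)
    ultimately show False using assms(3) by simp
  qed
  have "((\<lambda>t. h (circ t) / (1 - cnj w * circ t) * (circ t / (circ t - 0))) has_integral (h 0 / (1 - cnj w * 0))) {0..1}"
    using assms nz by (intro circle_Cauchy_has_integral continuous_intros holomorphic_intros) auto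
  then have "((\<lambda>t. h (circ t) / (1 - cnj w * circ t)) has_integral h 0) {0..1}" by simp
  then have "((\<lambda>t. cnj (h (circ t) / (1 - cnj w * circ t))) has_integral cnj (h 0)) {0..1}"
    using has_integral_cnj[of "\<lambda>t. h (circ t) / (1 - cnj w * circ t)" "h 0"] by (simp add: o_def)
  moreover have "cnj (h (circ t) / (1 - cnj w * circ t)) = cnj (h (circ t)) * (circ t / (circ t - w))" for t
  proof -
    have "1 - w / circ t = (circ t - w) / circ t" by (simp add: diff_divide_distrib)
    then show ?thesis by (simp add: cnj_circ)
  qed
  ultimately have B: "((\<lambda>t. cnj (h (circ t)) * (circ t / (circ t - w))) has_integral cnj (h 0)) {0..1}"
    by simp
  have S: "((\<lambda>t. of_real (2 * Re (h (circ t))) * (circ t / (circ t - w))) has_integral (h w + cnj (h 0))) {0..1}"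
    using has_integral_add[OF circle_Cauchy_has_integral[OF assms] B]
    unfolding distrib_right[symmetric] complex_add_cnj .
  have "((\<lambda>t. h (circ t)) has_integral h 0) {0..1}"
    using circle_Cauchy_has_integral[OF assms(1,2), of 0] by simp
  then have R: "((\<lambda>t. complex_of_real (Re (h (circ t)))) has_integral of_real (Re (h 0))) {0..1}"
    by (intro has_integral_of_real has_integral_Re)
  have eq1: "of_real (2 * Re (h (circ t))) * (circ t / (circ t - w)) - of_real (Re (h (circ t)))
      = of_real (Re (h (circ t))) * ((circ t + w) / (circ t - w))" for t
    using circ_minus_nonzero[OF assms(3), of t] by (simp add: field_simps)
  have eq2: "h w + cnj (h 0) - of_real (Re (h 0)) = h w - \<i> * of_real (Im (h 0))"
    by (simp add: complex_eq_iff)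
  show ?thesis using has_integral_diff[OF S R] by (simp only: eq1 eq2)
qed

text \<open>The dilations g(r w) with r < 1 are continuous up to the circle, so Schwarz' formula
  represents them by measures with positive densities on [0, 1]. These are tight, and since the
  Schwarz kernel is bounded and continuous in t for fixed w, the formula passes to a weak
  limit.\<close>

lemma Herglotz_disc:
  assumes hol: "g holomorphic_on ball 0 1" and pos: "\<And>w. norm w < 1 \<Longrightarrow> 0 < Re (g w)"
  obtains \<nu> :: "real measure" where "sets \<nu> = sets borel" "finite_measure \<nu>"
    "\<And>w. norm w < 1 \<Longrightarrow> g w = \<i> * of_real (Im (g 0)) + (LINT t|\<nu>. (circ t + w) / (circ t - w))"
proof -
  \<comment> \<open>Dividing by c gives all the approximating measures total mass 1, as Helly's
    selection theorem is formulated for probability distributions. The factor is restored in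
    \<open>\<nu>\<close> at the end.\<close>
  define c where "c = Re (g 0)"
  have c: "c > 0" using pos[of 0] by (simp add: c_def)
  define r where "r n = 1 - 1 / (real n + 2)" for n
  have r: "0 < r n" "r n < 1" for n by (auto simp: r_def field_simps)
  have rlim: "r \<longlonglongrightarrow> 1" unfolding r_def by real_asymp
  define d where "d n t = Re (g (of_real (r n) * circ t)) / c" for n t
  have rin: "norm (of_real (r n) * u) < 1" if "norm u \<le> 1" for n and u :: complex
  proof -
    have "r n * norm u \<le> r n * 1" using r[of n] that by (intro mult_left_mono) auto
    then have "r n * norm u < 1" using r[of n] by linarith
    then show ?thesis using r[of n] by (simp add: norm_mult)
  qed
  have d0: "0 \<le> d n t" for n t
    using pos[OF rin[of "circ t" n]] c by (simp add: d_def)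
  have contg: "isCont g u" if "norm u < 1" for u
    using hol that by (metis dist_0_norm mem_ball open_ball holomorphic_on_imp_continuous_on continuous_on_eq_continuous_at)
  have contd: "isCont (d n) t" for n t
  proof -
    have "isCont (\<lambda>t. g (of_real (r n) * circ t)) t"
      by (rule isCont_o2[where g=g]) (auto intro!: continuous_intros contg rin)
    then show ?thesis unfolding d_def using c by (intro continuous_intros) auto
  qed
  have [measurable]: "d n \<in> borel_measurable borel" for n
    using contd by (intro borel_measurable_continuous_onI) (simp add: continuous_on_eq_continuous_within continuous_at_imp_continuous_at_within)
  define \<mu> where "\<mu> n = density lborel (\<lambda>t. ennreal (indicator {0..1} t * d n t))" for n
  have [simp]: "sets (\<mu> n) = sets borel" "space (\<mu> n) = UNIV" for n by (simp_all add: \<mu>_def)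
  have schwarz: "(LINT t|\<mu> n. (circ t + w) / (circ t - w)) = (g (of_real (r n) * w) - \<i> * of_real (Im (g 0))) / of_real c"
    if "norm w < 1" for n w
  proof -
    have ct: "isCont (\<lambda>t. (circ t + w) / (circ t - w)) t" for t
      using circ_minus_nonzero[OF that] by (intro continuous_intros isCont_circ) auto
    have [measurable]: "(\<lambda>t. (circ t + w) / (circ t - w)) \<in> borel_measurable borel"
      using ct by (intro borel_measurable_continuous_onI) (simp add: continuous_on_eq_continuous_within continuous_at_imp_continuous_at_within)
    have "continuous_on (cball 0 1) (\<lambda>u. g (of_real (r n) * u))"
      using rin[of _ n] by (intro continuous_at_imp_continuous_on ballI isCont_o2[OF _ contg] continuous_intros) auto
    moreover have "(\<lambda>u. g (of_real (r n) * u)) holomorphic_on ball 0 1"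
      using rin[of _ n] by (intro holomorphic_on_compose_gen[OF _ hol, unfolded o_def] holomorphic_intros) (auto intro: less_imp_le)
    ultimately have HI: "((\<lambda>t. of_real (Re (g (of_real (r n) * circ t))) * ((circ t + w) / (circ t - w)))
         has_integral (g (of_real (r n) * w) - \<i> * of_real (Im (g 0)))) {0..1}"
      using Schwarz_has_integral[of "\<lambda>u. g (of_real (r n) * u)" w] that by simp
    have "(LINT t|\<mu> n. (circ t + w) / (circ t - w)) = (LINT t|lborel. (indicator {0..1} t * d n t) *\<^sub>R ((circ t + w) / (circ t - w)))"
      unfolding \<mu>_def using d0 by (subst integral_density) (auto simp: indicator_def)
    also have "\<dots> = (LINT t:{0..1}|lborel. of_real (d n t) * ((circ t + w) / (circ t - w)))"
      unfolding set_lebesgue_integral_def by (intro Bochner_Integration.integral_cong) (auto simp: indicator_def scaleR_conv_of_real)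
    also have "\<dots> = integral {0..1} (\<lambda>t. of_real (d n t) * ((circ t + w) / (circ t - w)))"
    proof (rule set_borel_integral_eq_integral(2))
      show "set_integrable lborel {0..1} (\<lambda>t. of_real (d n t) * ((circ t + w) / (circ t - w)))"
        using contd ct by (intro borel_integrable_atLeastAtMost' continuous_at_imp_continuous_on ballI continuous_mult continuous_of_real)
    qed
    also have "\<dots> = (g (of_real (r n) * w) - \<i> * of_real (Im (g 0))) / of_real c"
    proof (rule integral_unique)
      show "((\<lambda>t. of_real (d n t) * ((circ t + w) / (circ t - w))) has_integral
        (g (of_real (r n) * w) - \<i> * of_real (Im (g 0))) / of_real c) {0..1}"
        using has_integral_divide[OF HI, of "of_real c"] c by (simp add: d_def mult.commute)
    qed
    finally show ?thesis .
  qed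
  have em: "emeasure (\<mu> n) A = 1" if A: "A \<in> sets borel" "{0..1} \<subseteq> A" for n A
  proof -
    have int: "integrable lborel (\<lambda>t. indicator {0..1} t * d n t)"
      using borel_integrable_atLeastAtMost'[of 0 1 "d n"] contd
      by (auto simp: set_integrable_def intro: continuous_at_imp_continuous_on)
    \<comment> \<open>At w = 0 the Schwarz kernel is the constant 1, so the representation formula
      itself computes the total mass.\<close>
    have "(LINT t|\<mu> n. (circ t + 0) / (circ t - 0)) = 1" unfolding schwarz[of 0 n, simplified norm_zero, OF zero_less_one]
      using c by (simp add: c_def complex_eq_iff)
    then have "(LINT t|\<mu> n. (1::complex)) = 1" by simp
    then have "(LINT t|lborel. (indicator {0..1} t * d n t) *\<^sub>R (1::complex)) = 1"
      unfolding \<mu>_def using d0 by (subst (asm) integral_density) (auto simp: indicator_def)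
    then have "complex_of_real (LINT t|lborel. indicator {0..1} t * d n t) = 1"
      by (simp add: scaleR_conv_of_real del: of_real_mult)
    then have I: "(LINT t|lborel. indicator {0..1} t * d n t) = 1" by (simp only: of_real_eq_1_iff)
    have "emeasure (\<mu> n) A = (\<integral>\<^sup>+t. ennreal (indicator {0..1} t * d n t) \<partial>lborel)"
      unfolding \<mu>_def using A by (subst emeasure_density) (auto simp: indicator_def intro!: nn_integral_cong)
    also have "\<dots> = ennreal (LINT t|lborel. indicator {0..1} t * d n t)"
      using d0 int by (intro nn_integral_eq_integral) auto
    finally show ?thesis using I by simp
  qed
  have rd: "real_distribution (\<mu> n)" for n
    by (intro real_distribution.intro prob_spaceI real_distribution_axioms.intro) (auto simp: em)
  have "tight \<mu>"
    unfolding tight_def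
  proof (intro conjI allI impI rd)
    fix e :: real assume "e > 0"
    moreover have "emeasure (\<mu> n) {-1<..1} = 1" for n by (rule em) auto
    ultimately have "-1 < (1::real) \<and> (\<forall>n. measure (\<mu> n) {-1<..1} > 1 - e)"
      by (simp add: measure_def)
    then show "\<exists>a b. a < b \<and> (\<forall>n. measure (\<mu> n) {a<..b} > 1 - e)" by blast
  qed
  then obtain q M where q: "strict_mono q" and M: "real_distribution M" and wc: "weak_conv_m (\<lambda>n. \<mu> (q n)) M"
    using tight_imp_convergent_subsubsequence[of \<mu> id] by (auto simp: strict_mono_def o_def)
  interpret M: real_distribution M by fact
  have lim: "(LINT t|M. (circ t + w) / (circ t - w)) = (g w - \<i> * of_real (Im (g 0))) / of_real c" if w: "norm w < 1" for w
  proof -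
    have "(\<lambda>n. LINT t|\<mu> (q n). (circ t + w) / (circ t - w)) \<longlonglongrightarrow> (LINT t|M. (circ t + w) / (circ t - w))"
    proof (rule weak_conv_imp_integral_bdd_continuous_conv)
      show "real_distribution (\<mu> (q n))" for n using rd by simp
      show "isCont (\<lambda>t. (circ t + w) / (circ t - w)) t" for t
        using circ_minus_nonzero[OF w] by (intro continuous_intros isCont_circ) auto
      show "norm ((circ t + w) / (circ t - w)) \<le> 2 / (1 - norm w)" for t
      proof -
        have "norm (circ t + w) \<le> 2" using norm_triangle_ineq[of "circ t" w] w by simp
        moreover have "1 - norm w \<le> norm (circ t - w)" using norm_triangle_ineq2[of "circ t" w] by simp
        ultimately show ?thesis using w by (simp add: norm_divide frac_le)
      qed
    qed (use M wc in auto)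
    then have "(\<lambda>n. (g (of_real (r (q n)) * w) - \<i> * of_real (Im (g 0))) / of_real c) \<longlonglongrightarrow> (LINT t|M. (circ t + w) / (circ t - w))"
      by (simp add: schwarz[OF w])
    moreover have "(\<lambda>n. (g (of_real (r (q n)) * w) - \<i> * of_real (Im (g 0))) / of_real c) \<longlonglongrightarrow> (g w - \<i> * of_real (Im (g 0))) / of_real c"
    proof -
      have "(\<lambda>n. r (q n)) \<longlonglongrightarrow> 1" using LIMSEQ_subseq_LIMSEQ[OF rlim q] by (simp add: o_def)
      then have "(\<lambda>n. of_real (r (q n)) * w) \<longlonglongrightarrow> of_real 1 * w" by (intro tendsto_intros)
      then have "(\<lambda>n. g (of_real (r (q n)) * w)) \<longlonglongrightarrow> g w"
        using isCont_tendsto_compose[OF contg[OF w]] by simp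
      then show ?thesis using c by (intro tendsto_intros) auto
    qed
    ultimately show ?thesis by (rule LIMSEQ_unique)
  qed
  define \<nu> where "\<nu> = density M (\<lambda>_. ennreal c)"
  show ?thesis
  proof
    show "sets \<nu> = sets borel" by (simp add: \<nu>_def)
    show "finite_measure \<nu>"
      by (intro finite_measureI) (simp add: \<nu>_def emeasure_density_const M.emeasure_space_1[simplified])
    fix w :: complex assume w: "norm w < 1"
    have [measurable]: "(\<lambda>t. (circ t + w) / (circ t - w)) \<in> borel_measurable borel"
      by measurable
    have "(LINT t|\<nu>. (circ t + w) / (circ t - w)) = of_real c * (LINT t|M. (circ t + w) / (circ t - w))"
      unfolding \<nu>_def using c
      by (subst integral_density) (auto simp: scaleR_conv_of_real simp del: times_divide_eq_right)
    then show "g w = \<i> * of_real (Im (g 0)) + (LINT t|\<nu>. (circ t + w) / (circ t - w))"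
      using c by (simp add: lim[OF w])
  qed
qed

text \<open>Under the Cayley transform the mass at the point \<open>1\<close> of the circle becomes the linear term.\<close>

lemma Herglotz_half_plane:
  assumes hol: "F holomorphic_on {z. 0 < Im z}" and pos: "\<And>z. 0 < Im z \<Longrightarrow> 0 < Re (F z)"
  obtains b \<zeta> and \<kappa> :: "real measure" where "0 \<le> \<zeta>" "sets \<kappa> = sets borel" "finite_measure \<kappa>"
    "\<And>z. 0 < Im z \<Longrightarrow> F z = \<i> * of_real b - \<i> * of_real \<zeta> * z + (LINT s|\<kappa>. \<i> * (1 + of_real s * z) / (z - of_real s))"
proof -
  \<comment> \<open>The inverse Cayley transform, from the disc onto the upper half-plane.\<close>
  define T where "T w = \<i> * (1 + w) / (1 - w)" for w :: complex
  have ImT_eq: "Im (T w) = (1 - (norm w)\<^sup>2) / (norm (1 - w))\<^sup>2" for w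
    unfolding T_def cmod_power2 by (simp add: Im_divide power2_eq_square algebra_simps)
  have ImT: "0 < Im (T w)" if "norm w < 1" for w
  proof -
    have "w \<noteq> 1" using that by auto
    moreover have "0 < 1 - (norm w)\<^sup>2" using that by (simp add: abs_square_less_1)
    ultimately show ?thesis by (simp add: ImT_eq)
  qed
  have "T holomorphic_on ball 0 1" unfolding T_def by (intro holomorphic_intros) auto
  then have holT: "(\<lambda>w. F (T w)) holomorphic_on ball 0 1"
    using ImT by (intro holomorphic_on_compose_gen[OF _ hol, unfolded o_def]) auto
  have posT: "\<And>w. norm w < 1 \<Longrightarrow> 0 < Re (F (T w))" using pos ImT by blast
  obtain \<nu> :: "real measure" where \<nu>: "sets \<nu> = sets borel" "finite_measure \<nu>"
    and rep: "\<And>w. norm w < 1 \<Longrightarrow> F (T w) = \<i> * of_real (Im (F (T 0))) + (LINT t|\<nu>. (circ t + w) / (circ t - w))"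
    using Herglotz_disc[OF holT] posT by blast
  interpret \<nu>: finite_measure \<nu> by fact
  note [measurable_cong] = \<nu>(1)
  have [simp]: "space \<nu> = UNIV" using sets_eq_imp_space_eq[OF \<nu>(1)] by simp
  define N where "N = {t. circ t = 1}"
  have [measurable]: "N \<in> sets borel" unfolding N_def by measurable
  define \<phi> where "\<phi> t = Re (T (circ t))" for t
  have [measurable]: "\<phi> \<in> borel_measurable borel" unfolding \<phi>_def T_def by measurable
  \<comment> \<open>By \<open>ImT_eq\<close> the imaginary part of T vanishes on the unit
    circle.\<close>
  have \<phi>: "complex_of_real (\<phi> t) = T (circ t)" if "t \<notin> N" for t
    by (simp add: \<phi>_def complex_eq_iff ImT_eq)
  define \<kappa> where "\<kappa> = distr (density \<nu> (\<lambda>t. ennreal (indicator (- N) t))) borel \<phi>"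
  show ?thesis
  proof
    show "0 \<le> measure \<nu> N" by simp
    show "sets \<kappa> = sets borel" by (simp add: \<kappa>_def)
    show "finite_measure \<kappa>"
    proof (intro finite_measureI)
      have "emeasure \<kappa> (space \<kappa>) = emeasure (density \<nu> (\<lambda>t. ennreal (indicator (- N) t))) UNIV"
        unfolding \<kappa>_def by (subst emeasure_distr) auto
      also have "\<dots> = emeasure \<nu> (- N)" by (subst emeasure_density) (auto simp: ennreal_indicator)
      finally show "emeasure \<kappa> (space \<kappa>) \<noteq> \<infinity>" by simp
    qed
    fix z :: complex assume z: "0 < Im z"
    define w where "w = (z - \<i>) / (z + \<i>)"
    have zi: "z + \<i> \<noteq> 0" using z by (auto simp: complex_eq_iff)
    have w1: "1 - w = 2 * \<i> / (z + \<i>)" "1 + w = 2 * z / (z + \<i>)"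
      using zi by (simp_all add: w_def field_simps)
    have Tw: "T w = z" unfolding T_def w1 using zi by simp
    have w: "norm w < 1"
    proof -
      have "(norm (z - \<i>))\<^sup>2 < (norm (z + \<i>))\<^sup>2"
        using z unfolding cmod_power2 by (simp add: power2_eq_square algebra_simps)
      then have "norm (z - \<i>) < norm (z + \<i>)" by (rule power2_less_imp_less) simp
      then show ?thesis using zi by (simp add: w_def norm_divide)
    qed
    \<comment> \<open>For t in N the kernel is (1 + w) / (1 - w), which is -\<i> T(w) = -\<i> z.
      Elsewhere both fractions are written with the common factor z + \<i> and the common
      denominator 1 - e, which cancel in the quotient.\<close>
    have ker: "(circ t + w) / (circ t - w) = indicator N t *\<^sub>R (- \<i> * z) +
        indicator (- N) t *\<^sub>R (\<i> * (1 + of_real (\<phi> t) * z) / (z - of_real (\<phi> t)))" for t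
    proof (cases "t \<in> N")
      case True
      then have "(circ t + w) / (circ t - w) = (1 + w) / (1 - w)" by (simp add: N_def)
      also have "\<dots> = - \<i> * z" unfolding w1 using zi by simp
      finally show ?thesis using True by simp
    next
      case False
      define e where "e = circ t"
      have e: "e \<noteq> 1" using False by (simp add: e_def N_def)
      have ew: "e - w \<noteq> 0" using circ_minus_nonzero[OF w] by (simp add: e_def)
      have eq: "of_real (\<phi> t) = \<i> * (1 + e) / (1 - e)" using \<phi>[OF False] by (simp add: T_def e_def)
      have zs: "z - of_real (\<phi> t) \<noteq> 0" using z by (auto simp: complex_eq_iff)
      have "z - of_real (\<phi> t) = ((z - \<i>) - (z + \<i>) * e) / (1 - e)"
        unfolding eq using e by (simp add: field_simps)
      moreover have "1 + of_real (\<phi> t) * z = \<i> * ((z - \<i>) + (z + \<i>) * e) / (1 - e)"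
        unfolding eq using e by (simp add: field_simps)
      moreover have "z - \<i> = w * (z + \<i>)" using zi by (simp add: w_def)
      ultimately have 1: "z - of_real (\<phi> t) = (z + \<i>) * (w - e) / (1 - e)"
        and 2: "1 + of_real (\<phi> t) * z = \<i> * ((z + \<i>) * (w + e)) / (1 - e)"
        by (simp_all add: algebra_simps)
      have "(e + w) / (e - w) = \<i> * (1 + of_real (\<phi> t) * z) / (z - of_real (\<phi> t))"
      proof -
        have "\<i> * (\<i> * (A * p) / B) / (A * q / B) = - (p / q)" if "A \<noteq> 0" "B \<noteq> 0" for A B p q :: complex
        proof -
          have "\<i> * (\<i> * (A * p) / B) = - (A * p / B)" by (simp add: mult.assoc[symmetric])
          moreover have "A * p / B / (A * q / B) = p / q" using that by simp
          ultimately show ?thesis by (metis minus_divide_left)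
        qed
        then have "\<i> * (1 + of_real (\<phi> t) * z) / (z - of_real (\<phi> t)) = - ((w + e) / (w - e))"
          unfolding 1 2 using e zi by simp
        also have "\<dots> = (w + e) / (- (w - e))" by (rule minus_divide_right)
        also have "\<dots> = (e + w) / (e - w)" by (simp add: add.commute)
        finally show ?thesis by simp
      qed
      then show ?thesis using False by (simp add: e_def)
    qed
    have bnd: "norm ((circ t + w) / (circ t - w)) \<le> 2 / (1 - norm w)" for t
    proof -
      have "norm (circ t + w) \<le> 2" using norm_triangle_ineq[of "circ t" w] w by simp
      moreover have "1 - norm w \<le> norm (circ t - w)" using norm_triangle_ineq2[of "circ t" w] by simp
      ultimately show ?thesis using w by (simp add: norm_divide frac_le)
    qed
    have i1: "integrable \<nu> (\<lambda>t. indicator N t *\<^sub>R (- \<i> * z))"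
      by (intro \<nu>.integrable_const_bound[where B="norm z"]) (auto simp: norm_mult indicator_def)
    have "integrable \<nu> (\<lambda>t. (circ t + w) / (circ t - w))"
      using bnd by (intro \<nu>.integrable_const_bound[where B="2 / (1 - norm w)"]) auto
    from Bochner_Integration.integrable_diff[OF this i1]
    have i2: "integrable \<nu> (\<lambda>t. indicator (- N) t *\<^sub>R (\<i> * (1 + of_real (\<phi> t) * z) / (z - of_real (\<phi> t))))"
      by (simp add: ker)
    have "F z = \<i> * of_real (Im (F (T 0))) + (LINT t|\<nu>. (circ t + w) / (circ t - w))"
      using rep[OF w] by (simp add: Tw)
    also have "(LINT t|\<nu>. (circ t + w) / (circ t - w)) = - \<i> * of_real (measure \<nu> N) * z +
       (LINT t|\<nu>. indicator (- N) t *\<^sub>R (\<i> * (1 + of_real (\<phi> t) * z) / (z - of_real (\<phi> t))))"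
      unfolding ker using i1 i2 by (subst Bochner_Integration.integral_add) (auto simp: scaleR_conv_of_real)
    also have "(LINT t|\<nu>. indicator (- N) t *\<^sub>R (\<i> * (1 + of_real (\<phi> t) * z) / (z - of_real (\<phi> t))))
       = (LINT s|\<kappa>. \<i> * (1 + of_real s * z) / (z - of_real s))"
      unfolding \<kappa>_def
      by (simp add: integral_distr integral_density)
    finally show "F z = \<i> * of_real (Im (F (T 0))) - \<i> * of_real (measure \<nu> N) * z +
        (LINT s|\<kappa>. \<i> * (1 + of_real s * z) / (z - of_real s))" by simp
  qed
qed


text \<open>Since \<open>(1 + s * z) / (z - s) = (1 + s\<^sup>2) / (z - s) + s\<close>, this density
  turns the regularized kernel of Herglotz' theorem into the kernel of \<open>Q_trans\<close> plus
  \<i> s; the factor pi compensates the 1 / pi in \<open>Q_trans\<close>.\<close>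

definition herglotz_measure :: "real measure \<Rightarrow> real measure" where
  "herglotz_measure \<kappa> = density \<kappa> (\<lambda>s. ennreal (pi * (1 + s\<^sup>2)))"

text \<open>The regularizing term \<i> s is purely imaginary, so the real part becomes a Poisson
  integral before any first moment of \<kappa> is known.\<close>

lemma poisson_herglotz_measure:
  assumes \<kappa>: "sets \<kappa> = sets borel" "finite_measure \<kappa>"
  shows "poisson_measure (herglotz_measure \<kappa>)"
    and "0 < y \<Longrightarrow> Re (LINT s|\<kappa>. \<i> * (1 + of_real s * Complex x y) / (Complex x y - of_real s)) = poisson (herglotz_measure \<kappa>) x y"
proof -
  interpret \<kappa>: finite_measure \<kappa> by fact
  note [measurable_cong] = \<kappa>(1)
  have [simp]: "space \<kappa> = UNIV" using sets_eq_imp_space_eq[OF \<kappa>(1)] by simp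
  have pos: "0 < 1 + s\<^sup>2" for s :: real by (simp add: add_pos_nonneg)
  have "integrable \<kappa> (\<lambda>s. pi)" by simp
  moreover have "integrable (herglotz_measure \<kappa>) (\<lambda>s. 1 / (1 + s\<^sup>2)) \<longleftrightarrow> integrable \<kappa> (\<lambda>s. (pi * (1 + s\<^sup>2)) *\<^sub>R (1 / (1 + s\<^sup>2)))"
    unfolding herglotz_measure_def by (intro integrable_density) (auto simp: less_imp_le[OF pos])
  moreover have "(pi * (1 + s\<^sup>2)) *\<^sub>R (1 / (1 + s\<^sup>2)) = pi" for s :: real
    using pos[of s] by simp
  ultimately show "poisson_measure (herglotz_measure \<kappa>)"
    by (simp add: poisson_measure_def \<kappa>(1) herglotz_measure_def)
  assume y: "0 < y"
  define z where "z = Complex x y"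
  have zs: "z - of_real s \<noteq> 0" for s using y by (auto simp: z_def complex_eq_iff)
  have re: "Re (\<i> * (1 + of_real s * z) / (z - of_real s)) = (pi * (1 + s\<^sup>2)) * poisson_kernel x y s" for s
  proof -
    have "(pi * (1 + s\<^sup>2)) * poisson_kernel x y s = y * (1 + s\<^sup>2) / ((x - s)\<^sup>2 + y\<^sup>2)"
      by (simp add: poisson_kernel_def)
    moreover have "Re (\<i> * (1 + of_real s * z) / (z - of_real s)) = y * (1 + s\<^sup>2) / ((x - s)\<^sup>2 + y\<^sup>2)"
      unfolding Re_divide z_def by (simp add: power2_eq_square algebra_simps)
    ultimately show ?thesis by simp
  qed
  have "integrable \<kappa> (\<lambda>s. \<i> * (1 + of_real s * z) / (z - of_real s))"
  proof (rule \<kappa>.integrable_const_bound)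
    show "AE s in \<kappa>. norm (\<i> * (1 + of_real s * z) / (z - of_real s)) \<le> norm z + norm (1 + z\<^sup>2) / y"
    proof (intro AE_I2)
      fix s
      have "\<i> * (1 + of_real s * z) / (z - of_real s) = \<i> * ((1 + z\<^sup>2) / (z - of_real s) - z)"
      proof -
        have "(1 + z\<^sup>2) / (z - of_real s) - z = ((1 + z\<^sup>2) - z * (z - of_real s)) / (z - of_real s)"
          using zs[of s] by (simp add: diff_divide_distrib)
        also have "(1 + z\<^sup>2) - z * (z - of_real s) = 1 + of_real s * z"
          by (simp add: algebra_simps power2_eq_square)
        finally show ?thesis by simp
      qed
      also have "norm \<dots> = norm ((1 + z\<^sup>2) / (z - of_real s) - z)" by (simp add: norm_mult)
      also have "\<dots> \<le> norm (1 + z\<^sup>2) / norm (z - of_real s) + norm z"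
        by (metis norm_triangle_ineq4 norm_divide)
      also have "\<dots> \<le> norm (1 + z\<^sup>2) / y + norm z"
        using y abs_Im_le_cmod[of "z - of_real s"] by (intro add_mono divide_left_mono mult_pos_pos) (auto simp: z_def complex_eq_iff)
      finally show "norm (\<i> * (1 + of_real s * z) / (z - of_real s)) \<le> norm z + norm (1 + z\<^sup>2) / y" by simp
    qed
  qed measurable
  then have "Re (LINT s|\<kappa>. \<i> * (1 + of_real s * z) / (z - of_real s)) = (LINT s|\<kappa>. (pi * (1 + s\<^sup>2)) * poisson_kernel x y s)"
    by (subst integral_Re[symmetric]) (simp_all only: re)
  also have "\<dots> = poisson (herglotz_measure \<kappa>) x y"
    unfolding poisson_def herglotz_measure_def
    by (subst integral_density) (auto simp: less_imp_le[OF pos])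
  finally show "Re (LINT s|\<kappa>. \<i> * (1 + of_real s * Complex x y) / (Complex x y - of_real s)) = poisson (herglotz_measure \<kappa>) x y"
    by (simp add: z_def)
qed

section \<open>Boundary values of functions with positive real part\<close>

text \<open>By Herglotz' theorem the real part is \<zeta> \<epsilon> plus a Poisson integral, and
  the latter converges almost everywhere to a density.\<close>

lemma AE_Re_boundary_limit:
  assumes hol: "F holomorphic_on {z. 0 < Im z}" and pos: "\<And>z. 0 < Im z \<Longrightarrow> 0 < Re (F z)"
  shows "AE t in lborel. \<exists>l. ((\<lambda>\<epsilon>. Re (F (Complex t \<epsilon>))) \<longlongrightarrow> l) (at_right 0)"
proof -
  obtain b \<zeta> and \<kappa> :: "real measure" where "0 \<le> \<zeta>" and \<kappa>: "sets \<kappa> = sets borel" "finite_measure \<kappa>"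
    and rep: "\<And>z. 0 < Im z \<Longrightarrow> F z = \<i> * of_real b - \<i> * of_real \<zeta> * z + (LINT s|\<kappa>. \<i> * (1 + of_real s * z) / (z - of_real s))"
  proof (rule Herglotz_half_plane[OF hol pos])
    fix b \<zeta> and \<kappa> :: "real measure"
    assume "0 \<le> \<zeta>" "sets \<kappa> = sets borel" "finite_measure \<kappa>"
      "\<And>z. 0 < Im z \<Longrightarrow> F z = \<i> * of_real b - \<i> * of_real \<zeta> * z + (LINT s|\<kappa>. \<i> * (1 + of_real s * z) / (z - of_real s))"
    then show thesis by (rule that)
  qed
  have re: "Re (F (Complex t \<epsilon>)) = \<zeta> * \<epsilon> + poisson (herglotz_measure \<kappa>) t \<epsilon>" if "0 < \<epsilon>" for t \<epsilon>
    using rep[of "Complex t \<epsilon>"] that by (simp add: poisson_herglotz_measure(2)[OF \<kappa>])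
  obtain f where f: "continuous_density (herglotz_measure \<kappa>) f"
    using ex_continuous_density poisson_herglotz_measure(1)[OF \<kappa>] by blast
  show ?thesis
    using AE_poisson_tendsto_density[OF f poisson_herglotz_measure(1)[OF \<kappa>]]
  proof eventually_elim
    case (elim t)
    have "((\<lambda>\<epsilon>. \<zeta> * \<epsilon> + poisson (herglotz_measure \<kappa>) t \<epsilon>) \<longlongrightarrow> \<zeta> * 0 + f t) (at_right 0)"
      using elim by (intro tendsto_intros)
    moreover have "\<forall>\<^sub>F \<epsilon> in at_right 0. \<zeta> * \<epsilon> + poisson (herglotz_measure \<kappa>) t \<epsilon> = Re (F (Complex t \<epsilon>))"
      using eventually_at_right_less[of "0::real"] by eventually_elim (simp add: re)
    ultimately show ?case by (auto simp: tendsto_cong)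
  qed
qed

text \<open>Both \<open>Ln (2 + F)\<close> and \<open>2 - \<i> Ln (2 + F)\<close> have positive real part, so the modulus and the
  argument of \<open>2 + F\<close> have boundary limits.\<close>

lemma AE_boundary_limit:
  assumes hol: "F holomorphic_on {z. 0 < Im z}" and pos: "\<And>z. 0 < Im z \<Longrightarrow> 0 < Re (F z)"
  shows "AE t in lborel. \<exists>l. ((\<lambda>\<epsilon>. F (Complex t \<epsilon>)) \<longlongrightarrow> l) (at_right 0)"
proof -
  define L where "L z = Ln (2 + F z)" for z
  have nz: "2 + F z \<notin> \<real>\<^sub>\<le>\<^sub>0" "2 + F z \<noteq> 0" if "0 < Im z" for z
    using pos[OF that] by (auto simp: complex_nonpos_Reals_iff complex_eq_iff)
  have "L holomorphic_on {z. 0 < Im z}"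
    unfolding L_def using nz by (intro holomorphic_intros hol) auto
  moreover have "0 < Re (L z)" if "0 < Im z" for z
  proof -
    have "1 < Re (2 + F z)" using pos[OF that] by simp
    then have "1 < norm (2 + F z)" using complex_Re_le_cmod by (rule less_le_trans)
    then show ?thesis using nz[OF that] by (simp add: L_def)
  qed
  ultimately have 1: "AE t in lborel. \<exists>l. ((\<lambda>\<epsilon>. Re (L (Complex t \<epsilon>))) \<longlongrightarrow> l) (at_right 0)"
    by (rule AE_Re_boundary_limit)
  have "(\<lambda>z. 2 - \<i> * L z) holomorphic_on {z. 0 < Im z}"
    by (intro holomorphic_intros \<open>L holomorphic_on {z. 0 < Im z}\<close>)
  moreover have "0 < Re (2 - \<i> * L z)" if "0 < Im z" for z
  proof -
    have "0 < Re (2 + F z)" using pos[OF that] by simp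
    then have "\<bar>Im (L z)\<bar> < pi/2" unfolding L_def using Re_Ln_pos_lt_imp by blast
    then show ?thesis using pi_half_less_two by simp
  qed
  ultimately have 2: "AE t in lborel. \<exists>l. ((\<lambda>\<epsilon>. Re (2 - \<i> * L (Complex t \<epsilon>))) \<longlongrightarrow> l) (at_right 0)"
    by (rule AE_Re_boundary_limit)
  from 1 2 show ?thesis
  proof eventually_elim
    case (elim t)
    then obtain l m where "((\<lambda>\<epsilon>. Re (L (Complex t \<epsilon>))) \<longlongrightarrow> l) (at_right 0)"
      and "((\<lambda>\<epsilon>. 2 + Im (L (Complex t \<epsilon>))) \<longlongrightarrow> m) (at_right 0)" by auto
    then have "((\<lambda>\<epsilon>. Complex (Re (L (Complex t \<epsilon>))) (2 + Im (L (Complex t \<epsilon>)) - 2)) \<longlongrightarrow> Complex l (m - 2)) (at_right 0)"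
      by (intro tendsto_intros)
    then have "((\<lambda>\<epsilon>. exp (L (Complex t \<epsilon>)) - 2) \<longlongrightarrow> exp (Complex l (m - 2)) - 2) (at_right 0)"
      by (intro tendsto_intros) simp
    moreover have "\<forall>\<^sub>F \<epsilon> in at_right 0. exp (L (Complex t \<epsilon>)) - 2 = F (Complex t \<epsilon>)"
      using eventually_at_right_less[of "0::real"] by eventually_elim (simp add: L_def nz)
    ultimately show ?case by (auto simp: tendsto_cong)
  qed
qed

section \<open>The Cauchy transform\<close>

lemma integrable_Cauchy_kernel:
  assumes \<nu>: "sets \<nu> = sets borel" and int: "integrable \<nu> (\<lambda>s. (1 + s\<^sup>2) powr (-1/2))" and z: "Im z \<noteq> 0"
  shows "integrable \<nu> (\<lambda>s. 1 / (z - of_real s))"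
proof (rule Bochner_Integration.integrable_bound)
  note [measurable_cong] = \<nu>
  \<comment> \<open>The square root of the constant in \<open>inverse_shifted_square_le\<close>,
    since the squared modulus of the Cauchy kernel is what that lemma bounds.\<close>
  define C where "C = sqrt (2 + (1 + 2*(Re z)\<^sup>2) / (Im z)\<^sup>2)"
  show "integrable \<nu> (\<lambda>s. C * (1 + s\<^sup>2) powr (-1/2))" using int by simp
  show "(\<lambda>s. 1 / (z - complex_of_real s)) \<in> borel_measurable \<nu>" by measurable
  show "AE s in \<nu>. norm (1 / (z - complex_of_real s)) \<le> norm (C * (1 + s\<^sup>2) powr (-1/2))"
  proof (intro AE_I2)
    fix s :: real
    have pos: "0 < 1 + s\<^sup>2" by (simp add: add_pos_nonneg)
    have "(norm (1 / (z - complex_of_real s)))\<^sup>2 = 1 / ((Re z - s)\<^sup>2 + (Im z)\<^sup>2)"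
      by (simp add: norm_divide power_divide cmod_power2)
    also have "\<dots> \<le> (2 + (1 + 2*(Re z)\<^sup>2) / (Im z)\<^sup>2) * (1 / (1 + s\<^sup>2))"
      using z by (rule inverse_shifted_square_le)
    finally have "norm (1 / (z - complex_of_real s)) \<le> sqrt ((2 + (1 + 2*(Re z)\<^sup>2) / (Im z)\<^sup>2) * (1 / (1 + s\<^sup>2)))"
      by (rule real_le_rsqrt)
    also have "\<dots> = C * (1 + s\<^sup>2) powr (-1/2)"
      using pos by (simp add: C_def real_sqrt_mult real_sqrt_divide powr_minus powr_half_sqrt inverse_eq_divide)
    also have "\<dots> \<le> norm \<dots>" by simp
    finally show "norm (1 / (z - complex_of_real s)) \<le> norm (C * (1 + s\<^sup>2) powr (-1/2))" .
  qed
qed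

lemma M_plus_1D:
  assumes "\<nu> \<in> M_plus 1"
  shows "sets \<nu> = sets borel" "space \<nu> = UNIV" "integrable \<nu> (\<lambda>s. (1 + s\<^sup>2) powr (-1/2))" "poisson_measure \<nu>"
proof -
  show s: "sets \<nu> = sets borel" using assms by (simp add: M_plus_def)
  note [measurable_cong] = s
  show "space \<nu> = UNIV" using sets_eq_imp_space_eq[OF s] by simp
  have "(\<integral>\<^sup>+s. ennreal ((1 + s\<^sup>2) powr (-1/2)) \<partial>\<nu>) < \<infinity>" using assms by (simp add: M_plus_def)
  then show i: "integrable \<nu> (\<lambda>s. (1 + s\<^sup>2) powr (-1/2))" by (intro integrableI_bounded) auto
  have "integrable \<nu> (\<lambda>s. 1 / (1 + s\<^sup>2))"
  proof (rule Bochner_Integration.integrable_bound[OF i])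
    show "AE s in \<nu>. norm (1 / (1 + s\<^sup>2)) \<le> norm ((1 + s\<^sup>2) powr (-1/2))"
    proof (intro AE_I2)
      fix s :: real
      have "1 / (1 + s\<^sup>2) = (1 + s\<^sup>2) powr (-1)"
        using add_pos_nonneg[of 1 "s\<^sup>2"] by (simp add: powr_minus inverse_eq_divide)
      also have "\<dots> \<le> (1 + s\<^sup>2) powr (-1/2)" by (rule powr_mono) auto
      finally show "norm (1 / (1 + s\<^sup>2)) \<le> norm ((1 + s\<^sup>2) powr (-1/2))" by (simp add: add_pos_nonneg)
    qed
  qed measurable
  then show "poisson_measure \<nu>" using s by (simp add: poisson_measure_def)
qed

lemma Q_trans_eq: "Q_trans \<nu> z = \<i> / of_real pi * (LINT s|\<nu>. 1 / (z - of_real s))"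
  unfolding Q_trans_def by (subst integral_mult_right_zero[symmetric]) (simp add: divide_inverse mult_ac)

lemma inverse_difference_quotient:
  fixes a b :: "'a :: field"
  assumes "a \<noteq> 0" "b \<noteq> 0" "a - b \<noteq> 0"
  shows "(1 / a - 1 / b) / (a - b) = - 1 / (a * b)"
proof -
  define c where "c = a - b"
  have "1 / a - 1 / b = - c / (a * b)" using assms(1,2) by (simp add: diff_frac_eq c_def)
  then show ?thesis using assms(3) unfolding c_def[symmetric] by simp
qed

text \<open>Only a positive distance from \<open>z0\<close> to almost every s is asked for, so the
  lemma serves points of the half-plane as well as real points outside the support. Within \<delta>
  / 2 of \<open>z0\<close> the kernels are at most twice the kernel at \<open>z0\<close>, which
  dominates the difference quotients.\<close>

lemma has_field_derivative_Cauchy_transform: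
  fixes \<nu> :: "real measure" and z0 :: complex
  assumes \<nu>: "sets \<nu> = sets borel" and \<delta>: "0 < \<delta>" "AE s in \<nu>. \<delta> \<le> norm (z0 - of_real s)"
    and int: "integrable \<nu> (\<lambda>s. 1 / (z0 - of_real s))"
  shows "((\<lambda>z. LINT s|\<nu>. 1 / (z - of_real s)) has_field_derivative - (LINT s|\<nu>. 1 / (z0 - of_real s)\<^sup>2)) (at z0)"
proof -
  note [measurable_cong] = \<nu>
  define I where "I z = (LINT s|\<nu>. 1 / (z - of_real s))" for z :: complex
  have key: "norm (1 / (z - of_real s)) \<le> 2 * norm (1 / (z0 - of_real s))"
    if "dist z z0 < \<delta>/2" "\<delta> \<le> norm (z0 - of_real s)" for z :: complex and s :: real
  proof -
    have "norm (z0 - of_real s) \<le> norm (z - of_real s) + norm (z0 - z)"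
      using norm_triangle_ineq[of "z - of_real s" "z0 - z"] by simp
    then have "norm (z0 - of_real s) / 2 \<le> norm (z - of_real s)"
      using that by (simp add: dist_norm norm_minus_commute)
    moreover have "0 < norm (z0 - of_real s)" using that \<delta> by linarith
    ultimately have "1 / norm (z - of_real s) \<le> 1 / (norm (z0 - of_real s) / 2)"
      by (intro divide_left_mono mult_pos_pos) auto
    then show ?thesis by (simp add: norm_divide)
  qed
  have intz: "integrable \<nu> (\<lambda>s. 1 / (z - of_real s))" if "dist z z0 < \<delta>/2" for z
  proof (rule Bochner_Integration.integrable_bound)
    show "integrable \<nu> (\<lambda>s. 2 * norm (1 / (z0 - of_real s)))" using int by (intro integrable_mult_right integrable_norm)
    show "AE s in \<nu>. norm (1 / (z - of_real s)) \<le> norm (2 * norm (1 / (z0 - of_real s)))"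
      using \<delta>(2) by eventually_elim (use key[OF that] in simp)
  qed measurable
  show ?thesis
    unfolding has_field_derivative_iff tendsto_at_iff_sequentially I_def[symmetric]
  proof (intro allI impI, unfold o_def)
    fix X :: "nat \<Rightarrow> complex" assume X: "\<forall>i. X i \<in> UNIV - {z0}" "X \<longlonglongrightarrow> z0"
    then have "\<forall>\<^sub>F n in sequentially. dist (X n) z0 < \<delta>/2" using \<delta>(1) by (intro tendstoD) auto
    then obtain n0 where n0: "\<And>n. n \<ge> n0 \<Longrightarrow> dist (X n) z0 < \<delta>/2" by (auto simp: eventually_sequentially)
    have "(\<lambda>n. LINT s|\<nu>. - 1 / ((X (n + n0) - of_real s) * (z0 - of_real s))) \<longlonglongrightarrow> (LINT s|\<nu>. - 1 / (z0 - of_real s)\<^sup>2)"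
    proof (rule integral_dominated_convergence)
      show "integrable \<nu> (\<lambda>s. 2 / \<delta> * norm (1 / (z0 - of_real s)))" using int by (intro integrable_mult_right integrable_norm)
      show "AE s in \<nu>. (\<lambda>n. - 1 / ((X (n + n0) - of_real s) * (z0 - of_real s))) \<longlonglongrightarrow> - 1 / (z0 - of_real s)\<^sup>2"
        using \<delta>(2)
      proof eventually_elim
        case (elim s)
        then have "z0 - of_real s \<noteq> 0" using \<delta>(1) by auto
        moreover have "(\<lambda>n. X (n + n0)) \<longlonglongrightarrow> z0" using X(2) by (rule LIMSEQ_ignore_initial_segment)
        ultimately show ?case unfolding power2_eq_square by (intro tendsto_intros) auto
      qed
      show "AE s in \<nu>. norm (- 1 / ((X (n + n0) - of_real s) * (z0 - of_real s))) \<le> 2 / \<delta> * norm (1 / (z0 - of_real s))" for n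
        using \<delta>(2)
      proof eventually_elim
        case (elim s)
        have "norm (1 / (X (n + n0) - of_real s)) \<le> 2 * norm (1 / (z0 - of_real s))"
          using key[OF n0 elim] by simp
        also have "\<dots> \<le> 2 * (1 / \<delta>)"
          using elim \<delta>(1) by (simp add: norm_divide frac_le)
        finally have "norm (1 / (X (n + n0) - of_real s)) * norm (1 / (z0 - of_real s)) \<le> 2 / \<delta> * norm (1 / (z0 - of_real s))"
          by (intro mult_right_mono) auto
        then show ?case by (simp add: norm_divide norm_mult)
      qed
    qed measurable
    moreover have "(LINT s|\<nu>. - 1 / ((X (n + n0) - of_real s) * (z0 - of_real s))) = (I (X (n + n0)) - I z0) / (X (n + n0) - z0)" for n
    proof -
      have "dist (X (n + n0)) z0 < \<delta>/2" by (rule n0) simp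
      note i = intz[OF this]
      have "(I (X (n + n0)) - I z0) / (X (n + n0) - z0) = (LINT s|\<nu>. (1 / (X (n + n0) - of_real s) - 1 / (z0 - of_real s)) / (X (n + n0) - z0))"
        unfolding I_def using i int by simp
      also have "\<dots> = (LINT s|\<nu>. - 1 / ((X (n + n0) - of_real s) * (z0 - of_real s)))"
      proof (rule integral_cong_AE)
        show "AE s in \<nu>. (1 / (X (n + n0) - of_real s) - 1 / (z0 - of_real s)) / (X (n + n0) - z0) = - 1 / ((X (n + n0) - of_real s) * (z0 - of_real s))"
          using \<delta>(2)
        proof eventually_elim
          case (elim s)
          have "norm (z0 - of_real s) \<le> norm (X (n + n0) - of_real s) + norm (z0 - X (n + n0))"
            using norm_triangle_ineq[of "X (n + n0) - of_real s" "z0 - X (n + n0)"] by simp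
          then have "X (n + n0) - of_real s \<noteq> 0" "z0 - of_real s \<noteq> 0"
            using elim \<delta>(1) \<open>dist (X (n + n0)) z0 < \<delta>/2\<close> by (auto simp: dist_norm norm_minus_commute)
          moreover have "X (n + n0) - z0 \<noteq> 0" using X(1) by auto
          ultimately show ?case using inverse_difference_quotient[of "X (n + n0) - of_real s" "z0 - of_real s"] by simp
        qed
      qed measurable
      finally show ?thesis by simp
    qed
    ultimately have "(\<lambda>n. (I (X (n + n0)) - I z0) / (X (n + n0) - z0)) \<longlonglongrightarrow> - (LINT s|\<nu>. 1 / (z0 - of_real s)\<^sup>2)"
      by simp
    then show "(\<lambda>n. (I (X n) - I z0) / (X n - z0)) \<longlonglongrightarrow> - (LINT s|\<nu>. 1 / (z0 - of_real s)\<^sup>2)"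
      by (rule LIMSEQ_offset)
  qed
qed

lemma holomorphic_Q_trans:
  assumes "\<nu> \<in> M_plus 1"
  shows "Q_trans \<nu> holomorphic_on {z. 0 < Im z}"
proof -
  have "(\<lambda>z. LINT s|\<nu>. 1 / (z - of_real s)) holomorphic_on {z. 0 < Im z}"
    unfolding holomorphic_on_def
  proof (rule ballI, rule field_differentiable_at_within)
    fix z assume z: "z \<in> {z. 0 < Im z}"
    have "Im z \<le> norm (z - of_real s)" for s
      using abs_Im_le_cmod[of "z - of_real s"] by simp
    then have "((\<lambda>z. LINT s|\<nu>. 1 / (z - of_real s)) has_field_derivative - (LINT s|\<nu>. 1 / (z - of_real s)\<^sup>2)) (at z)"
      using M_plus_1D[OF assms] z
      by (intro has_field_derivative_Cauchy_transform[where \<delta>="Im z"] integrable_Cauchy_kernel) auto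
    then show "(\<lambda>z. LINT s|\<nu>. 1 / (z - of_real s)) field_differentiable at z"
      unfolding field_differentiable_def by blast
  qed
  then show ?thesis unfolding Q_trans_eq[abs_def] by (intro holomorphic_intros)
qed

lemma Q_trans_Complex:
  assumes "\<nu> \<in> M_plus 1" "0 < \<epsilon>"
  shows "Re (Q_trans \<nu> (Complex t \<epsilon>)) = poisson \<nu> t \<epsilon>"
    and "Im (Q_trans \<nu> (Complex t \<epsilon>)) = (LINT s|\<nu>. (t - s) / (pi * ((t - s)\<^sup>2 + \<epsilon>\<^sup>2)))"
proof -
  have int: "integrable \<nu> (\<lambda>s. 1 / (Complex t \<epsilon> - of_real s))"
    using M_plus_1D[OF assms(1)] assms(2) by (intro integrable_Cauchy_kernel) auto
  have "integrable \<nu> (\<lambda>s. \<i> / (of_real pi * (Complex t \<epsilon> - of_real s)))"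
    using integrable_mult_right[OF int, of "\<i> / of_real pi"] by simp
  then have "Re (Q_trans \<nu> (Complex t \<epsilon>)) = (LINT s|\<nu>. Re (\<i> / (of_real pi * (Complex t \<epsilon> - of_real s))))"
    "Im (Q_trans \<nu> (Complex t \<epsilon>)) = (LINT s|\<nu>. Im (\<i> / (of_real pi * (Complex t \<epsilon> - of_real s))))"
    unfolding Q_trans_def by (simp_all only: integral_Re integral_Im)
  moreover have "Re (\<i> / (of_real pi * (Complex t \<epsilon> - of_real s))) = poisson_kernel t \<epsilon> s"
    "Im (\<i> / (of_real pi * (Complex t \<epsilon> - of_real s))) = (t - s) / (pi * ((t - s)\<^sup>2 + \<epsilon>\<^sup>2))" for s
    unfolding Re_divide Im_divide poisson_kernel_def using pi_gt_zero
    by (simp_all add: power_mult_distrib flip: distrib_left) (simp_all add: power2_eq_square mult.assoc)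
  ultimately show "Re (Q_trans \<nu> (Complex t \<epsilon>)) = poisson \<nu> t \<epsilon>"
    "Im (Q_trans \<nu> (Complex t \<epsilon>)) = (LINT s|\<nu>. (t - s) / (pi * ((t - s)\<^sup>2 + \<epsilon>\<^sup>2)))"
    by (simp_all add: poisson_def)
qed

section \<open>The two factors of the defining identity and their boundary values\<close>

lemma M_plus_mono:
  assumes "\<nu> \<in> M_plus m" "m \<le> n"
  shows "\<nu> \<in> M_plus n"
proof -
  have "(\<integral>\<^sup>+s. ennreal ((1 + s\<^sup>2) powr (- n / 2)) \<partial>\<nu>) \<le> (\<integral>\<^sup>+s. ennreal ((1 + s\<^sup>2) powr (- m / 2)) \<partial>\<nu>)"
    using assms(2) by (intro nn_integral_mono ennreal_leI powr_mono) auto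
  then show ?thesis using assms(1) by (auto simp: M_plus_def)
qed

text \<open>Both factors of the identity have this form, one with M, c0, c1 and the other with
  \<mu>, \<zeta>0, \<zeta>1, so each property is proved once for both.\<close>

definition B_factor :: "real measure \<Rightarrow> real \<Rightarrow> real \<Rightarrow> complex \<Rightarrow> complex" where
  "B_factor \<nu> a b z = Q_trans \<nu> z - \<i> * of_real a / of_real pi - \<i> * of_real b * z / of_real pi"

lemma holomorphic_B_factor:
  "\<nu> \<in> M_plus 1 \<Longrightarrow> B_factor \<nu> a b holomorphic_on {z. 0 < Im z}"
  unfolding B_factor_def[abs_def] by (intro holomorphic_intros holomorphic_Q_trans) auto

lemma Re_B_factor:
  assumes "\<nu> \<in> M_plus 1" "0 < \<epsilon>"
  shows "Re (B_factor \<nu> a b (Complex t \<epsilon>)) = poisson \<nu> t \<epsilon> + b * \<epsilon> / pi"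
  using Q_trans_Complex[OF assms, of t] by (simp add: B_factor_def)

lemma Im_B_factor:
  "Im (B_factor \<nu> a b (Complex t \<epsilon>)) = Im (Q_trans \<nu> (Complex t \<epsilon>)) - (b * t + a) / pi"
  by (simp add: B_factor_def add_divide_distrib)

lemma poisson_pos:
  assumes "\<nu> \<in> M_plus 1" "0 < \<epsilon>"
  shows "0 < poisson \<nu> t \<epsilon>"
proof (rule ccontr)
  note [measurable_cong] = M_plus_1D(1)[OF assms(1)]
  assume "\<not> 0 < poisson \<nu> t \<epsilon>"
  then have "poisson \<nu> t \<epsilon> = 0" using poisson_nonneg[of \<epsilon> \<nu> t] assms(2) by simp
  then have "AE s in \<nu>. poisson_kernel t \<epsilon> s = 0"
    unfolding poisson_def using integrable_poisson_kernel[OF M_plus_1D(4)[OF assms(1)]] assms(2)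
    by (subst (asm) integral_nonneg_eq_0_iff_AE) (auto simp: poisson_kernel_nonneg)
  moreover have "poisson_kernel t \<epsilon> s \<noteq> 0" for s
  proof -
    have "0 < (t - s)\<^sup>2 + \<epsilon>\<^sup>2" using assms(2) by (intro add_nonneg_pos) auto
    then show ?thesis using assms(2) by (simp add: poisson_kernel_def)
  qed
  ultimately have "AE s in \<nu>. False" by simp
  then have "emeasure \<nu> UNIV = 0"
    using AE_iff_measurable[of UNIV \<nu> "\<lambda>_. False"] M_plus_1D(1,2)[OF assms(1)] by simp
  then show False using assms(1) by (simp add: M_plus_def)
qed

lemma Re_B_factor_pos:
  assumes "\<nu> \<in> M_plus 1" "0 \<le> b" "0 < Im z"
  shows "0 < Re (B_factor \<nu> a b z)"
proof -
  have "0 \<le> b * Im z / pi" using assms by simp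
  moreover have "0 < poisson \<nu> (Re z) (Im z)" using assms by (intro poisson_pos)
  ultimately show ?thesis using Re_B_factor[OF assms(1,3), of a b "Re z"] by simp
qed

lemma is_B_iff:
  "is_B M c0 c1 \<mu> \<zeta>0 \<zeta>1 \<longleftrightarrow> \<mu> \<in> M_plus 1 \<and> 0 \<le> \<zeta>1 \<and>
    (\<forall>z. 0 < Im z \<longrightarrow> B_factor M c0 c1 z * B_factor \<mu> \<zeta>0 \<zeta>1 z = 1)"
  by (simp add: is_B_def B_factor_def)

lemma hilbert_eqI: "has_hilbert M t h \<Longrightarrow> hilbert M t = h"
  unfolding has_hilbert_def hilbert_def by (intro tendsto_Lim) auto

lemma eventually_at_right_0I:
  "(\<And>\<epsilon>. 0 < \<epsilon> \<Longrightarrow> P \<epsilon>) \<Longrightarrow> \<forall>\<^sub>F \<epsilon> in at_right (0::real). P \<epsilon>"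
  using eventually_at_right_less[of "0::real"] by (rule eventually_mono)

text \<open>The factor has positive real part, hence a boundary limit almost everywhere. Its
  imaginary part yields existence of the Hilbert transform, and differentiation of M identifies its
  real part.\<close>

lemma AE_B_factor_limit:
  assumes M: "M \<in> M_plus 1" and "0 \<le> c1" and cd: "continuous_density M \<rho>"
  shows "AE t in lborel. (\<exists>h. has_hilbert M t h) \<and>
    ((\<lambda>\<epsilon>. B_factor M c0 c1 (Complex t \<epsilon>)) \<longlongrightarrow> Complex (\<rho> t) (hilbert M t - (c1 * t + c0) / pi)) (at_right 0)"
proof -
  have "AE t in lborel. \<exists>l. ((\<lambda>\<epsilon>. B_factor M c0 c1 (Complex t \<epsilon>)) \<longlongrightarrow> l) (at_right 0)"
    using assms by (intro AE_boundary_limit holomorphic_B_factor Re_B_factor_pos)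
  moreover have "AE t in lborel. ((\<lambda>\<epsilon>. poisson M t \<epsilon>) \<longlongrightarrow> \<rho> t) (at_right 0)"
    using cd M_plus_1D(4)[OF M] by (rule AE_poisson_tendsto_density)
  ultimately show ?thesis
  proof eventually_elim
    case (elim t)
    then obtain l where l: "((\<lambda>\<epsilon>. B_factor M c0 c1 (Complex t \<epsilon>)) \<longlongrightarrow> l) (at_right 0)" by blast
    have "((\<lambda>\<epsilon>. Im (B_factor M c0 c1 (Complex t \<epsilon>)) + (c1 * t + c0) / pi) \<longlongrightarrow> Im l + (c1 * t + c0) / pi) (at_right 0)"
      using l by (intro tendsto_intros)
    then have h: "has_hilbert M t (Im l + (c1 * t + c0) / pi)"
      by (simp add: has_hilbert_def Im_B_factor)
    have "((\<lambda>\<epsilon>. poisson M t \<epsilon> + c1 * \<epsilon> / pi) \<longlongrightarrow> \<rho> t + c1 * 0 / pi) (at_right 0)"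
      using elim by (intro tendsto_intros) auto
    moreover have "\<forall>\<^sub>F \<epsilon> in at_right 0. poisson M t \<epsilon> + c1 * \<epsilon> / pi = Re (B_factor M c0 c1 (Complex t \<epsilon>))"
      by (rule eventually_at_right_0I) (simp add: Re_B_factor[OF M])
    ultimately have "((\<lambda>\<epsilon>. Re (B_factor M c0 c1 (Complex t \<epsilon>))) \<longlongrightarrow> \<rho> t) (at_right 0)"
      by (simp add: tendsto_cong)
    moreover have "((\<lambda>\<epsilon>. Re (B_factor M c0 c1 (Complex t \<epsilon>))) \<longlongrightarrow> Re l) (at_right 0)"
      using l by (rule tendsto_Re)
    ultimately have "\<rho> t = Re l" by (rule tendsto_unique[OF trivial_limit_at_right_real])
    then have "l = Complex (\<rho> t) (hilbert M t - (c1 * t + c0) / pi)"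
      using hilbert_eqI[OF h] by (simp add: complex_eq_iff)
    then show ?case using l h by blast
  qed
qed

text \<open>The product of the two boundary values is again 1. Hence the boundary value of the
  factor of M is nonzero almost everywhere, and the real part of its reciprocal is the asserted
  density.\<close>

lemma AE_density_eq_mu_density:
  assumes M: "M \<in> M_plus 1" and "0 \<le> c1" and cd: "continuous_density M \<rho>"
    and B: "is_B M c0 c1 \<mu> \<zeta>0 \<zeta>1" and cdf: "continuous_density \<mu> f"
  shows "AE t in lborel. f t = mu_density M \<rho> c0 c1 t"
proof -
  have \<mu>: "\<mu> \<in> M_plus 1" "0 \<le> \<zeta>1" and eq: "\<And>z. 0 < Im z \<Longrightarrow> B_factor M c0 c1 z * B_factor \<mu> \<zeta>0 \<zeta>1 z = 1"
    using B by (auto simp: is_B_iff)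
  from AE_B_factor_limit[OF M \<open>0 \<le> c1\<close> cd, of c0] AE_B_factor_limit[OF \<mu> cdf, of \<zeta>0]
  show ?thesis
  proof eventually_elim
    case (elim t)
    define a where "a = Complex (\<rho> t) (hilbert M t - (c1 * t + c0) / pi)"
    define b where "b = Complex (f t) (hilbert \<mu> t - (\<zeta>1 * t + \<zeta>0) / pi)"
    have "((\<lambda>\<epsilon>. B_factor M c0 c1 (Complex t \<epsilon>) * B_factor \<mu> \<zeta>0 \<zeta>1 (Complex t \<epsilon>)) \<longlongrightarrow> a * b) (at_right 0)"
      using elim unfolding a_def b_def by (intro tendsto_mult) auto
    moreover have "\<forall>\<^sub>F \<epsilon> in at_right 0. B_factor M c0 c1 (Complex t \<epsilon>) * B_factor \<mu> \<zeta>0 \<zeta>1 (Complex t \<epsilon>) = 1"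
      by (rule eventually_at_right_0I) (simp add: eq)
    ultimately have "((\<lambda>\<epsilon>::real. 1) \<longlongrightarrow> a * b) (at_right 0)" by (rule Lim_transform_eventually)
    then have "a * b = 1" by (simp add: tendsto_const_iff)
    then have "b = 1 / a" by (metis divide_eq_eq mult.commute mult_zero_left zero_neq_one)
    then have "Re b = Re a / ((Re a)\<^sup>2 + (Im a)\<^sup>2)" by (simp add: Re_divide)
    then show ?case by (simp add: a_def b_def mu_density_def)
  qed
qed

section \<open>The singular part of the transformed measure\<close>

text \<open>For |t - s| \<le> \<epsilon> the Poisson kernel is at least 1 / (2 pi
  \<epsilon>).\<close>

lemma emeasure_Icc_le_poisson:
  assumes \<nu>: "poisson_measure \<nu>" and "0 < \<epsilon>"
  shows "emeasure \<nu> {t-\<epsilon>..t+\<epsilon>} \<le> ennreal (2 * pi * \<epsilon> * poisson \<nu> t \<epsilon>)"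
proof -
  note [measurable_cong] = poisson_measureD(1)[OF \<nu>] and [simp] = poisson_measureD(1,2)[OF \<nu>]
  have "emeasure \<nu> {t-\<epsilon>..t+\<epsilon>} = (\<integral>\<^sup>+s. indicator {t-\<epsilon>..t+\<epsilon>} s \<partial>\<nu>)" by simp
  also have "\<dots> \<le> (\<integral>\<^sup>+s. ennreal (2 * pi * \<epsilon>) * ennreal (poisson_kernel t \<epsilon> s) \<partial>\<nu>)"
  proof (intro nn_integral_mono)
    fix s
    have "1 \<le> 2 * pi * \<epsilon> * poisson_kernel t \<epsilon> s" if "s \<in> {t-\<epsilon>..t+\<epsilon>}"
    proof -
      have "\<bar>t - s\<bar> \<le> \<bar>\<epsilon>\<bar>" using that by auto
      then have "(t - s)\<^sup>2 \<le> \<epsilon>\<^sup>2" by (simp add: abs_le_square_iff)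
      moreover have "0 < (t - s)\<^sup>2 + \<epsilon>\<^sup>2" using \<open>0 < \<epsilon>\<close> by (intro add_nonneg_pos) auto
      moreover have "2 * pi * \<epsilon> * poisson_kernel t \<epsilon> s = 2 * \<epsilon>\<^sup>2 / ((t - s)\<^sup>2 + \<epsilon>\<^sup>2)"
        by (simp add: poisson_kernel_def power2_eq_square)
      ultimately show ?thesis by simp
    qed
    then show "indicator {t-\<epsilon>..t+\<epsilon>} s \<le> ennreal (2 * pi * \<epsilon>) * ennreal (poisson_kernel t \<epsilon> s)"
      using \<open>0 < \<epsilon>\<close> by (auto simp: indicator_def ennreal_mult[symmetric] poisson_kernel_nonneg simp flip: ennreal_1)
  qed
  also have "\<dots> = ennreal (2 * pi * \<epsilon>) * ennreal (poisson \<nu> t \<epsilon>)"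
    using assms by (subst nn_integral_cmult) (auto simp: ennreal_poisson)
  also have "\<dots> = ennreal (2 * pi * \<epsilon> * poisson \<nu> t \<epsilon>)"
    using assms by (intro ennreal_mult[symmetric]) (auto simp: poisson_nonneg)
  finally show ?thesis .
qed

text \<open>The covering lemma asks for one good interval about each point, so a bound along some
  heights tending to 0 is enough. An interval of radius \<epsilon> has mass at most 2 pi \<epsilon>
  C, that is pi C times its length, and the overlap accounts for the factor 2.\<close>

lemma emeasure_le_lborel_of_poisson_bound:
  assumes \<nu>: "poisson_measure \<nu>" and "open U" "0 \<le> C"
    and bound: "\<And>t. t \<in> U \<Longrightarrow> \<exists>\<^sub>F \<epsilon> in at_right 0. poisson \<nu> t \<epsilon> \<le> C"
  shows "emeasure \<nu> U \<le> ennreal (2 * pi * C) * emeasure lborel U"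
proof -
  have "emeasure \<nu> U \<le> 2 * ennreal (pi * C) * emeasure lborel U"
  proof (rule emeasure_le_of_interval_cover)
    fix t assume t: "t \<in> U"
    then obtain d where d: "d > 0" "ball t d \<subseteq> U" using \<open>open U\<close> by (meson openE)
    have "\<forall>\<^sub>F \<epsilon> in at_right 0. \<epsilon> < d" "\<forall>\<^sub>F \<epsilon> in at_right (0::real). 0 < \<epsilon>"
      using d(1) eventually_at_right_less by (auto simp: eventually_at_right_field)
    then have "\<forall>\<^sub>F \<epsilon> in at_right 0. 0 < \<epsilon> \<and> \<epsilon> < d" by eventually_elim auto
    then have "\<exists>\<^sub>F \<epsilon> in at_right 0. poisson \<nu> t \<epsilon> \<le> C \<and> 0 < \<epsilon> \<and> \<epsilon> < d"
      using bound[OF t] frequently_eventually_frequently by fastforce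
    then obtain \<epsilon> where \<epsilon>: "poisson \<nu> t \<epsilon> \<le> C" "0 < \<epsilon>" "\<epsilon> < d" by (auto dest: frequently_ex)
    have "emeasure \<nu> {t-\<epsilon><..<t+\<epsilon>} \<le> emeasure \<nu> {t-\<epsilon>..t+\<epsilon>}"
      using poisson_measureD(1)[OF \<nu>] by (intro emeasure_mono) auto
    also have "\<dots> \<le> ennreal (2 * pi * \<epsilon> * poisson \<nu> t \<epsilon>)" using \<nu> \<epsilon>(2) by (rule emeasure_Icc_le_poisson)
    also have "\<dots> \<le> ennreal (pi * C * (2 * \<epsilon>))"
      using \<epsilon> by (intro ennreal_leI) (simp add: mult_ac mult_left_mono)
    also have "\<dots> = ennreal (pi * C) * emeasure lborel {t-\<epsilon><..<t+\<epsilon>}"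
      using \<epsilon> \<open>0 \<le> C\<close> by (simp add: ennreal_mult)
    finally show "\<exists>a b. a < t \<and> t < b \<and> {a<..<b} \<subseteq> U \<and> emeasure \<nu> {a<..<b} \<le> ennreal (pi * C) * emeasure lborel {a<..<b}"
      using \<epsilon> d(2) by (intro exI[of _ "t-\<epsilon>"] exI[of _ "t+\<epsilon>"]) (auto simp: ball_eq_greaterThanLessThan)
  qed (use assms in \<open>auto simp: poisson_measureD\<close>)
  also have "2 * ennreal (pi * C) = ennreal (2 * pi * C)"
    using \<open>0 \<le> C\<close> by (simp add: ennreal_mult' mult.assoc flip: ennreal_numeral)
  finally show ?thesis .
qed

lemma null_set_of_poisson_bound:
  assumes \<nu>: "poisson_measure \<nu>" and "open U" "0 \<le> C"
    and bound: "\<And>t. t \<in> U \<Longrightarrow> \<exists>\<^sub>F \<epsilon> in at_right 0. poisson \<nu> t \<epsilon> \<le> C"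
    and A: "A \<in> null_sets lborel" "A \<subseteq> U"
  shows "emeasure \<nu> A = 0"
proof -
  have "emeasure \<nu> A \<le> 0 + ennreal e" if "0 < e" for e
  proof -
    \<comment> \<open>The summand 1 keeps the denominator positive when C = 0.\<close>
    define e' where "e' = e / (2 * pi * C + 1)"
    have C1: "0 < 2 * pi * C + 1" using \<open>0 \<le> C\<close> by (simp add: add_nonneg_pos)
    then have "0 < e'" using that by (simp add: e'_def)
    have "A \<in> sets lebesgue" using A by auto
    then obtain T where T: "open T" "A \<subseteq> T" "T - A \<in> lmeasurable" "emeasure lebesgue (T - A) < ennreal e'"
      using sets_lebesgue_outer_open[OF _ \<open>0 < e'\<close>] by metis
    have [measurable]: "A \<in> sets borel" "T \<in> sets borel" "U \<in> sets borel" using A T \<open>open U\<close> by auto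
    have "emeasure lborel (T \<inter> U) \<le> emeasure lborel T" by (intro emeasure_mono) auto
    also have "\<dots> \<le> emeasure lborel ((T - A) \<union> A)" by (intro emeasure_mono) auto
    also have "\<dots> \<le> emeasure lborel (T - A) + emeasure lborel A" by (intro emeasure_subadditive) auto
    also have "\<dots> \<le> ennreal e'"
    proof -
      have "emeasure lborel A = 0" using A(1) by auto
      then show ?thesis using T(4) by (simp add: emeasure_completion less_imp_le)
    qed
    finally have TU: "emeasure lborel (T \<inter> U) \<le> ennreal e'" .
    have "emeasure \<nu> A \<le> emeasure \<nu> (T \<inter> U)"
      using T A poisson_measureD(1)[OF \<nu>] by (intro emeasure_mono) auto
    also have "\<dots> \<le> ennreal (2 * pi * C) * emeasure lborel (T \<inter> U)"
      using assms T by (intro emeasure_le_lborel_of_poisson_bound) auto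
    also have "\<dots> \<le> ennreal (2 * pi * C) * ennreal e'" using TU by (intro mult_left_mono) auto
    also have "\<dots> = ennreal (2 * pi * C * e')" using \<open>0 \<le> C\<close> by (intro ennreal_mult'[symmetric]) auto
    also have "\<dots> \<le> ennreal e"
      using C1 \<open>0 < e\<close> by (intro ennreal_leI) (simp add: e'_def field_simps)
    finally show ?thesis by simp
  qed
  then have "emeasure \<nu> A \<le> 0" by (rule ennreal_le_epsilon) blast
  then show ?thesis by simp
qed

text \<open>The Poisson integral of \<mu> is at most the real part of its factor, hence at most the
  modulus, which is the reciprocal of the modulus of the factor of M. Estimates on \<mu> thus become
  lower bounds for the factor of M.\<close>

lemma poisson_le_inverse_norm:
  assumes B: "is_B M c0 c1 \<mu> \<zeta>0 \<zeta>1" and "0 < \<epsilon>" "0 < d" "d \<le> norm (B_factor M c0 c1 (Complex t \<epsilon>))"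
  shows "poisson \<mu> t \<epsilon> \<le> 1 / d"
proof -
  have \<mu>: "\<mu> \<in> M_plus 1" "0 \<le> \<zeta>1" and eq: "B_factor M c0 c1 (Complex t \<epsilon>) * B_factor \<mu> \<zeta>0 \<zeta>1 (Complex t \<epsilon>) = 1"
    using B \<open>0 < \<epsilon>\<close> by (auto simp: is_B_iff)
  have "poisson \<mu> t \<epsilon> \<le> Re (B_factor \<mu> \<zeta>0 \<zeta>1 (Complex t \<epsilon>))"
    using Re_B_factor[OF \<mu>(1) \<open>0 < \<epsilon>\<close>] \<mu>(2) \<open>0 < \<epsilon>\<close> by simp
  also have "\<dots> \<le> norm (B_factor \<mu> \<zeta>0 \<zeta>1 (Complex t \<epsilon>))" by (rule complex_Re_le_cmod)
  also have "\<dots> = 1 / norm (B_factor M c0 c1 (Complex t \<epsilon>))"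
  proof -
    have "norm (B_factor M c0 c1 (Complex t \<epsilon>)) * norm (B_factor \<mu> \<zeta>0 \<zeta>1 (Complex t \<epsilon>)) = 1"
      using arg_cong[OF eq, of norm] by (simp add: norm_mult)
    moreover have "norm (B_factor M c0 c1 (Complex t \<epsilon>)) \<noteq> 0" using assms by linarith
    ultimately show ?thesis by (simp add: field_simps)
  qed
  also have "\<dots> \<le> 1 / d" using assms by (intro divide_left_mono mult_pos_pos) auto
  finally show ?thesis .
qed

text \<open>Away from the closure of \<open>S e\<close> every point has upper density at least e. So
  there are arbitrarily small \<delta> for which the interval of radius \<delta> has mass above e
  \<delta>, and then the Poisson integral of M at height \<delta> is at least e / (2 pi). Upper
  density controls only such a sequence of heights, whence the frequent quantifier.\<close>

lemma poisson_bound_in_support: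
  assumes M: "M \<in> M_plus 1" and "0 \<le> c1" and B: "is_B M c0 c1 \<mu> \<zeta>0 \<zeta>1"
    and t: "t \<notin> zero_set M"
  shows "\<exists>U C. open U \<and> t \<in> U \<and> 0 \<le> C \<and> (\<forall>u\<in>U. \<exists>\<^sub>F \<epsilon> in at_right 0. poisson \<mu> u \<epsilon> \<le> C)"
proof -
  define S where "S e = {s. Limsup (at_right 0) (\<lambda>\<delta>. emeasure M {s - \<delta>..s + \<delta>} / ennreal (2 * \<delta>)) < ennreal e}" for e
  obtain e where e: "0 < e" "t \<notin> closure (S e)"
    using t by (auto simp: zero_set_def S_def)
  have "\<exists>\<^sub>F \<epsilon> in at_right 0. poisson \<mu> u \<epsilon> \<le> 1 / (e / (2 * pi))" if u: "u \<in> - closure (S e)" for u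
  proof -
    have "u \<notin> S e" using u closure_subset by blast
    then have "ennreal e \<le> Limsup (at_right 0) (\<lambda>\<delta>. emeasure M {u - \<delta>..u + \<delta>} / ennreal (2 * \<delta>))"
      by (simp add: S_def not_less)
    moreover have "ennreal (e/2) < ennreal e" using e(1) by (intro ennreal_lessI) auto
    ultimately have "\<not> Limsup (at_right 0) (\<lambda>\<delta>. emeasure M {u - \<delta>..u + \<delta>} / ennreal (2 * \<delta>)) \<le> ennreal (e/2)"
      by (simp add: not_le)
    then have "\<exists>\<^sub>F \<delta> in at_right 0. \<not> emeasure M {u - \<delta>..u + \<delta>} / ennreal (2 * \<delta>) \<le> ennreal (e/2)"
      unfolding frequently_def using Limsup_bounded by fastforce
    moreover have "\<forall>\<^sub>F \<delta> in at_right (0::real). 0 < \<delta>" by (rule eventually_at_right_less)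
    ultimately have "\<exists>\<^sub>F \<delta> in at_right 0. \<not> emeasure M {u - \<delta>..u + \<delta>} / ennreal (2 * \<delta>) \<le> ennreal (e/2) \<and> 0 < \<delta>"
      by (rule frequently_eventually_frequently)
    then show ?thesis
    proof (rule frequently_elim1)
      fix \<delta> :: real
      assume H: "\<not> emeasure M {u - \<delta>..u + \<delta>} / ennreal (2 * \<delta>) \<le> ennreal (e/2) \<and> 0 < \<delta>"
      have "e / (2 * pi) \<le> poisson M u \<delta>"
      proof (rule ccontr)
        assume "\<not> ?thesis"
        then have "2 * pi * \<delta> * poisson M u \<delta> \<le> e * \<delta>" using H by (simp add: field_simps)
        then have "emeasure M {u - \<delta>..u + \<delta>} \<le> ennreal (e * \<delta>)"
          using emeasure_Icc_le_poisson[OF M_plus_1D(4)[OF M], of \<delta> u] H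
          by (meson ennreal_leI order_trans)
        then have "emeasure M {u - \<delta>..u + \<delta>} / ennreal (2 * \<delta>) \<le> ennreal (e * \<delta>) / ennreal (2 * \<delta>)"
          by (rule divide_right_mono_ennreal)
        also have "\<dots> = ennreal (e/2)" using H e(1) by (subst divide_ennreal) auto
        finally show False using H by simp
      qed
      also have "\<dots> \<le> Re (B_factor M c0 c1 (Complex u \<delta>))" using Re_B_factor[OF M] H \<open>0 \<le> c1\<close> by simp
      also have "\<dots> \<le> norm (B_factor M c0 c1 (Complex u \<delta>))" by (rule complex_Re_le_cmod)
      finally show "poisson \<mu> u \<delta> \<le> 1 / (e / (2 * pi))"
        using H e(1) by (intro poisson_le_inverse_norm[OF B]) auto
    qed
  qed
  then show ?thesis using e by (intro exI[of _ "- closure (S e)"] exI[of _ "1 / (e / (2 * pi))"]) auto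
qed

text \<open>Off the support the factor of M extends continuously to the real point t. The imaginary
  part of its value there is \<open>hilbert M t - (c1 * t + c0) / pi\<close>, which is nonzero by
  assumption, so the modulus is bounded below on a whole neighbourhood.\<close>

lemma poisson_bound_off_support:
  assumes M: "M \<in> M_plus 1" and B: "is_B M c0 c1 \<mu> \<zeta>0 \<zeta>1"
    and t: "t \<notin> msupp M" "t \<notin> hilbert_zeros M c0 c1"
  shows "\<exists>U C. open U \<and> t \<in> U \<and> 0 \<le> C \<and> (\<forall>u\<in>U. \<exists>\<^sub>F \<epsilon> in at_right 0. poisson \<mu> u \<epsilon> \<le> C)"
proof -
  note sets = M_plus_1D(1)[OF M]
  note [measurable_cong] = sets
  obtain V where V: "open V" "t \<in> V" "emeasure M V = 0" using t(1) by (auto simp: msupp_def)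
  obtain \<delta> where \<delta>: "0 < \<delta>" "ball t \<delta> \<subseteq> V" using V by (meson openE)
  have AE: "AE s in M. \<delta> \<le> norm (of_real t - complex_of_real s)"
  proof -
    have "V \<in> null_sets M" using V sets by auto
    then have "AE s in M. s \<notin> V" by (rule AE_not_in)
    then show ?thesis
    proof eventually_elim
      case (elim s)
      then have "s \<notin> ball t \<delta>" using \<delta> by auto
      then show ?case by (simp add: dist_norm norm_of_real flip: of_real_diff)
    qed
  qed
  have int: "integrable M (\<lambda>s. 1 / (of_real t - complex_of_real s))"
  proof (rule Bochner_Integration.integrable_bound)
    \<comment> \<open>The factor 2 comes from \<open>inverse_sum_le\<close>, used because the kernel
      at a real point lacks the term \<open>\<delta>\<^sup>2\<close>.\<close>
    define C where "C = sqrt (2 * (2 + (1 + 2*t\<^sup>2) / \<delta>\<^sup>2))"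
    show "integrable M (\<lambda>s. C * (1 + s\<^sup>2) powr (-1/2))" using M_plus_1D(3)[OF M] by simp
    show "AE s in M. norm (1 / (of_real t - complex_of_real s)) \<le> norm (C * (1 + s\<^sup>2) powr (-1/2))"
      using AE
    proof eventually_elim
      case (elim s)
      have pos: "0 < 1 + s\<^sup>2" by (simp add: add_pos_nonneg)
      have le: "\<delta> \<le> \<bar>t - s\<bar>" using elim by (simp add: norm_of_real flip: of_real_diff)
      then have "\<delta>\<^sup>2 \<le> (t - s)\<^sup>2" using \<delta>(1) by (metis abs_le_square_iff abs_of_pos)
      then have "1 / ((t - s)\<^sup>2 + 0) \<le> 2 * (1 / ((t - s)\<^sup>2 + \<delta>\<^sup>2))"
        using \<delta>(1) by (intro inverse_sum_le) auto
      also have "\<dots> \<le> 2 * ((2 + (1 + 2*t\<^sup>2) / \<delta>\<^sup>2) * (1 / (1 + s\<^sup>2)))"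
        using \<delta>(1) by (intro mult_left_mono inverse_shifted_square_le) auto
      finally have "(1 / \<bar>t - s\<bar>)\<^sup>2 \<le> 2 * (2 + (1 + 2*t\<^sup>2) / \<delta>\<^sup>2) * (1 / (1 + s\<^sup>2))"
        by (simp add: power_divide mult.assoc)
      then have "1 / \<bar>t - s\<bar> \<le> sqrt (2 * (2 + (1 + 2*t\<^sup>2) / \<delta>\<^sup>2) * (1 / (1 + s\<^sup>2)))"
        by (rule real_le_rsqrt)
      also have "\<dots> = C * (1 + s\<^sup>2) powr (-1/2)"
        using pos by (simp only: real_sqrt_mult C_def) (simp add: real_sqrt_divide powr_minus powr_half_sqrt inverse_eq_divide)
      finally show ?case by (simp add: norm_divide norm_of_real flip: of_real_diff) 
    qed
  qed measurable
  have "isCont (\<lambda>z. LINT s|M. 1 / (z - complex_of_real s)) (of_real t)"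
    using has_field_derivative_Cauchy_transform[OF sets \<delta>(1) AE int] by (rule DERIV_isCont)
  then have cQ: "isCont (Q_trans M) (of_real t)"
    unfolding Q_trans_eq[abs_def] by (intro continuous_intros)
  have Ct: "((\<lambda>\<epsilon>. Complex t \<epsilon>) \<longlongrightarrow> Complex t 0) (at_right 0)"
    by (intro tendsto_intros)
  \<comment> \<open>\<open>hilbert_zeros\<close> demands existence of the limit, so this is needed
    to conclude from \<open>t(2)\<close> that the value is nonzero.\<close>
  then have hh: "has_hilbert M t (Im (Q_trans M (of_real t)))"
    unfolding has_hilbert_def using isCont_tendsto_compose[OF cQ] by (intro tendsto_Im) (simp add: complex_of_real_def)
  have cB: "isCont (B_factor M c0 c1) (of_real t)"
    unfolding B_factor_def[abs_def] using cQ by (intro continuous_intros) auto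
  have nz: "B_factor M c0 c1 (of_real t) \<noteq> 0"
  proof
    assume "B_factor M c0 c1 (of_real t) = 0"
    then have "Im (B_factor M c0 c1 (Complex t 0)) = 0" by (simp add: complex_of_real_def)
    then have "hilbert M t - (c1 * t + c0) / pi = 0"
      using hilbert_eqI[OF hh] by (simp add: Im_B_factor complex_of_real_def)
    then show False using t(2) hh by (auto simp: hilbert_zeros_def)
  qed
  define m where "m = norm (B_factor M c0 c1 (of_real t)) / 2"
  have m: "0 < m" "m < norm (B_factor M c0 c1 (of_real t))" using nz by (auto simp: m_def)
  have "((\<lambda>z. norm (B_factor M c0 c1 z)) \<longlongrightarrow> norm (B_factor M c0 c1 (of_real t))) (nhds (of_real t))"
    using cB by (intro tendsto_norm) (simp add: isCont_def tendsto_at_iff_tendsto_nhds)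
  then have "\<forall>\<^sub>F z in nhds (of_real t). m < norm (B_factor M c0 c1 z)"
    using m(2) by (rule order_tendstoD)
  then obtain d where d: "0 < d" "\<And>z. dist z (of_real t) < d \<Longrightarrow> m < norm (B_factor M c0 c1 z)"
    unfolding eventually_nhds_metric by blast
  have "\<exists>\<^sub>F \<epsilon> in at_right 0. poisson \<mu> u \<epsilon> \<le> 1 / m" if "u \<in> ball t (d/2)" for u
  proof (rule eventually_frequently[OF trivial_limit_at_right_real])
    have "poisson \<mu> u \<epsilon> \<le> 1 / m" if "0 < \<epsilon>" "\<epsilon> < d/2" for \<epsilon>
    proof (rule poisson_le_inverse_norm[OF B that(1) m(1)])
      have "dist (Complex u \<epsilon>) (of_real t) \<le> \<bar>u - t\<bar> + \<bar>\<epsilon>\<bar>"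
        unfolding dist_norm using cmod_le[of "Complex u \<epsilon> - of_real t"] by simp
      also have "\<dots> < d" using that \<open>u \<in> ball t (d/2)\<close> by (simp add: dist_real_def abs_minus_commute field_simps)
      finally show "m \<le> norm (B_factor M c0 c1 (Complex u \<epsilon>))" using d(2) less_imp_le by blast
    qed
    then show "\<forall>\<^sub>F \<epsilon> in at_right 0. poisson \<mu> u \<epsilon> \<le> 1 / m"
      unfolding eventually_at_right_field using d(1) by (intro exI[of _ "d/2"]) auto
  qed
  then show ?thesis using m d(1) by (intro exI[of _ "ball t (d/2)"] exI[of _ "1/m"]) auto
qed

text \<open>Each point of A lies outside one of the two pieces of \<open>Z_prime\<close>, and so has
  a neighbourhood where \<mu> is dominated by a multiple of Lebesgue measure. Lindelof's theorem
  selects countably many of these neighbourhoods.\<close>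

lemma emeasure_null_set_off_Z_prime:
  assumes M: "M \<in> M_plus 1" and "0 \<le> c1" and B: "is_B M c0 c1 \<mu> \<zeta>0 \<zeta>1"
    and A: "A \<in> null_sets lborel" "A \<inter> Z_prime M c0 c1 = {}"
  shows "emeasure \<mu> A = 0"
proof -
  have \<mu>: "poisson_measure \<mu>" using B M_plus_1D(4) by (auto simp: is_B_iff)
  have "\<exists>U C. open U \<and> t \<in> U \<and> 0 \<le> C \<and> (\<forall>u\<in>U. \<exists>\<^sub>F \<epsilon> in at_right 0. poisson \<mu> u \<epsilon> \<le> C)" if "t \<in> A" for t
  proof (cases "t \<in> msupp M")
    case True
    then have "t \<notin> zero_set M" using A(2) that by (auto simp: Z_prime_def)
    then show ?thesis using assms by (intro poisson_bound_in_support) auto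
  next
    case False
    then have "t \<notin> hilbert_zeros M c0 c1" using A(2) that by (auto simp: Z_prime_def)
    then show ?thesis using False assms by (intro poisson_bound_off_support) auto
  qed
  then obtain U C where U: "\<And>t. t \<in> A \<Longrightarrow> open (U t) \<and> t \<in> U t \<and> 0 \<le> C t \<and>
     (\<forall>u\<in>U t. \<exists>\<^sub>F \<epsilon> in at_right 0. poisson \<mu> u \<epsilon> \<le> C t)" by metis
  have null: "A \<inter> U t \<in> null_sets \<mu>" if "t \<in> A" for t
  proof -
    have "A \<inter> U t \<in> null_sets lborel" using A(1) U[OF that] by (intro null_set_Int2) auto
    moreover from this have "emeasure \<mu> (A \<inter> U t) = 0"
      using U[OF that] by (intro null_set_of_poisson_bound[OF \<mu>, of "U t" "C t"]) auto
    ultimately show ?thesis using poisson_measureD(1)[OF \<mu>] A(1) U[OF that]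
      by (intro null_setsI) auto
  qed
  obtain F where F: "F \<subseteq> U ` A" "countable F" "\<Union>F = \<Union>(U ` A)"
    using Lindelof[of "U ` A"] U by blast
  have "(\<Union>V\<in>F. A \<inter> V) \<in> null_sets \<mu>" using F(1) null by (intro null_sets_UN' F(2)) auto
  moreover have "(\<Union>V\<in>F. A \<inter> V) = A" using F(3) U by blast
  ultimately show ?thesis by auto
qed

section \<open>Atoms\<close>

lemma integrable_Cauchy_kernel_M_plus_1:
  "\<nu> \<in> M_plus 1 \<Longrightarrow> Im z \<noteq> 0 \<Longrightarrow> integrable \<nu> (\<lambda>s. 1 / (z - complex_of_real s))"
  using M_plus_1D[of \<nu>] by (intro integrable_Cauchy_kernel) auto

text \<open>The integrand becomes \<i> \<epsilon> / (\<alpha> + \<i> \<epsilon> - s), which equals 1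
  at s = \<alpha> and tends to 0 elsewhere. For \<epsilon> \<le> 1 it is dominated by the modulus of
  the Cauchy kernel at \<alpha> + \<i>. The substitution \<epsilon> = 1 / x brings the limit into
  the form of dominated convergence at infinity.\<close>

lemma tendsto_mass_at_point:
  assumes \<nu>: "\<nu> \<in> M_plus 1"
  shows "((\<lambda>\<epsilon>. of_real (pi * \<epsilon>) * Q_trans \<nu> (Complex \<alpha> \<epsilon>)) \<longlongrightarrow> of_real (measure \<nu> {\<alpha>})) (at_right 0)"
  unfolding filterlim_at_right_to_top
proof -
  note [measurable_cong] = M_plus_1D(1)[OF \<nu>]
  have [simp]: "{\<alpha>} \<in> sets \<nu>" "space \<nu> = UNIV" using M_plus_1D(1,2)[OF \<nu>] by auto
  have "((\<lambda>x. LINT s|\<nu>. \<i> * of_real (inverse x) / (Complex \<alpha> (inverse x) - of_real s)) \<longlongrightarrow> (LINT s|\<nu>. complex_of_real (indicator {\<alpha>} s))) at_top"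
  proof (rule integral_dominated_convergence_at_top)
    show "integrable \<nu> (\<lambda>s. norm (1 / (Complex \<alpha> 1 - complex_of_real s)))"
      by (intro integrable_norm integrable_Cauchy_kernel_M_plus_1[OF \<nu>]) simp
    show "\<forall>\<^sub>F x in at_top. AE s in \<nu>. norm (\<i> * of_real (inverse x) / (Complex \<alpha> (inverse x) - of_real s))
        \<le> norm (1 / (Complex \<alpha> 1 - complex_of_real s))"
      using eventually_ge_at_top[of "1::real"]
    proof eventually_elim
      case (elim x)
      define e where "e = inverse x"
      have e: "0 < e" "e \<le> 1" using elim by (auto simp: e_def inverse_le_1_iff)
      have "norm (\<i> * of_real e / (Complex \<alpha> e - of_real s)) \<le> norm (1 / (Complex \<alpha> 1 - complex_of_real s))" for s
      proof (rule power2_le_imp_le)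
        have "e\<^sup>2 \<le> 1" using e by (simp add: power_le_one)
        then have "e\<^sup>2 * (\<alpha> - s)\<^sup>2 \<le> 1 * (\<alpha> - s)\<^sup>2" by (intro mult_right_mono) auto
        moreover have "0 < (\<alpha> - s)\<^sup>2 + e\<^sup>2" "0 < (\<alpha> - s)\<^sup>2 + 1" using e by (auto intro: add_nonneg_pos)
        moreover have "a / (x + a) \<le> 1 / (x + 1)" if "0 < x + a" "0 < x + 1" "a * x \<le> 1 * x" for a x :: real
        proof -
          have "a \<le> (x + a) / (x + 1)" using that by (simp add: pos_le_divide_eq distrib_left)
          then show ?thesis unfolding pos_divide_le_eq[OF that(1)] by simp
        qed
        ultimately have "e\<^sup>2 / ((\<alpha> - s)\<^sup>2 + e\<^sup>2) \<le> 1 / ((\<alpha> - s)\<^sup>2 + 1)"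
          by blast
        then show "(norm (\<i> * of_real e / (Complex \<alpha> e - of_real s)))\<^sup>2 \<le> (norm (1 / (Complex \<alpha> 1 - complex_of_real s)))\<^sup>2"
          by (simp add: norm_divide norm_mult power_divide cmod_power2)
      qed simp
      then show ?case by (auto simp: e_def)
    qed
    show "AE s in \<nu>. ((\<lambda>x. \<i> * of_real (inverse x) / (Complex \<alpha> (inverse x) - of_real s)) \<longlongrightarrow> complex_of_real (indicator {\<alpha>} s)) at_top"
    proof (intro AE_I2)
      fix s
      have i0: "((\<lambda>x. inverse x) \<longlongrightarrow> (0::real)) at_top" by (rule tendsto_inverse_0_at_top[OF filterlim_ident])
      show "((\<lambda>x. \<i> * of_real (inverse x) / (Complex \<alpha> (inverse x) - of_real s)) \<longlongrightarrow> complex_of_real (indicator {\<alpha>} s)) at_top"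
      proof (cases "s = \<alpha>")
        case True
        have "\<forall>\<^sub>F x in at_top. 1 = \<i> * of_real (inverse x) / (Complex \<alpha> (inverse x) - of_real s)"
          using eventually_gt_at_top[of "0::real"]
        proof eventually_elim
          case (elim x)
          have eq: "Complex \<alpha> (inverse x) - of_real s = \<i> * of_real (inverse x)" using True by (simp add: Complex_eq)
          have "\<i> * complex_of_real (inverse x) \<noteq> 0" using elim by simp
          from divide_self[OF this] show ?case by (simp only: eq)
        qed
        from Lim_transform_eventually[OF tendsto_const this] show ?thesis using True by simp
      next
        case False
        have "((\<lambda>x. \<i> * of_real (inverse x) / (Complex \<alpha> (inverse x) - of_real s)) \<longlongrightarrow> \<i> * of_real 0 / (Complex \<alpha> 0 - of_real s)) at_top"
          using False by (intro tendsto_intros i0) (auto simp: complex_eq_iff)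
        then show ?thesis using False by simp
      qed
    qed
  qed measurable
  moreover have "of_real (pi * inverse x) * Q_trans \<nu> (Complex \<alpha> (inverse x)) = (LINT s|\<nu>. \<i> * of_real (inverse x) / (Complex \<alpha> (inverse x) - of_real s))" for x
  proof -
    have "of_real (pi * c) * (\<i> / (of_real pi * w)) = \<i> * of_real c / w" for c and w :: complex by simp
    then show ?thesis unfolding Q_trans_def integral_mult_right_zero[symmetric] by (simp only:)
  qed
  moreover have "(LINT s|\<nu>. complex_of_real (indicator {\<alpha>} s)) = of_real (measure \<nu> {\<alpha>})" by simp
  ultimately show "((\<lambda>x. of_real (pi * inverse x) * Q_trans \<nu> (Complex \<alpha> (inverse x))) \<longlongrightarrow> of_real (measure \<nu> {\<alpha>})) at_top"
    by simp
qed

lemma tendsto_mass_at_point_B_factor: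
  assumes \<nu>: "\<nu> \<in> M_plus 1"
  shows "((\<lambda>\<epsilon>. of_real (pi * \<epsilon>) * B_factor \<nu> a b (Complex \<alpha> \<epsilon>)) \<longlongrightarrow> of_real (measure \<nu> {\<alpha>})) (at_right 0)"
proof -
  have "((\<lambda>\<epsilon>. of_real (pi * \<epsilon>) * Q_trans \<nu> (Complex \<alpha> \<epsilon>) - of_real (pi * \<epsilon>) * (\<i> * of_real a / of_real pi + \<i> * of_real b * Complex \<alpha> \<epsilon> / of_real pi))
     \<longlongrightarrow> of_real (measure \<nu> {\<alpha>}) - of_real (pi * 0) * (\<i> * of_real a / of_real pi + \<i> * of_real b * Complex \<alpha> 0 / of_real pi)) (at_right 0)"
    by (intro tendsto_diff tendsto_mass_at_point[OF \<nu>] tendsto_intros) auto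
  then show ?thesis by (simp add: B_factor_def algebra_simps)
qed

section \<open>The inverse square integral and the weights of the atoms\<close>

abbreviation inv_square_integral :: "real measure \<Rightarrow> real \<Rightarrow> ennreal" where
  "inv_square_integral M \<alpha> \<equiv> (\<integral>\<^sup>+\<tau>. inverse (ennreal ((\<tau> - \<alpha>)\<^sup>2)) \<partial>M)"

text \<open>Up to constants, the Poisson kernel divided by its height is
  \<open>1 / ((\<alpha> - \<tau>)\<^sup>2 + \<epsilon>\<^sup>2)\<close>, which increases as
  \<epsilon> decreases. Monotone convergence in \<open>ennreal\<close> includes the divergent
  case.\<close>

lemma tendsto_inv_square_integral:
  assumes M: "M \<in> M_plus 1"
  shows "(\<lambda>n. ennreal (pi * poisson M \<alpha> (inverse (Suc n)) / inverse (Suc n))) \<longlonglongrightarrow> inv_square_integral M \<alpha>"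
proof -
  note [measurable_cong] = M_plus_1D(1)[OF M]
  define f where "f n \<tau> = ennreal (1 / ((\<alpha> - \<tau>)\<^sup>2 + (inverse (Suc n))\<^sup>2))" for n \<tau>
  have pos: "0 < (\<alpha> - \<tau>)\<^sup>2 + (inverse (Suc n))\<^sup>2" for n \<tau> by (intro add_nonneg_pos) auto
  have "ennreal (pi * poisson M \<alpha> (inverse (Suc n)) / inverse (Suc n)) = (\<integral>\<^sup>+\<tau>. f n \<tau> \<partial>M)" for n
  proof -
    have "ennreal (pi * poisson M \<alpha> (inverse (Suc n)) / inverse (Suc n)) = ennreal (pi / inverse (Suc n)) * ennreal (poisson M \<alpha> (inverse (Suc n)))"
      by (subst ennreal_mult[symmetric]) (auto simp: poisson_nonneg)
    also have "\<dots> = (\<integral>\<^sup>+\<tau>. ennreal (pi / inverse (Suc n)) * ennreal (poisson_kernel \<alpha> (inverse (Suc n)) \<tau>) \<partial>M)"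
      using M_plus_1D(4)[OF M] by (subst nn_integral_cmult) (auto simp: ennreal_poisson)
    also have "\<dots> = (\<integral>\<^sup>+\<tau>. f n \<tau> \<partial>M)"
      unfolding f_def
      by (intro nn_integral_cong, subst ennreal_mult[symmetric]) (auto simp: poisson_kernel_nonneg, simp add: poisson_kernel_def)
    finally show ?thesis .
  qed
  moreover have "(\<lambda>n. \<integral>\<^sup>+\<tau>. f n \<tau> \<partial>M) \<longlonglongrightarrow> (\<integral>\<^sup>+\<tau>. inverse (ennreal ((\<tau> - \<alpha>)\<^sup>2)) \<partial>M)"
  proof (rule nn_integral_LIMSEQ)
    show "incseq f"
    proof (intro incseq_SucI le_funI)
      fix n \<tau>
      have "inverse (real (Suc (Suc n))) \<le> inverse (real (Suc n))" by (simp add: field_simps)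
      then have "(inverse (real (Suc (Suc n))))\<^sup>2 \<le> (inverse (real (Suc n)))\<^sup>2" by (intro power_mono) auto
      then show "f n \<tau> \<le> f (Suc n) \<tau>"
        unfolding f_def by (intro ennreal_leI divide_left_mono add_left_mono mult_pos_pos pos) auto
    qed
    show "f n \<in> borel_measurable M" for n unfolding f_def[abs_def] by measurable
    fix \<tau>
    have "(\<lambda>n. (\<alpha> - \<tau>)\<^sup>2 + (inverse (Suc n))\<^sup>2) \<longlonglongrightarrow> (\<alpha> - \<tau>)\<^sup>2 + 0\<^sup>2"
      by (intro tendsto_intros LIMSEQ_inverse_real_of_nat)
    then have "(\<lambda>n. ennreal ((\<alpha> - \<tau>)\<^sup>2 + (inverse (Suc n))\<^sup>2)) \<longlonglongrightarrow> ennreal ((\<tau> - \<alpha>)\<^sup>2)"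
      by (intro tendsto_ennrealI) (simp add: power2_commute)
    moreover have "isCont (\<lambda>x::ennreal. inverse x) y" for y
      using continuous_on_inverse_ennreal[OF continuous_on_id, of UNIV]
      by (simp add: continuous_on_eq_continuous_at)
    ultimately have "(\<lambda>n. inverse (ennreal ((\<alpha> - \<tau>)\<^sup>2 + (inverse (Suc n))\<^sup>2))) \<longlonglongrightarrow> inverse (ennreal ((\<tau> - \<alpha>)\<^sup>2))"
      by (rule isCont_tendsto_compose[rotated])
    then show "(\<lambda>n. f n \<tau>) \<longlonglongrightarrow> inverse (ennreal ((\<tau> - \<alpha>)\<^sup>2))"
      unfolding f_def using inverse_ennreal[OF pos] by (simp add: inverse_eq_divide)
  qed
  ultimately show ?thesis by simp
qed

lemma filterlim_inverse_Suc_at_right: "filterlim (\<lambda>n. inverse (real (Suc n))) (at_right 0) sequentially"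
  unfolding filterlim_at using LIMSEQ_inverse_real_of_nat by auto

text \<open>Chebyshev's inequality bounds the mass of the interval of radius \<delta> by
  \<open>\<delta>\<^sup>2\<close> times the integral, so its mean density is of order \<delta>. Thus
  \<alpha> lies in each of the sets even before closures are taken.\<close>

lemma zero_set_of_inv_square_integral:
  assumes sets: "sets M = sets borel" and fin: "inv_square_integral M \<alpha> < \<infinity>"
  shows "\<alpha> \<in> zero_set M"
proof -
  note [measurable_cong] = sets
  define I where "I = enn2real (inv_square_integral M \<alpha>)"
  have I: "inv_square_integral M \<alpha> = ennreal I" "0 \<le> I" using fin by (auto simp: I_def)
  have bound: "emeasure M {\<alpha> - \<delta>..\<alpha> + \<delta>} / ennreal (2 * \<delta>) \<le> ennreal (\<delta> * I)" if "0 < \<delta>" for \<delta>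
  proof -
    have "emeasure M {\<alpha> - \<delta>..\<alpha> + \<delta>} = (\<integral>\<^sup>+\<tau>. indicator {\<alpha> - \<delta>..\<alpha> + \<delta>} \<tau> \<partial>M)" using sets by simp
    also have "\<dots> \<le> (\<integral>\<^sup>+\<tau>. ennreal (\<delta>\<^sup>2) * inverse (ennreal ((\<tau> - \<alpha>)\<^sup>2)) \<partial>M)"
    proof (intro nn_integral_mono)
      fix \<tau>
      show "indicator {\<alpha> - \<delta>..\<alpha> + \<delta>} \<tau> \<le> ennreal (\<delta>\<^sup>2) * inverse (ennreal ((\<tau> - \<alpha>)\<^sup>2))"
      proof (cases "\<tau> \<in> {\<alpha> - \<delta>..\<alpha> + \<delta>}")
        case True
        show ?thesis
        proof (cases "\<tau> = \<alpha>")
          case True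
          then show ?thesis using that by (simp add: ennreal_mult_top)
        next
          case False
          have "\<bar>\<tau> - \<alpha>\<bar> \<le> \<bar>\<delta>\<bar>" using True by auto
          then have "(\<tau> - \<alpha>)\<^sup>2 \<le> \<delta>\<^sup>2" by (simp add: abs_le_square_iff)
          moreover have "0 < (\<tau> - \<alpha>)\<^sup>2" using False by simp
          ultimately have "1 \<le> \<delta>\<^sup>2 * inverse ((\<tau> - \<alpha>)\<^sup>2)" by (simp add: field_simps)
          then have "1 \<le> ennreal (\<delta>\<^sup>2 * inverse ((\<tau> - \<alpha>)\<^sup>2))" by (simp flip: ennreal_1 add: ennreal_leI)
          then show ?thesis using True False by (simp add: inverse_ennreal ennreal_mult)
        qed
      qed simp
    qed
    also have "\<dots> = ennreal (\<delta>\<^sup>2) * ennreal I"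
      unfolding I(1)[symmetric] by (intro nn_integral_cmult) measurable
    also have "\<dots> = ennreal (\<delta>\<^sup>2 * I)" using I(2) by (intro ennreal_mult[symmetric]) auto
    finally have "emeasure M {\<alpha> - \<delta>..\<alpha> + \<delta>} / ennreal (2 * \<delta>) \<le> ennreal (\<delta>\<^sup>2 * I) / ennreal (2 * \<delta>)"
      by (rule divide_right_mono_ennreal)
    also have "\<dots> = ennreal (\<delta>\<^sup>2 * I / (2 * \<delta>))" using that I(2) by (intro divide_ennreal) auto
    also have "\<dots> \<le> ennreal (\<delta> * I)" using that I(2) by (intro ennreal_leI) (simp add: power2_eq_square field_simps)
    finally show ?thesis .
  qed
  have "Limsup (at_right 0) (\<lambda>\<delta>. emeasure M {\<alpha> - \<delta>..\<alpha> + \<delta>} / ennreal (2 * \<delta>)) < ennreal e" if "0 < e" for e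
  proof -
    have "((\<lambda>\<delta>. \<delta> * I) \<longlongrightarrow> 0 * I) (at_right 0)" by (intro tendsto_intros)
    then have "\<forall>\<^sub>F \<delta> in at_right 0. \<delta> * I < e / 2" by (rule order_tendstoD) (use that in simp)
    with eventually_at_right_less[of "0::real"]
    have "\<forall>\<^sub>F \<delta> in at_right 0. emeasure M {\<alpha> - \<delta>..\<alpha> + \<delta>} / ennreal (2 * \<delta>) \<le> ennreal (e/2)"
    proof eventually_elim
      case (elim \<delta>)
      then show ?case using bound[of \<delta>] by (meson ennreal_leI less_imp_le order_trans)
    qed
    then have "Limsup (at_right 0) (\<lambda>\<delta>. emeasure M {\<alpha> - \<delta>..\<alpha> + \<delta>} / ennreal (2 * \<delta>)) \<le> ennreal (e/2)"
      by (rule Limsup_bounded)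
    also have "\<dots> < ennreal e" using that by (intro ennreal_lessI) auto
    finally show ?thesis .
  qed
  then show ?thesis unfolding zero_set_def using closure_subset by fastforce
qed

text \<open>At an atom the factor of \<mu> blows up like mass / (pi \<epsilon>), so the factor of M
  vanishes to exactly first order.\<close>

lemma B_factor_over_at_atom:
  assumes B: "is_B M c0 c1 \<mu> \<zeta>0 \<zeta>1" and \<beta>: "measure \<mu> {\<alpha>} > 0"
  shows "((\<lambda>\<epsilon>. B_factor M c0 c1 (Complex \<alpha> \<epsilon>) / of_real \<epsilon>) \<longlongrightarrow> of_real (pi / measure \<mu> {\<alpha>})) (at_right 0)"
proof -
  have \<mu>: "\<mu> \<in> M_plus 1" and eq: "\<And>z. 0 < Im z \<Longrightarrow> B_factor M c0 c1 z * B_factor \<mu> \<zeta>0 \<zeta>1 z = 1"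
    using B by (auto simp: is_B_iff)
  have "((\<lambda>\<epsilon>. of_real pi / (of_real (pi * \<epsilon>) * B_factor \<mu> \<zeta>0 \<zeta>1 (Complex \<alpha> \<epsilon>))) \<longlongrightarrow> of_real pi / of_real (measure \<mu> {\<alpha>})) (at_right 0)"
    using \<beta> by (intro tendsto_intros tendsto_mass_at_point_B_factor \<mu>) auto
  moreover have "\<forall>\<^sub>F \<epsilon> in at_right 0. of_real pi / (of_real (pi * \<epsilon>) * B_factor \<mu> \<zeta>0 \<zeta>1 (Complex \<alpha> \<epsilon>)) = B_factor M c0 c1 (Complex \<alpha> \<epsilon>) / of_real \<epsilon>"
  proof (rule eventually_at_right_0I)
    fix \<epsilon> :: real assume "0 < \<epsilon>"
    then have e: "B_factor M c0 c1 (Complex \<alpha> \<epsilon>) * B_factor \<mu> \<zeta>0 \<zeta>1 (Complex \<alpha> \<epsilon>) = 1" by (intro eq) simp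
    then have "B_factor \<mu> \<zeta>0 \<zeta>1 (Complex \<alpha> \<epsilon>) \<noteq> 0" by auto
    then have "B_factor M c0 c1 (Complex \<alpha> \<epsilon>) = 1 / B_factor \<mu> \<zeta>0 \<zeta>1 (Complex \<alpha> \<epsilon>)"
      using e by (simp add: eq_divide_eq)
    then show "of_real pi / (of_real (pi * \<epsilon>) * B_factor \<mu> \<zeta>0 \<zeta>1 (Complex \<alpha> \<epsilon>)) = B_factor M c0 c1 (Complex \<alpha> \<epsilon>) / of_real \<epsilon>"
      by simp
  qed
  ultimately show ?thesis unfolding of_real_divide by (rule Lim_transform_eventually)
qed

text \<open>Write \<beta> for the mass at \<alpha>. First-order vanishing of the factor of M forces
  its imaginary part to tend to 0, so \<alpha> is a Hilbert zero. The real part divided by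
  \<epsilon> tends to pi / \<beta>; by monotone convergence the inverse square integral is
  \<open>pi\<^sup>2 / \<beta> - c1\<close>. Its finiteness puts \<alpha> in the zero set, and
  solving for \<beta> gives the weight.\<close>

lemma atom_in_Z_atoms:
  assumes M: "M \<in> M_plus 1" and B: "is_B M c0 c1 \<mu> \<zeta>0 \<zeta>1" and \<beta>: "measure \<mu> {\<alpha>} > 0"
  shows "inv_square_integral M \<alpha> < \<infinity>" "\<alpha> \<in> Z_atoms M c0 c1" "mu_weight M c1 \<alpha> = measure \<mu> {\<alpha>}"
proof -
  define \<beta> where "\<beta> = measure \<mu> {\<alpha>}"
  have "0 < \<beta>" using \<open>measure \<mu> {\<alpha>} > 0\<close> by (simp add: \<beta>_def)
  have lim: "((\<lambda>\<epsilon>. B_factor M c0 c1 (Complex \<alpha> \<epsilon>) / of_real \<epsilon>) \<longlongrightarrow> of_real (pi / \<beta>)) (at_right 0)"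
    unfolding \<beta>_def by (rule B_factor_over_at_atom[OF B \<open>measure \<mu> {\<alpha>} > 0\<close>])
  have "((\<lambda>\<epsilon>. of_real \<epsilon> * (B_factor M c0 c1 (Complex \<alpha> \<epsilon>) / of_real \<epsilon>)) \<longlongrightarrow> of_real 0 * of_real (pi / \<beta>)) (at_right 0)"
    by (intro tendsto_intros lim)
  moreover have "\<forall>\<^sub>F \<epsilon> in at_right 0. of_real \<epsilon> * (B_factor M c0 c1 (Complex \<alpha> \<epsilon>) / of_real \<epsilon>) = B_factor M c0 c1 (Complex \<alpha> \<epsilon>)"
    by (rule eventually_at_right_0I) simp
  ultimately have "((\<lambda>\<epsilon>. B_factor M c0 c1 (Complex \<alpha> \<epsilon>)) \<longlongrightarrow> of_real 0 * of_real (pi / \<beta>)) (at_right 0)"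
    by (rule Lim_transform_eventually)
  then have "((\<lambda>\<epsilon>. Im (B_factor M c0 c1 (Complex \<alpha> \<epsilon>)) + (c1 * \<alpha> + c0) / pi) \<longlongrightarrow> Im (of_real 0 * of_real (pi / \<beta>)) + (c1 * \<alpha> + c0) / pi) (at_right 0)"
    by (intro tendsto_intros)
  then have hh: "has_hilbert M \<alpha> ((c1 * \<alpha> + c0) / pi)" by (simp add: has_hilbert_def Im_B_factor)
  have "(\<lambda>n. Re (B_factor M c0 c1 (Complex \<alpha> (inverse (Suc n))) / of_real (inverse (Suc n)))) \<longlonglongrightarrow> Re (of_real (pi / \<beta>))"
    by (intro tendsto_Re filterlim_compose[OF lim filterlim_inverse_Suc_at_right])
  moreover have "Re (B_factor M c0 c1 (Complex \<alpha> (inverse (Suc n))) / of_real (inverse (Suc n)))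
      = poisson M \<alpha> (inverse (Suc n)) / inverse (Suc n) + c1 / pi" for n
  proof -
    have e: "0 < inverse (real (Suc n))" by simp
    have "Re (B_factor M c0 c1 (Complex \<alpha> (inverse (Suc n))) / of_real (inverse (Suc n))) =
      (poisson M \<alpha> (inverse (Suc n)) + c1 * inverse (Suc n) / pi) / inverse (Suc n)"
      unfolding Re_divide_of_real Re_B_factor[OF M e] ..
    also have "\<dots> = poisson M \<alpha> (inverse (Suc n)) / inverse (Suc n) + c1 / pi"
      using e by (simp add: add_divide_distrib del: of_nat_Suc)
    finally show ?thesis .
  qed
  ultimately have "(\<lambda>n. poisson M \<alpha> (inverse (Suc n)) / inverse (Suc n) + c1 / pi) \<longlonglongrightarrow> pi / \<beta>" by simp
  then have "(\<lambda>n. pi * ((poisson M \<alpha> (inverse (Suc n)) / inverse (Suc n) + c1 / pi) - c1 / pi)) \<longlonglongrightarrow> pi * (pi / \<beta> - c1 / pi)"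
    by (intro tendsto_intros)
  moreover have "pi * (pi / \<beta> - c1 / pi) = pi\<^sup>2 / \<beta> - c1" by (simp add: right_diff_distrib power2_eq_square)
  ultimately have lim2: "(\<lambda>n. pi * poisson M \<alpha> (inverse (Suc n)) / inverse (Suc n)) \<longlonglongrightarrow> pi\<^sup>2 / \<beta> - c1"
    by simp
  then have "0 \<le> pi\<^sup>2 / \<beta> - c1"
    by (rule LIMSEQ_le_const) (auto simp: poisson_nonneg intro!: exI[of _ 0])
  have "(\<lambda>n. ennreal (pi * poisson M \<alpha> (inverse (Suc n)) / inverse (Suc n))) \<longlonglongrightarrow> ennreal (pi\<^sup>2 / \<beta> - c1)"
    using lim2 by (rule tendsto_ennrealI)
  then have I: "inv_square_integral M \<alpha> = ennreal (pi\<^sup>2 / \<beta> - c1)"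
    using tendsto_inv_square_integral[OF M, of \<alpha>] LIMSEQ_unique by blast
  then show fin: "inv_square_integral M \<alpha> < \<infinity>" by simp
  have "\<alpha> \<in> zero_set M" using M_plus_1D(1)[OF M] fin by (rule zero_set_of_inv_square_integral)
  then show "\<alpha> \<in> Z_atoms M c0 c1"
    using hh hilbert_eqI[OF hh] by (auto simp: Z_atoms_def hilbert_zeros_def)
  show "mu_weight M c1 \<alpha> = measure \<mu> {\<alpha>}"
    unfolding mu_weight_def Let_def I using \<open>0 \<le> pi\<^sup>2 / \<beta> - c1\<close> \<open>0 < \<beta>\<close> by (simp add: \<beta>_def)
qed

lemma finite_measure_M_plus_0:
  assumes "M \<in> M_plus 0"
  shows "finite_measure M"
proof (intro finite_measureI)
  have "(1 + s\<^sup>2) powr (- 0 / 2) = 1" for s :: real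
    using add_pos_nonneg[of 1 "s\<^sup>2"] by simp
  then have "(\<integral>\<^sup>+s. ennreal ((1 + s\<^sup>2) powr (- 0 / 2)) \<partial>M) = emeasure M (space M)" by simp
  then show "emeasure M (space M) \<noteq> \<infinity>" using assms by (auto simp: M_plus_def)
qed

text \<open>The factor of M divided by \<epsilon> tends to (I + c1) / pi, where I is the inverse
  square integral. The real part is monotone convergence. The imaginary part is a difference
  quotient of conjugate Poisson integrals, because the value J at height 0 cancels against
  \<open>(c1 * \<alpha> + c0) / pi\<close> at a Hilbert zero. The limit is finite and positive, so
  the reciprocal detects a positive mass.\<close>

lemma atom_of_Z_atoms:
  assumes M: "M \<in> M_plus 0" and "0 \<le> c1" and B: "is_B M c0 c1 \<mu> \<zeta>0 \<zeta>1"
    and \<alpha>: "\<alpha> \<in> Z_atoms M c0 c1" and fin: "inv_square_integral M \<alpha> < \<infinity>"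
  shows "measure \<mu> {\<alpha>} > 0"
proof -
  have M1: "M \<in> M_plus 1" using M by (rule M_plus_mono) simp
  have \<mu>: "\<mu> \<in> M_plus 1" and eq: "\<And>z. 0 < Im z \<Longrightarrow> B_factor M c0 c1 z * B_factor \<mu> \<zeta>0 \<zeta>1 z = 1"
    using B by (auto simp: is_B_iff)
  note [measurable_cong] = M_plus_1D(1)[OF M1]
  interpret finite_measure M using M by (rule finite_measure_M_plus_0)
  define e where "e n = inverse (real (Suc n))" for n
  have e: "0 < e n" for n by (simp add: e_def)
  have elim0: "e \<longlonglongrightarrow> 0" unfolding e_def[abs_def] by (rule LIMSEQ_inverse_real_of_nat)
  define I where "I = enn2real (inv_square_integral M \<alpha>)"
  have I: "inv_square_integral M \<alpha> = ennreal I" "0 \<le> I" using fin by (auto simp: I_def)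
  have AE: "AE s in M. s \<noteq> \<alpha>"
  proof -
    have "AE \<tau> in M. inverse (ennreal ((\<tau> - \<alpha>)\<^sup>2)) \<noteq> \<infinity>"
      using fin by (intro nn_integral_PInf_AE) auto
    then show ?thesis by eventually_elim auto
  qed
  have int: "integrable M (\<lambda>s. 1 / (\<alpha> - s)\<^sup>2)"
  proof (rule integrableI_bounded)
    have "(\<integral>\<^sup>+s. ennreal (norm (1 / (\<alpha> - s)\<^sup>2)) \<partial>M) = inv_square_integral M \<alpha>"
    proof (rule nn_integral_cong_AE)
      show "AE s in M. ennreal (norm (1 / (\<alpha> - s)\<^sup>2)) = inverse (ennreal ((s - \<alpha>)\<^sup>2))"
        using AE by eventually_elim (simp add: inverse_ennreal power2_commute inverse_eq_divide)
    qed
    then show "(\<integral>\<^sup>+s. ennreal (norm (1 / (\<alpha> - s)\<^sup>2)) \<partial>M) < \<infinity>" using fin by simp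
  qed measurable
  define k where "k \<epsilon> s = (\<alpha> - s) / (pi * ((\<alpha> - s)\<^sup>2 + \<epsilon>\<^sup>2))" for \<epsilon> s
  have int_k: "integrable M (k \<epsilon>)" for \<epsilon>
  proof (rule Bochner_Integration.integrable_bound)
    show "integrable M (\<lambda>s. 1 + 1 / (\<alpha> - s)\<^sup>2)" using int by simp
    show "AE s in M. norm (k \<epsilon> s) \<le> norm (1 + 1 / (\<alpha> - s)\<^sup>2)"
      using AE
    proof eventually_elim
      case (elim s)
      define x where "x = \<bar>\<alpha> - s\<bar>"
      have x: "0 < x" using elim by (simp add: x_def)
      have "norm (k \<epsilon> s) = x / (pi * (x\<^sup>2 + \<epsilon>\<^sup>2))"
        unfolding k_def x_def by (simp add: abs_mult)
      also have "\<dots> \<le> x / (1 * x\<^sup>2)"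
        using x pi_gt3 by (intro divide_left_mono mult_mono mult_pos_pos) (auto intro: add_pos_nonneg)
      also have "\<dots> = 1 / x" using x by (simp add: power2_eq_square)
      also have "\<dots> \<le> 1 + (1 / x)\<^sup>2"
      proof -
        have "y \<le> 1 + y\<^sup>2" if "0 \<le> y" for y :: real
          using zero_le_power2[of "y - 1"] that by (simp add: power2_eq_square algebra_simps)
        then show ?thesis using x by simp
      qed
      finally show ?case by (simp add: x_def power_divide)
    qed
    show "k \<epsilon> \<in> borel_measurable M" unfolding k_def[abs_def] by measurable
  qed
  have ImQ: "Im (Q_trans M (Complex \<alpha> (e n))) = (LINT s|M. k (e n) s)" for n
    using Q_trans_Complex(2)[OF M1 e] by (simp add: k_def)
  define J where "J = (LINT s|M. k 0 s)"
  \<comment> \<open>The difference quotient has modulus \<epsilon> / (pi x (x^2 + \<epsilon>^2))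
    with x = |\<alpha> - s|. It tends to 0 for x > 0, and \<epsilon> x \<le> x^2 + \<epsilon>^2
    gives the majorant 1 / x^2, which is integrable by assumption.\<close>
  have "(\<lambda>n. LINT s|M. (k (e n) s - k 0 s) / e n) \<longlonglongrightarrow> (LINT s|M. 0)"
  proof (rule integral_dominated_convergence)
    show "integrable M (\<lambda>s. 1 / (\<alpha> - s)\<^sup>2)" by fact
    have diff: "(k \<epsilon> s - k 0 s) / \<epsilon> = - \<epsilon> / (pi * ((\<alpha> - s) * ((\<alpha> - s)\<^sup>2 + \<epsilon>\<^sup>2)))" if "s \<noteq> \<alpha>" "0 < \<epsilon>" for s \<epsilon>
    proof -
      define x where "x = \<alpha> - s"
      have "x \<noteq> 0" "x\<^sup>2 + \<epsilon>\<^sup>2 \<noteq> 0" using that by (auto simp: x_def)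
      define D where "D = x\<^sup>2 + \<epsilon>\<^sup>2"
      have "x / D - x / x\<^sup>2 = x / D - 1 / x" using \<open>x \<noteq> 0\<close> by (simp add: power2_eq_square)
      also have "\<dots> = (x * x - 1 * D) / (D * x)"
        using \<open>x \<noteq> 0\<close> \<open>x\<^sup>2 + \<epsilon>\<^sup>2 \<noteq> 0\<close> by (intro diff_frac_eq) (auto simp: D_def)
      also have "\<dots> = - (\<epsilon> * \<epsilon>) / (x * D)" by (simp add: D_def power2_eq_square mult.commute)
      finally have "(x / D - x / x\<^sup>2) / \<epsilon> / pi = - \<epsilon> / (x * D) / pi" using that by simp
      moreover have "(x / (pi * D) - x / (pi * x\<^sup>2)) / \<epsilon> = (x / D - x / x\<^sup>2) / \<epsilon> / pi"
        by (simp add: diff_divide_distrib mult_ac)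
      ultimately show ?thesis by (simp add: k_def x_def D_def mult.commute)
    qed
    show "AE s in M. (\<lambda>n. (k (e n) s - k 0 s) / e n) \<longlonglongrightarrow> 0"
      using AE
    proof eventually_elim
      case (elim s)
      have "(\<lambda>n. - e n / (pi * ((\<alpha> - s) * ((\<alpha> - s)\<^sup>2 + (e n)\<^sup>2)))) \<longlonglongrightarrow> - 0 / (pi * ((\<alpha> - s) * ((\<alpha> - s)\<^sup>2 + 0\<^sup>2)))"
        using elim by (intro tendsto_intros elim0) auto
      then show ?case using elim e by (simp add: diff)
    qed
    show "AE s in M. norm ((k (e n) s - k 0 s) / e n) \<le> 1 / (\<alpha> - s)\<^sup>2" for n
      using AE
    proof eventually_elim
      case (elim s)
      define x where "x = \<bar>\<alpha> - s\<bar>"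
      have x: "0 < x" using elim by (simp add: x_def)
      have x2: "x * x + e n * e n > 0" using x by (simp add: add_pos_nonneg)
      have "norm ((k (e n) s - k 0 s) / e n) = e n / (pi * (x * (x\<^sup>2 + (e n)\<^sup>2)))"
        unfolding diff[OF elim e] x_def using e[of n] by (simp add: abs_mult)
      also have "\<dots> \<le> e n / (1 * (x * (e n * x)))"
      proof (intro divide_left_mono mult_mono mult_pos_pos)
        have "0 \<le> (x - e n)\<^sup>2" by simp
        moreover have "0 \<le> e n * x" using x e[of n] by simp
        ultimately show "e n * x \<le> x\<^sup>2 + (e n)\<^sup>2" by (simp add: power2_eq_square algebra_simps)
      qed (use x e[of n] pi_gt3 in \<open>auto intro: add_pos_nonneg\<close>)
      also have "\<dots> = 1 / x\<^sup>2" using x e[of n] by (simp add: power2_eq_square)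
      finally show ?case by (simp add: x_def)
    qed
  qed (auto simp: k_def[abs_def])
  moreover have "(LINT s|M. (k (e n) s - k 0 s) / e n) = (Im (Q_trans M (Complex \<alpha> (e n))) - J) / e n" for n
    unfolding ImQ J_def using int_k by simp
  ultimately have L: "(\<lambda>n. (Im (Q_trans M (Complex \<alpha> (e n))) - J) / e n) \<longlonglongrightarrow> 0"
    by (simp only: Bochner_Integration.integral_zero)
  have "(\<lambda>n. e n * ((Im (Q_trans M (Complex \<alpha> (e n))) - J) / e n) + J) \<longlonglongrightarrow> 0 * 0 + J"
    by (intro tendsto_intros L elim0)
  then have LJ: "(\<lambda>n. Im (Q_trans M (Complex \<alpha> (e n)))) \<longlonglongrightarrow> J" using e by (simp add: less_imp_neq[OF e, symmetric])
  obtain h where h: "has_hilbert M \<alpha> h" and h0: "hilbert M \<alpha> - (c1 * \<alpha> + c0) / pi = 0"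
    using \<alpha> by (auto simp: Z_atoms_def hilbert_zeros_def)
  have "(\<lambda>n. Im (Q_trans M (Complex \<alpha> (e n)))) \<longlonglongrightarrow> h"
    using filterlim_compose[OF h[unfolded has_hilbert_def] filterlim_inverse_Suc_at_right] by (simp add: e_def)
  then have J: "J = (c1 * \<alpha> + c0) / pi" using LJ h0 hilbert_eqI[OF h] LIMSEQ_unique by fastforce
  have ImL: "(\<lambda>n. Im (B_factor M c0 c1 (Complex \<alpha> (e n)) / of_real (e n))) \<longlonglongrightarrow> 0"
    using L by (simp add: Im_B_factor J)
  have nn: "0 \<le> pi * poisson M \<alpha> (e n) / e n" for n
    using e[of n] by (intro divide_nonneg_nonneg mult_nonneg_nonneg poisson_nonneg) auto
  have "(\<lambda>n. ennreal (pi * poisson M \<alpha> (e n) / e n)) \<longlonglongrightarrow> ennreal I"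
    using tendsto_inv_square_integral[OF M1, of \<alpha>] I(1) by (simp add: e_def)
  then have "(\<lambda>n. pi * poisson M \<alpha> (e n) / e n) \<longlonglongrightarrow> I"
    using I(2) nn by (subst (asm) tendsto_ennreal_iff) auto
  then have "(\<lambda>n. pi * poisson M \<alpha> (e n) / e n / pi + c1 / pi) \<longlonglongrightarrow> I / pi + c1 / pi" by (intro tendsto_intros) auto
  moreover have "Re (B_factor M c0 c1 (Complex \<alpha> (e n)) / of_real (e n)) = pi * poisson M \<alpha> (e n) / e n / pi + c1 / pi" for n
    using e[of n] by (simp add: Re_B_factor[OF M1 e] add_divide_distrib)
  ultimately have ReL: "(\<lambda>n. Re (B_factor M c0 c1 (Complex \<alpha> (e n)) / of_real (e n))) \<longlonglongrightarrow> I / pi + c1 / pi" by simp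
  have FL: "(\<lambda>n. B_factor M c0 c1 (Complex \<alpha> (e n)) / of_real (e n)) \<longlonglongrightarrow> Complex (I / pi + c1 / pi) 0"
    using tendsto_Complex[OF ReL ImL] by (simp only: complex_surj)
  have "0 < I"
  proof (rule ccontr)
    assume "\<not> 0 < I"
    then have "I = 0" using I(2) by simp
    then have "inv_square_integral M \<alpha> = 0" using I(1) by simp
    then have "AE \<tau> in M. inverse (ennreal ((\<tau> - \<alpha>)\<^sup>2)) = 0"
      by (subst (asm) nn_integral_0_iff_AE) auto
    then have "AE \<tau> in M. False" by eventually_elim simp
    then have "emeasure M UNIV = 0"
      using AE_iff_measurable[of UNIV M "\<lambda>_. False"] M_plus_1D(1,2)[OF M1] by simp
    then show False using M by (simp add: M_plus_def)
  qed
  then have r: "0 < I / pi + c1 / pi" using \<open>0 \<le> c1\<close> by (simp add: add_pos_nonneg)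
  have "(\<lambda>n. of_real pi / (B_factor M c0 c1 (Complex \<alpha> (e n)) / of_real (e n))) \<longlonglongrightarrow> of_real pi / Complex (I / pi + c1 / pi) 0"
    using r by (intro tendsto_intros FL) (simp add: complex_eq_iff)
  moreover have "of_real pi / (B_factor M c0 c1 (Complex \<alpha> (e n)) / of_real (e n)) = of_real (pi * e n) * B_factor \<mu> \<zeta>0 \<zeta>1 (Complex \<alpha> (e n))" for n
  proof -
    have E: "B_factor M c0 c1 (Complex \<alpha> (e n)) * B_factor \<mu> \<zeta>0 \<zeta>1 (Complex \<alpha> (e n)) = 1" using e by (intro eq) simp
    then have "B_factor M c0 c1 (Complex \<alpha> (e n)) \<noteq> 0" by auto
    then have "B_factor \<mu> \<zeta>0 \<zeta>1 (Complex \<alpha> (e n)) = 1 / B_factor M c0 c1 (Complex \<alpha> (e n))"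
      using E by (simp add: eq_divide_eq mult.commute)
    then show ?thesis by simp
  qed
  moreover have "(\<lambda>n. of_real (pi * e n) * B_factor \<mu> \<zeta>0 \<zeta>1 (Complex \<alpha> (e n))) \<longlonglongrightarrow> of_real (measure \<mu> {\<alpha>})"
    using filterlim_compose[OF tendsto_mass_at_point_B_factor[OF \<mu>] filterlim_inverse_Suc_at_right] by (simp add: e_def)
  ultimately have "of_real (measure \<mu> {\<alpha>}) = of_real pi / Complex (I / pi + c1 / pi) 0"
    using LIMSEQ_unique by simp
  also have "\<dots> = of_real pi / of_real (I / pi + c1 / pi)" by (simp only: complex_of_real_def)
  also have "\<dots> = of_real (pi / (I / pi + c1 / pi))" by (simp only: of_real_divide)
  finally have "measure \<mu> {\<alpha>} = pi / (I / pi + c1 / pi)" by (simp only: of_real_eq_iff)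
  then show ?thesis using r by simp
qed

text \<open>At a point of \<open>Z_atoms\<close> without mass the inverse square integral has to
  diverge by \<open>atom_of_Z_atoms\<close>, and there the weight is 0 by convention.\<close>

lemma measure_atom_eq:
  assumes M: "M \<in> M_plus 0" and "0 \<le> c1" and B: "is_B M c0 c1 \<mu> \<zeta>0 \<zeta>1"
  shows "measure \<mu> {\<alpha>} = (if \<alpha> \<in> Z_atoms M c0 c1 then mu_weight M c1 \<alpha> else 0)"
proof (cases "measure \<mu> {\<alpha>} = 0")
  case False
  then have "0 < measure \<mu> {\<alpha>}" by (simp add: zero_less_measure_iff)
  then show ?thesis using atom_in_Z_atoms[OF M_plus_mono[OF M] B] by simp
next
  case True
  have "inv_square_integral M \<alpha> = \<infinity>" if "\<alpha> \<in> Z_atoms M c0 c1"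
  proof (rule ccontr)
    assume "inv_square_integral M \<alpha> \<noteq> \<infinity>"
    then show False
      using atom_of_Z_atoms[OF M \<open>0 \<le> c1\<close> B that] True by (simp add: less_top)
  qed
  then show ?thesis using True by (simp add: mu_weight_def Let_def)
qed

section \<open>Asymptotics on the imaginary axis\<close>

lemma norm_inverse_Complex_0_le:
  assumes "1 \<le> y"
  shows "norm (1 / (Complex 0 y - of_real s)) \<le> norm (1 / (Complex 0 1 - of_real s))"
proof (rule power2_le_imp_le)
  have "1 \<le> y\<^sup>2" using assms by (simp add: one_le_power)
  then have "1 / (s\<^sup>2 + y\<^sup>2) \<le> 1 / (s\<^sup>2 + 1)"
  proof (intro divide_left_mono mult_pos_pos add_left_mono)
    show "0 < s\<^sup>2 + y\<^sup>2" "0 < s\<^sup>2 + 1" using \<open>1 \<le> y\<^sup>2\<close> zero_le_power2[of s] by linarith+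
  qed auto
  then show "(norm (1 / (Complex 0 y - of_real s)))\<^sup>2 \<le> (norm (1 / (Complex 0 1 - complex_of_real s)))\<^sup>2"
    by (simp add: norm_divide power_divide cmod_power2)
qed simp

lemma tendsto_inverse_Complex_0: "((\<lambda>y. 1 / (Complex 0 y - of_real s)) \<longlongrightarrow> 0) at_top"
proof (rule tendsto_norm_zero_cancel, rule tendsto_sandwich)
  show "\<forall>\<^sub>F y in at_top. 0 \<le> norm (1 / (Complex 0 y - of_real s))" by simp
  show "\<forall>\<^sub>F y in at_top. norm (1 / (Complex 0 y - of_real s)) \<le> 1 / y"
    using eventually_gt_at_top[of "0::real"]
  proof eventually_elim
    case (elim y)
    have "\<bar>y\<bar> \<le> norm (Complex 0 y - of_real s)" using abs_Im_le_cmod[of "Complex 0 y - of_real s"] by simp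
    then show ?case using elim by (simp add: norm_divide frac_le)
  qed
  show "((\<lambda>y. 1 / y) \<longlongrightarrow> (0::real)) at_top" by real_asymp
qed simp

lemma tendsto_Q_trans_at_top:
  assumes \<nu>: "\<nu> \<in> M_plus 1"
  shows "((\<lambda>y. Q_trans \<nu> (Complex 0 y)) \<longlongrightarrow> 0) at_top"
proof -
  note [measurable_cong] = M_plus_1D(1)[OF \<nu>]
  have "((\<lambda>y. LINT s|\<nu>. 1 / (Complex 0 y - of_real s)) \<longlongrightarrow> (LINT s|\<nu>. 0)) at_top"
  proof (rule integral_dominated_convergence_at_top)
    show "integrable \<nu> (\<lambda>s. norm (1 / (Complex 0 1 - complex_of_real s)))"
      by (intro integrable_norm integrable_Cauchy_kernel_M_plus_1[OF \<nu>]) simp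
    show "\<forall>\<^sub>F y in at_top. AE s in \<nu>. norm (1 / (Complex 0 y - complex_of_real s)) \<le> norm (1 / (Complex 0 1 - complex_of_real s))"
      using eventually_ge_at_top[of "1::real"] by eventually_elim (auto intro: norm_inverse_Complex_0_le)
    show "AE s in \<nu>. ((\<lambda>y. 1 / (Complex 0 y - complex_of_real s)) \<longlongrightarrow> 0) at_top"
      by (intro AE_I2 tendsto_inverse_Complex_0)
  qed measurable
  then have "((\<lambda>y. \<i> / of_real pi * (LINT s|\<nu>. 1 / (Complex 0 y - of_real s))) \<longlongrightarrow> \<i> / of_real pi * 0) at_top"
    by (intro tendsto_mult) auto
  then show ?thesis by (simp add: Q_trans_eq)
qed

lemma norm_y_over_le_1: "0 < y \<Longrightarrow> norm (of_real y / (Complex 0 y - of_real s)) \<le> 1"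
  using abs_Im_le_cmod[of "Complex 0 y - of_real s"] by (simp add: norm_divide divide_le_eq_1)

lemma tendsto_y_over: "((\<lambda>y. \<i> * of_real y / (Complex 0 y - of_real s)) \<longlongrightarrow> 1) at_top"
proof -
  have "((\<lambda>y. 1 + of_real s * (1 / (Complex 0 y - of_real s))) \<longlongrightarrow> 1 + of_real s * 0) at_top"
    by (intro tendsto_intros tendsto_inverse_Complex_0)
  moreover have "\<forall>\<^sub>F y in at_top. 1 + of_real s * (1 / (Complex 0 y - of_real s)) = \<i> * of_real y / (Complex 0 y - of_real s)"
    using eventually_gt_at_top[of "0::real"]
  proof eventually_elim
    case (elim y)
    define w where "w = Complex 0 y - of_real s"
    have "w \<noteq> 0" using elim by (auto simp: w_def complex_eq_iff)
    moreover have "\<i> * of_real y = w + of_real s" by (simp add: w_def complex_eq_iff)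
    ultimately show ?case unfolding w_def[symmetric] by (simp add: add_divide_distrib)
  qed
  ultimately have "((\<lambda>y. \<i> * of_real y / (Complex 0 y - of_real s)) \<longlongrightarrow> 1 + of_real s * 0) at_top"
    by (rule Lim_transform_eventually)
  then show ?thesis by simp
qed

lemma tendsto_y_Q_trans:
  assumes M: "M \<in> M_plus 0"
  shows "((\<lambda>y. of_real y * Q_trans M (Complex 0 y)) \<longlongrightarrow> of_real (measure M UNIV / pi)) at_top"
proof -
  have M1: "M \<in> M_plus 1" using M by (rule M_plus_mono) simp
  note [measurable_cong] = M_plus_1D(1)[OF M1]
  interpret finite_measure M using M by (rule finite_measure_M_plus_0)
  have "((\<lambda>y. LINT s|M. \<i> * of_real y / (Complex 0 y - of_real s)) \<longlongrightarrow> (LINT s|M. 1)) at_top"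
  proof (rule integral_dominated_convergence_at_top)
    show "integrable M (\<lambda>s. 1::real)" by simp
    show "\<forall>\<^sub>F y in at_top. AE s in M. norm (\<i> * of_real y / (Complex 0 y - complex_of_real s)) \<le> 1"
      using eventually_gt_at_top[of "0::real"]
      by eventually_elim (use norm_y_over_le_1 in \<open>auto simp: norm_divide norm_mult\<close>)
    show "AE s in M. ((\<lambda>y. \<i> * of_real y / (Complex 0 y - complex_of_real s)) \<longlongrightarrow> 1) at_top"
      by (intro AE_I2 tendsto_y_over)
  qed measurable
  then have "((\<lambda>y. 1 / of_real pi * (LINT s|M. \<i> * of_real y / (Complex 0 y - of_real s))) \<longlongrightarrow> 1 / of_real pi * of_real (measure M UNIV)) at_top"
    using M_plus_1D(2)[OF M1] by (intro tendsto_mult) (auto simp: of_real_def)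
  moreover have "1 / of_real pi * (LINT s|M. \<i> * of_real y / (Complex 0 y - of_real s)) = of_real y * Q_trans M (Complex 0 y)" for y
  proof -
    have "1 / of_real pi * (\<i> * c / w) = c * (\<i> / (of_real pi * w))" for c w :: complex by simp
    then show ?thesis unfolding Q_trans_def integral_mult_right_zero[symmetric] by (simp only:)
  qed
  ultimately show ?thesis by simp
qed

lemma M_plus_minus_1D:
  assumes M: "M \<in> M_plus (-1)"
  shows "M \<in> M_plus 0" "M \<in> M_plus 1" "integrable M (\<lambda>s. s)" "integrable M (\<lambda>s. \<bar>s\<bar>)"
proof -
  show "M \<in> M_plus 0" "M \<in> M_plus 1" using M by (auto intro: M_plus_mono)
  then have [measurable_cong]: "sets M = sets borel" by (simp add: M_plus_def)
  have "integrable M (\<lambda>s. (1 + s\<^sup>2) powr (1/2))"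
    using M by (intro integrableI_bounded) (auto simp: M_plus_def)
  then show a: "integrable M (\<lambda>s. s)"
  proof (rule Bochner_Integration.integrable_bound)
    show "AE s in M. norm s \<le> norm ((1 + s\<^sup>2) powr (1/2))"
    proof (intro AE_I2)
      fix s :: real
      have "\<bar>s\<bar> = sqrt (s\<^sup>2)" by simp
      also have "\<dots> \<le> sqrt (1 + s\<^sup>2)" by (rule real_sqrt_le_mono) simp
      also have "\<dots> = (1 + s\<^sup>2) powr (1/2)" by (simp add: powr_half_sqrt add_nonneg_nonneg)
      finally show "norm s \<le> norm ((1 + s\<^sup>2) powr (1/2))" by simp
    qed
  qed measurable
  then show "integrable M (\<lambda>s. \<bar>s\<bar>)" by simp
qed

text \<open>The second term of the expansion at infinity. As \<i> y / (\<i> y - s) - 1 = s / (\<i> y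
  - s), the expression is 1 / pi times the integral of s y / (\<i> y - s), which the first moment
  dominates.\<close>

lemma tendsto_y_Q_trans_second:
  assumes M: "M \<in> M_plus (-1)"
  shows "((\<lambda>y. of_real y * (of_real y * Q_trans M (Complex 0 y) - of_real (measure M UNIV / pi)))
     \<longlongrightarrow> - \<i> * of_real ((LINT s|M. s) / pi)) at_top"
proof -
  note M0 = M_plus_minus_1D[OF M]
  note [measurable_cong] = M_plus_1D(1)[OF M0(2)]
  interpret finite_measure M using M0(1) by (rule finite_measure_M_plus_0)
  have lim: "((\<lambda>y. LINT s|M. of_real s * (of_real y / (Complex 0 y - of_real s))) \<longlongrightarrow> (LINT s|M. of_real s * - \<i>)) at_top"
  proof (rule integral_dominated_convergence_at_top)
    show "integrable M (\<lambda>s. \<bar>s\<bar>)" by (rule M0(4))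
    show "\<forall>\<^sub>F y in at_top. AE s in M. norm (of_real s * (of_real y / (Complex 0 y - complex_of_real s))) \<le> \<bar>s\<bar>"
      using eventually_gt_at_top[of "0::real"]
    proof eventually_elim
      case (elim y)
      have "norm (of_real s * (of_real y / (Complex 0 y - complex_of_real s))) \<le> \<bar>s\<bar> * 1" for s
        unfolding norm_mult using norm_y_over_le_1[OF elim, of s] by (intro mult_mono) auto
      then show ?case by simp
    qed
    show "AE s in M. ((\<lambda>y. of_real s * (of_real y / (Complex 0 y - complex_of_real s))) \<longlongrightarrow> of_real s * - \<i>) at_top"
    proof (intro AE_I2 tendsto_mult tendsto_const)
      fix s
      have "((\<lambda>y. - \<i> * (\<i> * of_real y / (Complex 0 y - of_real s))) \<longlongrightarrow> - \<i> * 1) at_top"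
        by (intro tendsto_mult tendsto_const tendsto_y_over)
      moreover have "- \<i> * (\<i> * c / w) = c / w" for c w :: complex by simp
      ultimately show "((\<lambda>y. of_real y / (Complex 0 y - complex_of_real s)) \<longlongrightarrow> - \<i>) at_top" by simp
    qed
  qed measurable
  have eq: "of_real y * (of_real y * Q_trans M (Complex 0 y) - of_real (measure M UNIV / pi)) =
     1 / of_real pi * (LINT s|M. of_real s * (of_real y / (Complex 0 y - of_real s)))" if "0 < y" for y
  proof -
    have i1: "integrable M (\<lambda>s. 1 / (Complex 0 y - complex_of_real s))"
      using that by (intro integrable_Cauchy_kernel_M_plus_1[OF M0(2)]) simp
    have "of_real y * (of_real y * Q_trans M (Complex 0 y) - of_real (measure M UNIV / pi)) =
      (LINT s|M. of_real y * (of_real y * (\<i> / of_real pi * (1 / (Complex 0 y - complex_of_real s))) - of_real (1 / pi)))"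
    proof -
      have i2: "integrable M (\<lambda>s. of_real y * (\<i> / of_real pi * (1 / (Complex 0 y - complex_of_real s))))"
        by (intro integrable_mult_right i1)
      have i3: "integrable M (\<lambda>s. complex_of_real (1 / pi))" by simp
      have c: "(LINT s|M. complex_of_real (1 / pi)) = of_real (measure M UNIV / pi)"
        using M_plus_1D(2)[OF M0(2)] by (simp add: scaleR_conv_of_real)
      show ?thesis
        unfolding Q_trans_eq integral_mult_right_zero Bochner_Integration.integral_diff[OF i2 i3] c ..
    qed
    also have "\<dots> = (LINT s|M. 1 / of_real pi * (of_real s * (of_real y / (Complex 0 y - of_real s))))"
    proof (rule Bochner_Integration.integral_cong[OF refl])
      fix s
      define w where "w = Complex 0 y - of_real s"
      have w: "w \<noteq> 0" using that by (auto simp: w_def complex_eq_iff)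
      have iy: "\<i> * of_real y = w + of_real s" by (simp add: w_def complex_eq_iff)
      have "of_real y * (\<i> / of_real pi * (1 / w)) - 1 / of_real pi = 1 / of_real pi * ((\<i> * of_real y) / w - 1)"
        by (simp add: right_diff_distrib)
      also have "\<dots> = 1 / of_real pi * (of_real s / w)" unfolding iy using w by (simp add: add_divide_distrib)
      finally show "of_real y * (of_real y * (\<i> / of_real pi * (1 / (Complex 0 y - complex_of_real s))) - of_real (1 / pi)) = 1 / of_real pi * (of_real s * (of_real y / (Complex 0 y - of_real s)))"
        by (simp add: w_def)
    qed
    finally show ?thesis by (subst (asm) integral_mult_right_zero)
  qed
  have "((\<lambda>y. 1 / of_real pi * (LINT s|M. of_real s * (of_real y / (Complex 0 y - of_real s)))) \<longlongrightarrow> 1 / of_real pi * (LINT s|M. of_real s * - \<i>)) at_top"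
    by (intro tendsto_mult tendsto_const lim)
  moreover have "\<forall>\<^sub>F y in at_top. 1 / of_real pi * (LINT s|M. of_real s * (of_real y / (Complex 0 y - of_real s))) =
     of_real y * (of_real y * Q_trans M (Complex 0 y) - of_real (measure M UNIV / pi))"
    using eventually_gt_at_top[of "0::real"] by eventually_elim (simp only: eq)
  ultimately have L: "((\<lambda>y. of_real y * (of_real y * Q_trans M (Complex 0 y) - of_real (measure M UNIV / pi))) \<longlongrightarrow> 1 / of_real pi * (LINT s|M. of_real s * - \<i>)) at_top"
    by (rule Lim_transform_eventually)
  have eql: "1 / of_real pi * (LINT s|M. of_real s * - \<i>) = - \<i> * of_real ((LINT s|M. s) / pi)"
    by (simp add: mult.commute)
  show ?thesis using L unfolding eql .
qed

lemma B_factor_imaginary_axis: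
  "B_factor \<nu> a b (Complex 0 y) = Q_trans \<nu> (Complex 0 y) - \<i> * of_real (a / pi) + of_real (b * y / pi)"
  by (simp add: B_factor_def complex_eq_iff)

lemma tendsto_B_factor_over_y:
  assumes "\<nu> \<in> M_plus 1"
  shows "((\<lambda>y. B_factor \<nu> a b (Complex 0 y) / of_real y) \<longlongrightarrow> of_real (b / pi)) at_top"
proof -
  have i0: "((\<lambda>y::real. complex_of_real (inverse y)) \<longlongrightarrow> of_real 0) at_top"
    by (intro tendsto_of_real tendsto_inverse_0_at_top filterlim_ident)
  have "((\<lambda>y. (Q_trans \<nu> (Complex 0 y) - \<i> * of_real (a / pi)) * of_real (inverse y) + of_real (b / pi))
     \<longlongrightarrow> (0 - \<i> * of_real (a / pi)) * of_real 0 + of_real (b / pi)) at_top"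
    by (intro tendsto_intros tendsto_Q_trans_at_top assms i0)
  moreover have "\<forall>\<^sub>F y in at_top. (Q_trans \<nu> (Complex 0 y) - \<i> * of_real (a / pi)) * of_real (inverse y) + of_real (b / pi)
     = B_factor \<nu> a b (Complex 0 y) / of_real y"
    using eventually_gt_at_top[of "0::real"]
    by eventually_elim (simp add: B_factor_imaginary_axis add_divide_distrib divide_inverse distrib_right)
  ultimately have "((\<lambda>y. B_factor \<nu> a b (Complex 0 y) / of_real y) \<longlongrightarrow> (0 - \<i> * of_real (a / pi)) * of_real 0 + of_real (b / pi)) at_top"
    by (rule Lim_transform_eventually)
  then show ?thesis by simp
qed

lemma tendsto_B_factor_minus:
  assumes "\<nu> \<in> M_plus 1"
  shows "((\<lambda>y. B_factor \<nu> a b (Complex 0 y) - of_real (b * y / pi)) \<longlongrightarrow> - \<i> * of_real (a / pi)) at_top"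
proof -
  have "((\<lambda>y. Q_trans \<nu> (Complex 0 y) - \<i> * of_real (a / pi)) \<longlongrightarrow> 0 - \<i> * of_real (a / pi)) at_top"
    by (intro tendsto_intros tendsto_Q_trans_at_top assms)
  then show ?thesis by (simp add: B_factor_imaginary_axis)
qed

lemma tendsto_y_B_factor_0:
  assumes "M \<in> M_plus 0"
  shows "((\<lambda>y. of_real y * B_factor M 0 0 (Complex 0 y)) \<longlongrightarrow> of_real (measure M UNIV / pi)) at_top"
  using tendsto_y_Q_trans[OF assms] by (simp add: B_factor_imaginary_axis)

lemma measure_pos_M_plus_0:
  assumes "M \<in> M_plus 0"
  shows "0 < measure M UNIV"
proof -
  interpret finite_measure M using assms by (rule finite_measure_M_plus_0)
  have "emeasure M UNIV \<noteq> 0" using assms by (simp add: M_plus_def)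
  then show ?thesis by (simp add: emeasure_eq_measure zero_less_measure_iff)
qed

text \<open>Along the imaginary axis G / y tends to \<zeta>1 / pi and G - \<zeta>1 y / pi tends to
  -\<i> \<zeta>0 / pi, so both constants are read off the growth of G = 1 / F. If c1 is nonzero, F
  grows linearly and G tends to 0. If c1 = 0 and c0 is nonzero, F tends to -\<i> c0 / pi. If both
  vanish, two terms of the expansion of F are required.\<close>

lemma is_B_zeta:
  assumes M: "M \<in> M_plus (-1)" and B: "is_B M c0 c1 \<mu> \<zeta>0 \<zeta>1"
  shows "c1 \<noteq> 0 \<Longrightarrow> \<zeta>0 = 0 \<and> \<zeta>1 = 0"
    and "c1 = 0 \<Longrightarrow> c0 \<noteq> 0 \<Longrightarrow> \<zeta>1 = 0 \<and> \<zeta>0 = - pi\<^sup>2 / c0"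
    and "c0 = 0 \<Longrightarrow> c1 = 0 \<Longrightarrow> \<zeta>0 = - (pi\<^sup>2 / (measure M UNIV)\<^sup>2) * (LINT \<tau>|M. \<tau>) \<and> \<zeta>1 = pi\<^sup>2 / measure M UNIV"
proof -
  note M0 = M_plus_minus_1D[OF M]
  have \<mu>: "\<mu> \<in> M_plus 1" and eq: "\<And>z. 0 < Im z \<Longrightarrow> B_factor M c0 c1 z * B_factor \<mu> \<zeta>0 \<zeta>1 z = 1"
    using B by (auto simp: is_B_iff)
  define F where "F y = B_factor M c0 c1 (Complex 0 y)" for y
  define G where "G y = B_factor \<mu> \<zeta>0 \<zeta>1 (Complex 0 y)" for y
  have FG: "G y = 1 / F y" "F y \<noteq> 0" if "0 < y" for y
  proof -
    have "F y * G y = 1" unfolding F_def G_def using that by (intro eq) simp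
    moreover from this show "F y \<noteq> 0" by auto
    ultimately show "G y = 1 / F y" by (simp add: eq_divide_eq mult.commute)
  qed
  have G1: "((\<lambda>y. G y / of_real y) \<longlongrightarrow> of_real (\<zeta>1 / pi)) at_top"
    unfolding G_def by (rule tendsto_B_factor_over_y[OF \<mu>])
  have G0: "((\<lambda>y. G y - of_real (\<zeta>1 * y / pi)) \<longlongrightarrow> - \<i> * of_real (\<zeta>0 / pi)) at_top"
    unfolding G_def by (rule tendsto_B_factor_minus[OF \<mu>])
  have ev: "\<forall>\<^sub>F y in at_top. P y" if "\<And>y. 0 < y \<Longrightarrow> P y" for P :: "real \<Rightarrow> bool"
    using eventually_gt_at_top[of "0::real"] that by (rule eventually_mono)
  have i0: "((\<lambda>y::real. complex_of_real (inverse y)) \<longlongrightarrow> of_real 0) at_top"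
    by (intro tendsto_of_real tendsto_inverse_0_at_top filterlim_ident)
  have from_limit: "\<zeta>1 = 0 \<and> \<zeta>0 = Re (\<i> * of_real pi * l)" if l: "(G \<longlongrightarrow> l) at_top" for l
  proof -
    have "((\<lambda>y. G y * of_real (inverse y)) \<longlongrightarrow> l * of_real 0) at_top" by (intro tendsto_intros l i0)
    then have "((\<lambda>y. G y / of_real y) \<longlongrightarrow> 0) at_top" by (simp add: divide_inverse)
    from tendsto_unique[OF trivial_limit_at_top_linorder this G1] have z: "\<zeta>1 = 0" by simp
    then have "(G \<longlongrightarrow> - \<i> * of_real (\<zeta>0 / pi)) at_top" using G0 by simp
    from tendsto_unique[OF trivial_limit_at_top_linorder l this] have "l = - \<i> * of_real (\<zeta>0 / pi)" .
    then show ?thesis using z by simp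
  qed
  show "\<zeta>0 = 0 \<and> \<zeta>1 = 0" if "c1 \<noteq> 0"
  proof -
    have "((\<lambda>y. of_real (inverse y) / (F y / of_real y)) \<longlongrightarrow> of_real 0 / of_real (c1 / pi)) at_top"
      unfolding F_def using that by (intro tendsto_divide i0 tendsto_B_factor_over_y M0) auto
    moreover have "\<forall>\<^sub>F y in at_top. of_real (inverse y) / (F y / of_real y) = G y"
      by (rule ev) (simp add: FG divide_inverse)
    ultimately have "(G \<longlongrightarrow> of_real 0 / of_real (c1 / pi)) at_top" by (rule Lim_transform_eventually)
    then show ?thesis using from_limit[of 0] by simp
  qed
  show "\<zeta>1 = 0 \<and> \<zeta>0 = - pi\<^sup>2 / c0" if "c1 = 0" "c0 \<noteq> 0"
  proof -
    have "(F \<longlongrightarrow> - \<i> * of_real (c0 / pi)) at_top"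
      using tendsto_B_factor_minus[OF M0(2), of c0 c1] that(1) by (simp add: F_def[abs_def])
    then have "((\<lambda>y. 1 / F y) \<longlongrightarrow> 1 / (- \<i> * of_real (c0 / pi))) at_top"
      using that(2) by (intro tendsto_intros) auto
    moreover have "\<forall>\<^sub>F y in at_top. 1 / F y = G y" by (rule ev) (simp add: FG)
    ultimately have "(G \<longlongrightarrow> 1 / (- \<i> * of_real (c0 / pi))) at_top" by (rule Lim_transform_eventually)
    from from_limit[OF this] have "\<zeta>1 = 0" "\<zeta>0 = Re (\<i> * of_real pi * (1 / (- \<i> * of_real (c0 / pi))))" by auto
    moreover have "\<i> * of_real pi * (1 / (- \<i> * of_real (c0 / pi))) = of_real (- pi\<^sup>2 / c0)"
      using that(2) by (simp add: power2_eq_square)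
    ultimately show ?thesis by (simp add: power2_eq_square)
  qed
  show "\<zeta>0 = - (pi\<^sup>2 / (measure M UNIV)\<^sup>2) * (LINT \<tau>|M. \<tau>) \<and> \<zeta>1 = pi\<^sup>2 / measure M UNIV" if "c0 = 0" "c1 = 0"
  proof -
    define m where "m = measure M UNIV"
    define m1 where "m1 = (LINT \<tau>|M. \<tau>)"
    have m: "0 < m" unfolding m_def by (rule measure_pos_M_plus_0[OF M0(1)])
    have yF: "((\<lambda>y. of_real y * F y) \<longlongrightarrow> of_real (m / pi)) at_top"
      using tendsto_y_B_factor_0[OF M0(1)] that by (simp add: F_def m_def)
    have yyF: "((\<lambda>y. of_real y * (of_real y * F y - of_real (m / pi))) \<longlongrightarrow> - \<i> * of_real (m1 / pi)) at_top"
      using tendsto_y_Q_trans_second[OF M] that by (simp add: F_def m_def m1_def B_factor_imaginary_axis)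
    have "((\<lambda>y. 1 / (of_real y * F y)) \<longlongrightarrow> 1 / of_real (m / pi)) at_top"
      using m by (intro tendsto_divide yF tendsto_const) auto
    moreover have "\<forall>\<^sub>F y in at_top. 1 / (of_real y * F y) = G y / of_real y" by (rule ev) (simp add: FG)
    ultimately have "((\<lambda>y. G y / of_real y) \<longlongrightarrow> 1 / of_real (m / pi)) at_top" by (rule Lim_transform_eventually)
    from tendsto_unique[OF trivial_limit_at_top_linorder this G1]
    have "1 / of_real (m / pi) = complex_of_real (\<zeta>1 / pi)" .
    then have "complex_of_real (pi / m) = of_real (\<zeta>1 / pi)" by simp
    then have "pi / m = \<zeta>1 / pi" by (simp only: of_real_eq_iff)
    then have z1: "\<zeta>1 = pi\<^sup>2 / m" by (simp add: field_simps power2_eq_square)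
    \<comment> \<open>This quotient is 1 / F - pi y / m = (m - pi y F) / (m F), expanded by y so
      that numerator and denominator both converge.\<close>
    have "((\<lambda>y. - of_real pi * (of_real y * (of_real y * F y - of_real (m / pi))) / (of_real m * (of_real y * F y)))
       \<longlongrightarrow> - of_real pi * (- \<i> * of_real (m1 / pi)) / (of_real m * of_real (m / pi))) at_top"
      using m by (intro tendsto_intros yyF yF) auto
    moreover have "\<forall>\<^sub>F y in at_top. - of_real pi * (of_real y * (of_real y * F y - of_real (m / pi))) / (of_real m * (of_real y * F y)) = G y - of_real (\<zeta>1 * y / pi)"
    proof (rule ev)
      fix y :: real assume y: "0 < y"
      define f where "f = F y"
      have f: "f \<noteq> 0" using FG(2)[OF y] by (simp add: f_def)
      have "- of_real pi * (of_real y * (of_real y * f - of_real (m / pi))) = (of_real y :: complex) * (of_real m - of_real pi * (of_real y * f))"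
        by (simp add: algebra_simps)
      then have "- of_real pi * (of_real y * (of_real y * f - of_real (m / pi))) / (of_real m * (of_real y * f)) = (of_real m - of_real pi * (of_real y * f)) / (of_real m * f)"
        using y by simp
      also have "\<dots> = 1 / f - of_real pi * of_real y / of_real m"
        using f m by (simp add: diff_divide_distrib)
      also have "\<dots> = G y - of_real (\<zeta>1 * y / pi)"
        using FG(1)[OF y] by (simp add: z1 f_def power2_eq_square)
      finally show "- of_real pi * (of_real y * (of_real y * F y - of_real (m / pi))) / (of_real m * (of_real y * F y)) = G y - of_real (\<zeta>1 * y / pi)"
        by (simp add: f_def)
    qed
    ultimately have "((\<lambda>y. G y - of_real (\<zeta>1 * y / pi)) \<longlongrightarrow> - of_real pi * (- \<i> * of_real (m1 / pi)) / (of_real m * of_real (m / pi))) at_top"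
      by (rule Lim_transform_eventually)
    from tendsto_unique[OF trivial_limit_at_top_linorder this G0]
    have "- of_real pi * (- \<i> * of_real (m1 / pi)) / (of_real m * of_real (m / pi)) = - \<i> * complex_of_real (\<zeta>0 / pi)" .
    moreover have "- of_real pi * (- \<i> * of_real (m1 / pi)) / (of_real m * of_real (m / pi)) = - \<i> * complex_of_real (- (pi * m1 / m\<^sup>2))"
      by (simp add: power2_eq_square)
    ultimately have "- \<i> * complex_of_real (\<zeta>0 / pi) = - \<i> * of_real (- (pi * m1 / m\<^sup>2))" by simp
    from arg_cong[OF this, of Im] have "\<zeta>0 / pi = - (pi * m1 / m\<^sup>2)" by simp
    then have "\<zeta>0 = - (pi * m1 / m\<^sup>2) * pi" by (simp add: divide_eq_eq)
    then show ?thesis using z1 by (simp add: m_def m1_def power2_eq_square)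
  qed
qed

section \<open>Size of a measure from its Poisson integral on the imaginary axis\<close>

lemma tendsto_poisson_over_y:
  assumes \<nu>: "poisson_measure \<nu>"
  shows "((\<lambda>y. poisson \<nu> 0 y / y) \<longlongrightarrow> 0) at_top"
proof -
  note [measurable_cong] = poisson_measureD(1)[OF \<nu>]
  have "((\<lambda>y. LINT s|\<nu>. poisson_kernel 0 y s / y) \<longlongrightarrow> (LINT s|\<nu>. 0)) at_top"
  proof (rule integral_dominated_convergence_at_top)
    show "integrable \<nu> (\<lambda>s. 1 / (1 + s\<^sup>2))" using \<nu> by auto
    have k: "poisson_kernel 0 y s / y = 1 / (pi * (s\<^sup>2 + y\<^sup>2))" if "0 < y" for y s
      using that by (simp add: poisson_kernel_def)
    show "\<forall>\<^sub>F y in at_top. AE s in \<nu>. norm (poisson_kernel 0 y s / y) \<le> 1 / (1 + s\<^sup>2)"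
      using eventually_ge_at_top[of "1::real"]
    proof eventually_elim
      case (elim y)
      have "norm (poisson_kernel 0 y s / y) \<le> 1 / (1 + s\<^sup>2)" for s
      proof -
        have "1 \<le> y\<^sup>2" using elim by (simp add: one_le_power)
        then have "1 * (1 + s\<^sup>2) \<le> pi * (s\<^sup>2 + y\<^sup>2)" using pi_gt3 by (intro mult_mono) auto
        moreover have "0 < s\<^sup>2 + y\<^sup>2" using \<open>1 \<le> y\<^sup>2\<close> zero_le_power2[of s] by linarith
        ultimately have "1 / (pi * (s\<^sup>2 + y\<^sup>2)) \<le> 1 / (1 + s\<^sup>2)"
          by (intro divide_left_mono) (auto intro!: mult_pos_pos add_pos_nonneg)
        then show ?thesis using k[of y s] elim by simp
      qed
      then show ?case by simp
    qed
    show "AE s in \<nu>. ((\<lambda>y. poisson_kernel 0 y s / y) \<longlongrightarrow> 0) at_top"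
    proof (intro AE_I2)
      fix s
      have "((\<lambda>y. 1 / (pi * (s\<^sup>2 + y\<^sup>2))) \<longlongrightarrow> 0) at_top" by real_asymp
      moreover have "\<forall>\<^sub>F y in at_top. 1 / (pi * (s\<^sup>2 + y\<^sup>2)) = poisson_kernel 0 y s / y"
        using eventually_gt_at_top[of "0::real"] by eventually_elim (simp add: k)
      ultimately show "((\<lambda>y. poisson_kernel 0 y s / y) \<longlongrightarrow> 0) at_top" by (rule Lim_transform_eventually)
    qed
  qed measurable
  then show ?thesis by (simp add: poisson_def)
qed

text \<open>A telescoping substitute for 2 ^ k / (4 ^ k + a^2), which for a = |s| is pi times the
  Poisson kernel at 0 and height 2 ^ k. Its sum over k is known exactly.\<close>

definition dyadic :: "real \<Rightarrow> nat \<Rightarrow> real" where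
  "dyadic a k = 1 / (2^k + a) - 1 / (2^Suc k + a)"

text \<open>With y = 2 ^ k the difference is y / ((y + a) (2 y + a)), and this denominator lies
  between y^2 + a^2 and 4 (y^2 + a^2).\<close>

lemma dyadic_telescope:
  assumes "0 \<le> a"
  shows "dyadic a sums (1 / (1 + a))" and "0 \<le> dyadic a k"
    and "dyadic a k \<le> 2^k / (4^k + a\<^sup>2)" and "2^k / (4^k + a\<^sup>2) \<le> 4 * dyadic a k"
proof -
  have "(\<lambda>k. - (1 / (2^k + a))) \<longlonglongrightarrow> 0" by real_asymp
  from telescope_sums[OF this] show "dyadic a sums (1 / (1 + a))" by (simp add: dyadic_def[abs_def])
  define y where "y = (2::real)^k"
  have y: "0 < y" by (simp add: y_def)
  have pos: "0 < y + a" "0 < 2 * y + a" "0 < y * y + a * a" using y assms by (simp_all add: add_pos_nonneg)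
  have "dyadic a k = 1 / (y + a) - 1 / (2 * y + a)" by (simp add: dyadic_def y_def)
  also have "\<dots> = (1 * (2 * y + a) - 1 * (y + a)) / ((y + a) * (2 * y + a))"
    using pos by (intro diff_frac_eq) auto
  finally have d: "dyadic a k = y / ((y + a) * (2 * y + a))" by simp
  have f: "(4::real)^k + a\<^sup>2 = y * y + a * a" by (simp add: four_power_eq y_def power2_eq_square)
  show "0 \<le> dyadic a k" unfolding d using y pos by (intro divide_nonneg_nonneg) auto
  have ya: "0 \<le> y * a" using y assms by simp
  have "y * y + a * a \<le> (y + a) * (2 * y + a)" using ya zero_le_square[of y] by (simp add: algebra_simps)
  then show "dyadic a k \<le> 2^k / (4^k + a\<^sup>2)"
    unfolding d f y_def[symmetric] using y pos by (intro divide_left_mono mult_pos_pos) auto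
  have "(y + a) * (2 * y + a) \<le> 4 * (y * y + a * a)"
  proof -
    have "2 * (y * a) \<le> y * y + a * a" using zero_le_square[of "y - a"] by (simp add: algebra_simps)
    moreover have "(y + a) * (2 * y + a) = 2 * (y * y) + 3 * (y * a) + a * a" by (simp add: algebra_simps)
    ultimately show ?thesis using zero_le_square[of y] zero_le_square[of a] unfolding distrib_left by linarith
  qed
  then have "4 * y / (4 * (y * y + a * a)) \<le> 4 * y / ((y + a) * (2 * y + a))"
    using y pos by (intro divide_left_mono mult_pos_pos) auto
  moreover have "4 * y / (4 * (y * y + a * a)) = y / (y * y + a * a)"
    by (rule mult_divide_mult_cancel_left) simp
  ultimately show "2^k / (4^k + a\<^sup>2) \<le> 4 * dyadic a k" unfolding d f y_def[symmetric] by simp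
qed

text \<open>The condition \<open>\<integral> (1 + s\<^sup>2) powr (-1/2) d\<nu> < \<infinity>\<close> is read off the growth of the Poisson integral
  along the imaginary axis, sampled at \<open>2 ^ k\<close>: the kernels there add up to about \<open>1 / (1 + \<bar>s\<bar>)\<close>.\<close>

lemma M_plus_1_of_summable_poisson:
  assumes \<nu>: "poisson_measure \<nu>" and summ: "summable (\<lambda>k. poisson \<nu> 0 (2^k))"
  shows "(\<integral>\<^sup>+s. ennreal ((1 + s\<^sup>2) powr (- 1 / 2)) \<partial>\<nu>) < \<infinity>"
proof -
  note [measurable_cong] = poisson_measureD(1)[OF \<nu>]
  define d where "d s = dyadic \<bar>s\<bar>" for s
  have d: "d s sums (1 / (1 + \<bar>s\<bar>))" "0 \<le> d s k" "d s k \<le> 2^k / (4^k + s\<^sup>2)" for s k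
    using dyadic_telescope[of "\<bar>s\<bar>"] by (simp_all add: d_def)
  have "(\<integral>\<^sup>+s. ennreal ((1 + s\<^sup>2) powr (- 1 / 2)) \<partial>\<nu>) \<le> (\<integral>\<^sup>+s. ennreal 2 * (\<Sum>k. ennreal (d s k)) \<partial>\<nu>)"
  proof (intro nn_integral_mono)
    fix s :: real
    have pos: "0 < 1 + s\<^sup>2" by (simp add: add_pos_nonneg)
    have "(1 + \<bar>s\<bar>)\<^sup>2 \<le> 4 * (1 + s\<^sup>2)"
      using zero_le_power2[of "\<bar>s\<bar> - 1"] zero_le_power2[of s] by (simp add: power2_eq_square algebra_simps)
    then have "sqrt ((1 + \<bar>s\<bar>)\<^sup>2) \<le> sqrt (4 * (1 + s\<^sup>2))" by (rule real_sqrt_le_mono)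
    moreover have "sqrt (4 * (1 + s\<^sup>2)) = 2 * sqrt (1 + s\<^sup>2)" by (subst real_sqrt_mult) simp
    ultimately have "1 + \<bar>s\<bar> \<le> 2 * sqrt (1 + s\<^sup>2)" by simp
    then have "1 / sqrt (1 + s\<^sup>2) \<le> 2 * (1 / (1 + \<bar>s\<bar>))"
      using pos by (simp add: pos_divide_le_eq pos_le_divide_eq)
    moreover have "(1 + s\<^sup>2) powr (- 1 / 2) = 1 / sqrt (1 + s\<^sup>2)"
      using pos by (simp add: powr_minus powr_half_sqrt inverse_eq_divide)
    ultimately have "ennreal ((1 + s\<^sup>2) powr (- 1 / 2)) \<le> ennreal (2 * (1 / (1 + \<bar>s\<bar>)))"
      by (intro ennreal_leI) simp
    also have "\<dots> = ennreal 2 * ennreal (\<Sum>k. d s k)"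
      using sums_unique[OF d(1), of s] by (simp add: ennreal_mult')
    also have "ennreal (\<Sum>k. d s k) = (\<Sum>k. ennreal (d s k))"
      using d(1,2) sums_summable by (intro suminf_ennreal2[symmetric]) blast+
    finally show "ennreal ((1 + s\<^sup>2) powr (- 1 / 2)) \<le> ennreal 2 * (\<Sum>k. ennreal (d s k))" .
  qed
  also have "\<dots> \<le> (\<integral>\<^sup>+s. ennreal 2 * (\<Sum>k. ennreal pi * ennreal (poisson_kernel 0 (2^k) s)) \<partial>\<nu>)"
  proof (intro nn_integral_mono mult_left_mono suminf_le)
    fix s :: real and k :: nat
    have "2^k / (4^k + s\<^sup>2) = pi * poisson_kernel 0 (2^k) s"
      by (simp add: poisson_kernel_def four_power_eq power2_eq_square[of "2^k"] add.commute)
    then have "d s k \<le> pi * poisson_kernel 0 (2^k) s" using d(3)[of s k] by simp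
    then show "ennreal (d s k) \<le> ennreal pi * ennreal (poisson_kernel 0 (2^k) s)"
      by (simp add: ennreal_mult[symmetric] poisson_kernel_nonneg ennreal_leI)
  qed auto
  also have "\<dots> = ennreal 2 * (\<Sum>k. ennreal pi * ennreal (poisson \<nu> 0 (2^k)))"
    by (simp add: nn_integral_cmult nn_integral_suminf ennreal_poisson[OF \<nu>])
  also have "(\<Sum>k. ennreal pi * ennreal (poisson \<nu> 0 (2^k))) = (\<Sum>k. ennreal (pi * poisson \<nu> 0 (2^k)))"
    by (simp add: ennreal_mult poisson_nonneg)
  also have "\<dots> = ennreal (\<Sum>k. pi * poisson \<nu> 0 (2^k))"
    using summ by (intro suminf_ennreal2 summable_mult) (simp_all add: poisson_nonneg)
  also have "ennreal 2 * \<dots> < \<infinity>" by (simp add: ennreal_mult_less_top)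
  finally show ?thesis .
qed

text \<open>The product pi y P(y), with P(y) the Poisson integral at \<i> y, is the integral of y^2
  / (s^2 + y^2), which increases to the total mass.\<close>

lemma finite_of_bounded_poisson:
  assumes \<nu>: "poisson_measure \<nu>" and bound: "\<forall>\<^sub>F y in at_top. y * poisson \<nu> 0 y \<le> C"
  shows "emeasure \<nu> UNIV < \<infinity>"
proof -
  note [measurable_cong] = poisson_measureD(1)[OF \<nu>] and [simp] = poisson_measureD(1,2)[OF \<nu>]
  define f where "f n s = ennreal ((real n)\<^sup>2 / (s\<^sup>2 + (real n)\<^sup>2))" for n s
  have "(\<lambda>n. \<integral>\<^sup>+s. f n s \<partial>\<nu>) \<longlonglongrightarrow> (\<integral>\<^sup>+s. 1 \<partial>\<nu>)"
  proof (rule nn_integral_LIMSEQ)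
    show "f n \<in> borel_measurable \<nu>" for n unfolding f_def[abs_def] by measurable
    show "incseq f"
    proof (intro incseq_SucI le_funI)
      fix n s
      show "f n s \<le> f (Suc n) s"
      proof (cases "n = 0")
        case False
        have frac: "a / (x + a) \<le> b / (x + b)" if "0 \<le> x" "0 < a" "a \<le> b" for a b x :: real
        proof -
          have "0 < x + a" "0 < x + b" "x * a \<le> x * b" using that by (auto intro: mult_left_mono)
          then have "a * (x + b) \<le> b * (x + a)" by (simp add: algebra_simps)
          then show ?thesis using \<open>0 < x + a\<close> \<open>0 < x + b\<close> by (simp add: frac_le_eq divide_le_0_iff)
        qed
        have "(real n)\<^sup>2 \<le> (real (Suc n))\<^sup>2" by (intro power_mono) auto
        then show ?thesis unfolding f_def using False by (intro ennreal_leI frac) auto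
      qed (simp add: f_def)
    qed
    show "(\<lambda>n. f n s) \<longlonglongrightarrow> 1" for s
    proof -
      have "(\<lambda>n. (real n)\<^sup>2 / (s\<^sup>2 + (real n)\<^sup>2)) \<longlonglongrightarrow> 1" by real_asymp
      then show ?thesis unfolding f_def by (metis ennreal_1 tendsto_ennrealI)
    qed
  qed
  moreover have "\<forall>\<^sub>F n in sequentially. (\<integral>\<^sup>+s. f n s \<partial>\<nu>) \<le> ennreal (pi * C)"
    using eventually_compose_filterlim[OF bound filterlim_real_sequentially] eventually_gt_at_top[of "0::nat"]
  proof eventually_elim
    case (elim n)
    have "(\<integral>\<^sup>+s. f n s \<partial>\<nu>) = (\<integral>\<^sup>+s. ennreal (pi * real n) * ennreal (poisson_kernel 0 (real n) s) \<partial>\<nu>)"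
      unfolding f_def by (intro nn_integral_cong, subst ennreal_mult[symmetric])
        (auto simp: poisson_kernel_nonneg, simp add: poisson_kernel_def power2_eq_square)
    also have "\<dots> = ennreal (pi * real n) * ennreal (poisson \<nu> 0 (real n))"
      using \<nu> by (subst nn_integral_cmult) (auto simp: ennreal_poisson)
    also have "\<dots> = ennreal (pi * (real n * poisson \<nu> 0 (real n)))"
      by (subst ennreal_mult[symmetric]) (auto simp: poisson_nonneg mult.assoc)
    also have "\<dots> \<le> ennreal (pi * C)" using elim by (intro ennreal_leI) simp
    finally show ?case .
  qed
  ultimately have "(\<integral>\<^sup>+s. 1 \<partial>\<nu>) \<le> ennreal (pi * C)"
    by (intro tendsto_upperbound) auto
  then show ?thesis by (simp add: le_less_trans)
qed

text \<open>With m the total mass of a finite M, this is y (m - pi y P(y)) for the Poisson integral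
  P(y) at \<i> y: the error in the leading asymptotics. The integrand is about s^2 / y for |s| below
  y and at most y beyond.\<close>

definition cut_off_moment :: "real measure \<Rightarrow> real \<Rightarrow> real" where
  "cut_off_moment M y = (LINT s|M. y * s\<^sup>2 / (y\<^sup>2 + s\<^sup>2))"

text \<open>Re (1 / F) is at most 1 / Re F = pi y / A with A = pi y Re F. Subtracting pi y / m
  leaves pi y (m - A) / (A m), whose numerator is pi times the cut-off moment. Since A tends to m,
  eventually A > m / 2, which gives the factor 2.\<close>

lemma Re_inverse_B_factor_le:
  assumes M: "M \<in> M_plus 0"
  defines "m \<equiv> measure M UNIV"
  shows "\<forall>\<^sub>F y in at_top. Re (1 / B_factor M 0 0 (Complex 0 y)) - pi / m * y \<le> 2 * pi / m\<^sup>2 * cut_off_moment M y"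
proof -
  have M1: "M \<in> M_plus 1" using M by (rule M_plus_mono) simp
  note [measurable_cong] = M_plus_1D(1)[OF M1]
  interpret finite_measure M using M by (rule finite_measure_M_plus_0)
  have m: "0 < m" unfolding m_def by (rule measure_pos_M_plus_0[OF M])
  have "((\<lambda>y. Re (of_real y * B_factor M 0 0 (Complex 0 y))) \<longlongrightarrow> Re (of_real (m / pi))) at_top"
    unfolding m_def by (intro tendsto_Re tendsto_y_B_factor_0 M)
  moreover have "m / (2 * pi) < Re (of_real (m / pi))" using m by (simp add: field_simps)
  ultimately have "\<forall>\<^sub>F y in at_top. m / (2 * pi) < Re (of_real y * B_factor M 0 0 (Complex 0 y))"
    by (rule order_tendstoD)
  with eventually_gt_at_top[of "0::real"] show ?thesis
  proof eventually_elim
    case (elim y)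
    define F where "F = B_factor M 0 0 (Complex 0 y)"
    have ReF: "Re F = poisson M 0 y" using Re_B_factor[OF M1 elim(1)] by (simp add: F_def)
    define A where "A = pi * y * Re F"
    have A: "m / 2 < A" using elim(2) by (simp add: A_def F_def field_simps)
    have "0 < A" using A m by linarith
    moreover have "0 < pi * y" using elim(1) by simp
    ultimately have "0 < Re F" unfolding A_def by (rule zero_less_mult_pos)
    have int: "integrable M (\<lambda>s. y * s\<^sup>2 / (y\<^sup>2 + s\<^sup>2))"
    proof (rule integrable_const_bound)
      show "AE s in M. norm (y * s\<^sup>2 / (y\<^sup>2 + s\<^sup>2)) \<le> y"
      proof (intro AE_I2)
        fix s
        have "0 < y\<^sup>2 + s\<^sup>2" using elim(1) by (simp add: add_pos_nonneg)
        then have "s\<^sup>2 / (y\<^sup>2 + s\<^sup>2) \<le> 1" by (simp add: divide_le_eq_1)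
        then have "y * (s\<^sup>2 / (y\<^sup>2 + s\<^sup>2)) \<le> y * 1" using elim(1) by (intro mult_left_mono) auto
        then show "norm (y * s\<^sup>2 / (y\<^sup>2 + s\<^sup>2)) \<le> y" using elim(1) by (simp add: add_nonneg_nonneg)
      qed
    qed measurable
    have "y * (m - A) = (LINT s|M. y - pi * y * y * poisson_kernel 0 y s)"
      unfolding m_def A_def ReF poisson_def
      using integrable_poisson_kernel[OF M_plus_1D(4)[OF M1], of 0 y] M_plus_1D(2)[OF M1]
      by (simp add: right_diff_distrib mult.assoc)
    also have "\<dots> = cut_off_moment M y"
      unfolding cut_off_moment_def
    proof (intro Bochner_Integration.integral_cong refl)
      fix s
      have nz: "y\<^sup>2 + s\<^sup>2 \<noteq> 0" using elim(1) by (simp add: add_pos_nonneg less_imp_neq[symmetric])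
      have "pi * y * y * poisson_kernel 0 y s = y * y\<^sup>2 / (y\<^sup>2 + s\<^sup>2)"
        by (simp add: poisson_kernel_def power2_eq_square add.commute)
      also have "y - \<dots> = (y * (y\<^sup>2 + s\<^sup>2) - y * y\<^sup>2) / (y\<^sup>2 + s\<^sup>2)" using nz by (simp add: diff_divide_distrib)
      finally show "y - pi * y * y * poisson_kernel 0 y s = y * s\<^sup>2 / (y\<^sup>2 + s\<^sup>2)" by (simp add: distrib_left)
    qed
    finally have D: "y * (m - A) = cut_off_moment M y" .
    have D0: "0 \<le> cut_off_moment M y" unfolding cut_off_moment_def using elim(1) by (intro integral_nonneg_AE AE_I2) (simp add: add_nonneg_nonneg)
    have "Re (1 / F) = Re F / ((Re F)\<^sup>2 + (Im F)\<^sup>2)" by (simp add: Re_divide)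
    also have "\<dots> \<le> Re F / (Re F)\<^sup>2"
      using \<open>0 < Re F\<close> by (intro divide_left_mono mult_pos_pos) (auto intro: add_pos_nonneg)
    also have "\<dots> = pi * y / A" using \<open>0 < Re F\<close> elim(1) by (simp add: A_def power2_eq_square)
    finally have "Re (1 / F) - pi / m * y \<le> pi * y / A - pi * y / m" by simp
    also have "\<dots> = (pi * y * m - pi * y * A) / (A * m)" using A m by (intro diff_frac_eq) auto
    also have "\<dots> = pi * cut_off_moment M y / (A * m)" unfolding D[symmetric] by (simp add: algebra_simps)
    also have "\<dots> \<le> pi * cut_off_moment M y / (m / 2 * m)"
      using A m D0 by (intro divide_left_mono mult_right_mono mult_pos_pos) auto
    also have "\<dots> = 2 * pi / m\<^sup>2 * cut_off_moment M y" by (simp add: power2_eq_square)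
    finally show ?case by (simp add: F_def)
  qed
qed

text \<open>At y = 2 ^ k the integrand is at most 4 s^2 times \<open>dyadic \<bar>s\<bar> k\<close>.
  Telescoping bounds every partial sum of integrands by 4 s^2 / (1 + |s|) \<le> 4 |s|, so a first
  moment pays for all dyadic scales together.\<close>

lemma summable_D_fun:
  assumes M: "M \<in> M_plus (-1)"
  shows "summable (\<lambda>k. cut_off_moment M (2^k))"
proof (rule summableI_nonneg_bounded)
  note M0 = M_plus_minus_1D[OF M]
  note [measurable_cong] = M_plus_1D(1)[OF M0(2)]
  define g where "g k s = 2^k * s\<^sup>2 / ((2^k)\<^sup>2 + s\<^sup>2)" for k and s :: real
  define d where "d s = dyadic \<bar>s\<bar>" for s
  have d: "d s sums (1 / (1 + \<bar>s\<bar>))" "0 \<le> d s k" "2^k / (4^k + s\<^sup>2) \<le> 4 * d s k" for s k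
    using dyadic_telescope[of "\<bar>s\<bar>"] by (simp_all add: d_def)
  have g0: "0 \<le> g k s" for k s by (simp add: g_def add_nonneg_nonneg)
  have gs: "(\<Sum>k<n. g k s) \<le> 4 * \<bar>s\<bar>" for n s
  proof -
    have "(\<Sum>k<n. g k s) \<le> (\<Sum>k<n. s\<^sup>2 * (4 * d s k))"
    proof (intro sum_mono)
      fix k
      have "g k s = s\<^sup>2 * (2^k / (4^k + s\<^sup>2))" by (simp add: g_def four_power_eq power2_eq_square[of "2^k"])
      also have "\<dots> \<le> s\<^sup>2 * (4 * d s k)" using d(3) by (intro mult_left_mono) auto
      finally show "g k s \<le> s\<^sup>2 * (4 * d s k)" .
    qed
    also have "\<dots> = 4 * s\<^sup>2 * (\<Sum>k<n. d s k)" by (subst sum_distrib_left) (simp add: mult_ac)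
    also have "\<dots> \<le> 4 * s\<^sup>2 * (1 / (1 + \<bar>s\<bar>))"
      using sum_le_suminf[of "d s" "{..<n}"] d(1,2) sums_unique[OF d(1), of s] sums_summable[OF d(1)]
      by (intro mult_left_mono) auto
    also have "\<dots> \<le> 4 * \<bar>s\<bar>"
      by (simp add: pos_divide_le_eq) (simp add: distrib_left power2_eq_square flip: abs_mult)
    finally show ?thesis .
  qed
  have int: "integrable M (g k)" for k
  proof (rule Bochner_Integration.integrable_bound)
    show "integrable M (\<lambda>s. 4 * \<bar>s\<bar>)" using M0(4) by simp
    show "AE s in M. norm (g k s) \<le> norm (4 * \<bar>s\<bar>)"
    proof (intro AE_I2)
      fix s
      have "g k s \<le> (\<Sum>k<Suc k. g k s)" using g0 by (intro member_le_sum) auto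
      then show "norm (g k s) \<le> norm (4 * \<bar>s\<bar>)" using gs[of s "Suc k"] g0[of k s] by simp
    qed
    show "g k \<in> borel_measurable M" unfolding g_def[abs_def] by measurable
  qed
  show "0 \<le> cut_off_moment M (2^n)" for n unfolding cut_off_moment_def by (intro integral_nonneg_AE AE_I2) (simp add: add_nonneg_nonneg)
  fix n
  have "(\<Sum>k<n. cut_off_moment M (2^k)) = (LINT s|M. (\<Sum>k<n. g k s))"
  proof -
    have "cut_off_moment M (2^k) = (LINT s|M. g k s)" for k by (simp add: cut_off_moment_def g_def)
    then show ?thesis using int by simp
  qed
  also have "\<dots> \<le> (LINT s|M. 4 * \<bar>s\<bar>)"
    using int M0(4) gs by (intro integral_mono) auto
  finally show "(\<Sum>k<n. cut_off_moment M (2^k)) \<le> (LINT s|M. 4 * \<bar>s\<bar>)" .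
qed

lemma y_D_fun_le:
  assumes M: "M \<in> M_plus 0" and "integrable M (\<lambda>s. s\<^sup>2)" "0 < y"
  shows "y * cut_off_moment M y \<le> (LINT s|M. s\<^sup>2)"
proof -
  have "sets M = sets borel" using M by (simp add: M_plus_def)
  note [measurable_cong] = this
  have le: "norm (y * (y * s\<^sup>2 / (y\<^sup>2 + s\<^sup>2))) \<le> s\<^sup>2" for s
  proof -
    have "0 < y\<^sup>2 + s\<^sup>2" using \<open>0 < y\<close> by (simp add: add_pos_nonneg)
    then have "y\<^sup>2 / (y\<^sup>2 + s\<^sup>2) \<le> 1" by (simp add: divide_le_eq_1)
    then have "s\<^sup>2 * (y\<^sup>2 / (y\<^sup>2 + s\<^sup>2)) \<le> s\<^sup>2 * 1" by (intro mult_left_mono) auto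
    then show ?thesis using \<open>0 < y\<close> by (simp add: power2_eq_square[of y] mult_ac add_nonneg_nonneg)
  qed
  have "integrable M (\<lambda>s. y * (y * s\<^sup>2 / (y\<^sup>2 + s\<^sup>2)))"
    by (rule Bochner_Integration.integrable_bound[OF assms(2)]) (use le in auto)
  then have "(LINT s|M. y * (y * s\<^sup>2 / (y\<^sup>2 + s\<^sup>2))) \<le> (LINT s|M. s\<^sup>2)"
    using assms(2) le by (intro integral_mono) (auto dest: spec intro: order_trans[OF abs_ge_self])
  then show ?thesis unfolding cut_off_moment_def integral_mult_right_zero .
qed

text \<open>If c1 is nonzero, F grows linearly and y / F converges. Otherwise F tends to the nonzero
  imaginary number -\<i> c0 / pi, so 1 / F need not be small, but its real part is Re F divided by
  |F|^2, and y Re F tends to the total mass over pi.\<close>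

lemma y_Re_inverse_B_factor_bounded:
  assumes M: "M \<in> M_plus 0" and "0 \<le> c1" and "c0 \<noteq> 0 \<or> c1 \<noteq> 0"
  shows "\<exists>C. \<forall>\<^sub>F y in at_top. y * Re (1 / B_factor M c0 c1 (Complex 0 y)) \<le> C"
proof -
  have M1: "M \<in> M_plus 1" using M by (rule M_plus_mono) simp
  define F where "F y = B_factor M c0 c1 (Complex 0 y)" for y
  have "\<exists>l. ((\<lambda>y. y * Re (1 / F y)) \<longlongrightarrow> l) at_top"
  proof (cases "c1 = 0")
    case False
    have "((\<lambda>y. Re (1 / (F y / of_real y))) \<longlongrightarrow> Re (1 / of_real (c1 / pi))) at_top"
      unfolding F_def using False by (intro tendsto_Re tendsto_divide tendsto_const tendsto_B_factor_over_y M1) auto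
    moreover have "Re (1 / (F y / of_real y)) = y * Re (1 / F y)" for y
    proof -
      have "1 / (F y / of_real y) = of_real y * (1 / F y)" by simp
      moreover have "Re (of_real y * w) = y * Re w" for w by simp
      ultimately show ?thesis by (simp only:)
    qed
    ultimately show ?thesis by auto
  next
    case True
    then have c0: "c0 \<noteq> 0" using assms(3) by simp
    have F: "(F \<longlongrightarrow> - \<i> * of_real (c0 / pi)) at_top"
      using tendsto_B_factor_minus[OF M1, of c0 c1] True by (simp add: F_def[abs_def])
    have yF: "((\<lambda>y. Re (of_real y * Q_trans M (Complex 0 y))) \<longlongrightarrow> Re (of_real (measure M UNIV / pi))) at_top"
      by (intro tendsto_Re tendsto_y_Q_trans M)
    have "((\<lambda>y. Re (of_real y * Q_trans M (Complex 0 y)) / ((Re (F y))\<^sup>2 + (Im (F y))\<^sup>2)) \<longlongrightarrow>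
      Re (of_real (measure M UNIV / pi)) / ((Re (- \<i> * of_real (c0 / pi)))\<^sup>2 + (Im (- \<i> * of_real (c0 / pi)))\<^sup>2)) at_top"
      using c0 by (intro tendsto_intros yF F) auto
    moreover have "Re (of_real y * Q_trans M (Complex 0 y)) / ((Re (F y))\<^sup>2 + (Im (F y))\<^sup>2) = y * Re (1 / F y)" for y
      using True by (simp add: F_def B_factor_imaginary_axis Re_divide)
    ultimately show ?thesis by auto
  qed
  then obtain l where "((\<lambda>y. y * Re (1 / F y)) \<longlongrightarrow> l) at_top" by blast
  then have "\<forall>\<^sub>F y in at_top. y * Re (1 / F y) < l + 1" by (rule order_tendstoD) simp
  then show ?thesis unfolding F_def by (intro exI[of _ "l + 1"]) (auto elim: eventually_mono)
qed

section \<open>The decomposition of the transformed measure\<close>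

lemma AE_in_msupp:
  assumes sets: "sets M = sets borel"
  shows "emeasure M (- msupp M) = 0" "AE s in M. s \<in> msupp M"
proof -
  define \<U> where "\<U> = {U. open U \<and> emeasure M U = 0}"
  obtain F where F: "F \<subseteq> \<U>" "countable F" "\<Union>F = \<Union>\<U>"
    using Lindelof[of \<U>] by (auto simp: \<U>_def)
  have "- msupp M = \<Union>F" unfolding F(3) by (auto simp: msupp_def \<U>_def)
  moreover have "(\<Union>U\<in>F. U) \<in> null_sets M"
    using F(1) sets by (intro null_sets_UN' F(2) null_setsI) (auto simp: \<U>_def)
  ultimately have n: "- msupp M \<in> null_sets M" by simp
  then show "emeasure M (- msupp M) = 0" by auto
  show "AE s in M. s \<in> msupp M" using AE_not_in[OF n] by simp
qed

text \<open>The first moment of the absolutely continuous summand is part of the definition of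
  \<open>L_star\<close>. For the other summand the weight is bounded, since almost every point lies
  in the compact support.\<close>

lemma L_star_plus_M_c_imp_M_plus:
  assumes "M \<in> L_star_plus_M_c"
  shows "M \<in> M_plus (-1)"
proof -
  obtain f \<nu> where f: "f \<in> L_star" and \<nu>: "\<nu> \<in> M_c" and sets: "sets M = sets borel"
    and add: "\<And>A. A \<in> sets borel \<Longrightarrow> emeasure M A = emeasure (density lborel (\<lambda>s. ennreal (f s))) A + emeasure \<nu> A"
    using assms by (auto simp: L_star_plus_M_c_def)
  have s\<nu>: "sets \<nu> = sets borel" "emeasure \<nu> UNIV \<noteq> 0" "emeasure \<nu> UNIV < \<infinity>" "compact (msupp \<nu>)"
    using \<nu> by (auto simp: M_c_def)
  have f0: "\<And>s. 0 \<le> f s" and if1: "integrable lborel f" and if2: "integrable lborel (\<lambda>s. (1 + s\<^sup>2) powr (1/2) * f s)"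
    using f by (auto simp: L_star_def)
  have [measurable]: "f \<in> borel_measurable borel" using if1 by auto
  define D where "D = density lborel (\<lambda>s. ennreal (f s))"
  have "emeasure D UNIV = (\<integral>\<^sup>+s. ennreal (f s) \<partial>lborel)" unfolding D_def by (subst emeasure_density) auto
  also have "\<dots> < \<infinity>" using if1 f0 by (simp add: nn_integral_eq_integral)
  finally have finD: "emeasure D UNIV < \<infinity>" .
  have finM: "emeasure M UNIV < \<infinity>" using add[of UNIV] finD s\<nu>(3) by (simp add: D_def)
  have neM: "emeasure M UNIV \<noteq> 0" using add[of UNIV] s\<nu>(2) by simp
  have K: "emeasure M K < \<infinity>" for K
    using emeasure_mono[of K UNIV M] finM sets by (auto intro: le_less_trans)
  obtain B where B: "\<And>s. s \<in> msupp \<nu> \<Longrightarrow> \<bar>s\<bar> \<le> B"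
    using compact_imp_bounded[OF s\<nu>(4)] by (auto simp: bounded_iff)
  have "(\<integral>\<^sup>+s. ennreal ((1 + s\<^sup>2) powr (1/2)) \<partial>\<nu>) \<le> (\<integral>\<^sup>+s. ennreal ((1 + B\<^sup>2) powr (1/2)) \<partial>\<nu>)"
  proof (rule nn_integral_mono_AE)
    show "AE s in \<nu>. ennreal ((1 + s\<^sup>2) powr (1/2)) \<le> ennreal ((1 + B\<^sup>2) powr (1/2))"
      using AE_in_msupp(2)[OF s\<nu>(1)]
    proof eventually_elim
      case (elim s)
      have "\<bar>s\<bar> \<le> \<bar>B\<bar>" using B[OF elim] by linarith
      then have "s\<^sup>2 \<le> B\<^sup>2" by (simp add: abs_le_square_iff)
      then show ?case by (intro ennreal_leI powr_mono2) (auto simp: add_nonneg_nonneg)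
    qed
  qed
  also have "\<dots> < \<infinity>" using s\<nu>(3) sets_eq_imp_space_eq[OF s\<nu>(1)] by (simp add: ennreal_mult_less_top)
  finally have i\<nu>: "(\<integral>\<^sup>+s. ennreal ((1 + s\<^sup>2) powr (1/2)) \<partial>\<nu>) < \<infinity>" .
  have "(\<integral>\<^sup>+s. ennreal ((1 + s\<^sup>2) powr (1/2)) \<partial>D) = (\<integral>\<^sup>+s. ennreal ((1 + s\<^sup>2) powr (1/2) * f s) \<partial>lborel)"
    unfolding D_def using f0 by (subst nn_integral_density) (auto simp: ennreal_mult mult.commute intro!: nn_integral_cong)
  also have "\<dots> < \<infinity>" using if2 f0 by (simp add: nn_integral_eq_integral)
  finally have "(\<integral>\<^sup>+s. ennreal ((1 + s\<^sup>2) powr (1/2)) \<partial>M) < \<infinity>"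
    using i\<nu> add sets s\<nu>(1) by (subst nn_integral_measure_add[of M D \<nu>]) (auto simp: D_def)
  then show ?thesis using sets neM K by (simp add: M_plus_def)
qed

text \<open>Each point has an open neighbourhood meeting S in that point alone, and Lindelof's
  theorem leaves countably many of them.\<close>

lemma countable_discrete:
  fixes S :: "real set"
  assumes "discrete S"
  shows "countable S"
proof -
  have "\<exists>T. open T \<and> T \<inter> S = {x}" if "x \<in> S" for x
    using discreteD[OF assms that] by (simp add: isolated_in_def)
  then obtain T where T: "\<And>x. x \<in> S \<Longrightarrow> open (T x) \<and> T x \<inter> S = {x}" by metis
  obtain F where F: "F \<subseteq> T ` S" "countable F" "\<Union>F = \<Union>(T ` S)"
    using Lindelof[of "T ` S"] T by blast
  have "S \<subseteq> \<Union>F" unfolding F(3) using T by auto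
  then have "S = (\<Union>V\<in>F. V \<inter> S)" by auto
  moreover have "countable (\<Union>V\<in>F. V \<inter> S)"
  proof (rule countable_UN[OF F(2)])
    fix V assume "V \<in> F"
    then obtain x where "x \<in> S" "V = T x" using F(1) by auto
    then have "V \<inter> S = {x}" using T by auto
    then show "countable (V \<inter> S)" by simp
  qed
  ultimately show ?thesis by simp
qed

lemma discrete_mono:
  fixes S :: "real set"
  assumes "discrete S" "T \<subseteq> S"
  shows "discrete T"
proof (rule discreteI)
  fix x assume "x \<in> T"
  then have "x isolated_in S" using assms discreteD by blast
  then obtain V where "open V" "V \<inter> S = {x}" by (auto simp: isolated_in_def)
  then show "x isolated_in T" using \<open>x \<in> T\<close> assms(2) by (auto simp: isolated_in_def intro!: exI[of _ V])
qed

lemma Z_atoms_subset_Z_prime: "Z_atoms M c0 c1 \<subseteq> Z_prime M c0 c1"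
  by (auto simp: Z_atoms_def Z_prime_def)

text \<open>The singular part \<sigma> of \<mu> lives on a null set N, and the part of N outside
  \<open>Z_prime\<close> has \<mu>-mass 0. So \<sigma> is the restriction of \<mu> to the countable
  set \<open>Z_prime\<close>, hence a sum over its points, among which only those in
  \<open>Z_atoms\<close> can carry mass.\<close>

lemma is_B_decomposition:
  assumes M: "M \<in> M_plus 0" and "0 \<le> c1" and disc: "countable (Z_prime M c0 c1)"
    and cd: "continuous_density M \<rho>" and B: "is_B M c0 c1 \<mu> \<zeta>0 \<zeta>1" and A: "A \<in> sets borel"
  shows "emeasure \<mu> A = (\<integral>\<^sup>+s\<in>A. ennreal (mu_density M \<rho> c0 c1 s) \<partial>lborel) +
          (\<integral>\<^sup>+\<alpha>\<in>A. ennreal (mu_weight M c1 \<alpha>) \<partial>count_space (Z_atoms M c0 c1))"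
proof -
  have M1: "M \<in> M_plus 1" using M by (rule M_plus_mono) simp
  have \<mu>: "\<mu> \<in> M_plus 1" using B by (auto simp: is_B_iff)
  note [measurable_cong] = M_plus_1D(1)[OF \<mu>]
  obtain f where f: "continuous_density \<mu> f" using ex_continuous_density[OF M_plus_1D(4)[OF \<mu>]] by blast
  obtain \<sigma> N where [measurable]: "f \<in> borel_measurable borel" and \<sigma>: "sets \<sigma> = sets borel"
    and N: "N \<in> null_sets lborel" and N0: "emeasure \<sigma> (- N) = 0"
    and add: "\<And>A. A \<in> sets borel \<Longrightarrow> emeasure \<mu> A = emeasure (density lborel (\<lambda>s. ennreal (f s))) A + emeasure \<sigma> A"
    using f unfolding continuous_density_def by blast
  define D where "D = density lborel (\<lambda>s. ennreal (f s))"
  define Z where "Z = Z_prime M c0 c1"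
  have cZ: "countable Z" using disc by (simp add: Z_def)
  have [measurable]: "N \<in> sets borel" "A \<in> sets borel" using N A by auto
  have Zb: "S \<in> sets borel" if "S \<subseteq> Z" for S
    using countable_subset[OF that cZ] by (rule sets.countable[rotated]) auto
  have DN: "emeasure D S = 0" if S: "S \<in> null_sets lborel" for S
  proof -
    have "AE s in lborel. s \<notin> S" using S by (rule AE_not_in)
    then have "(\<integral>\<^sup>+s\<in>S. ennreal (f s) \<partial>lborel) = (\<integral>\<^sup>+s. 0 \<partial>(lborel :: real measure))"
      by (intro nn_integral_cong_AE) (auto elim: eventually_mono)
    then show ?thesis unfolding D_def using S by (subst emeasure_density) auto
  qed
  have \<sigma>N: "emeasure \<sigma> S = emeasure \<sigma> (S \<inter> N)" if "S \<in> sets borel" for S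
  proof -
    have "emeasure \<sigma> S \<le> emeasure \<sigma> ((S \<inter> N) \<union> - N)" using \<sigma> that by (intro emeasure_mono) auto
    also have "\<dots> \<le> emeasure \<sigma> (S \<inter> N) + emeasure \<sigma> (- N)" using \<sigma> that by (intro emeasure_subadditive) auto
    finally have "emeasure \<sigma> S \<le> emeasure \<sigma> (S \<inter> N)" using N0 by simp
    moreover have "emeasure \<sigma> (S \<inter> N) \<le> emeasure \<sigma> S" using \<sigma> that by (intro emeasure_mono) auto
    ultimately show ?thesis by (rule antisym)
  qed
  have "emeasure \<sigma> A = emeasure \<mu> (A \<inter> Z)"
  proof -
    have Zm: "A \<inter> Z \<in> sets borel" "Z \<in> sets borel" using Zb[of "A \<inter> Z"] Zb[of Z] by auto
    have AN: "A \<inter> N \<in> null_sets lborel" "(A - Z) \<inter> N \<in> null_sets lborel"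
      using N Zm by (auto intro: null_set_Int1)
    moreover have "(A - Z) \<inter> N = A \<inter> N - Z" by auto
    ultimately have AN2: "A \<inter> N - Z \<in> null_sets lborel" by simp
    have "emeasure \<sigma> A = emeasure \<mu> (A \<inter> N)"
      using \<sigma>N[of A] add[of "A \<inter> N"] DN[OF AN(1)] by (simp add: D_def)
    also have "\<dots> = emeasure \<mu> (A \<inter> N \<inter> Z) + emeasure \<mu> (A \<inter> N - Z)"
      using Zm M_plus_1D(1)[OF \<mu>] by (subst plus_emeasure) (auto intro!: arg_cong[where f="emeasure \<mu>"])
    also have "emeasure \<mu> (A \<inter> N - Z) = 0"
      using AN2 by (intro emeasure_null_set_off_Z_prime[OF M1 \<open>0 \<le> c1\<close> B]) (auto simp: Z_def)
    \<comment> \<open>Points of Z outside N carry no mass: they form a countable set, which the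
      absolutely continuous part ignores, and \<sigma> vanishes off N.\<close>
    also have "emeasure \<mu> (A \<inter> N \<inter> Z) = emeasure \<mu> (A \<inter> Z)"
    proof -
      have cnt: "countable (A \<inter> Z - N)" using cZ by (blast intro: countable_subset)
      then have "A \<inter> Z - N \<in> null_sets lborel" by (rule countable_imp_null_set_lborel)
      moreover have "emeasure \<sigma> (A \<inter> Z - N) = 0"
      proof -
        have "(A \<inter> Z - N) \<inter> N = {}" by auto
        then show ?thesis using \<sigma>N[of "A \<inter> Z - N"] Zm by simp
      qed
      ultimately have "emeasure \<mu> (A \<inter> Z - N) = 0" using add[of "A \<inter> Z - N"] DN Zm by (simp add: D_def)
      moreover have "emeasure \<mu> (A \<inter> Z) = emeasure \<mu> (A \<inter> N \<inter> Z) + emeasure \<mu> (A \<inter> Z - N)"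
        using Zm M_plus_1D(1)[OF \<mu>] by (subst plus_emeasure) (auto intro!: arg_cong[where f="emeasure \<mu>"])
      ultimately show ?thesis by simp
    qed
    finally show ?thesis by simp
  qed
  also have "\<dots> = (\<integral>\<^sup>+\<alpha>. emeasure \<mu> {\<alpha>} \<partial>count_space (A \<inter> Z))"
    using M_plus_1D(1)[OF \<mu>] cZ by (intro emeasure_countable_singleton) auto
  also have "\<dots> = (\<integral>\<^sup>+\<alpha>\<in>A. ennreal (mu_weight M c1 \<alpha>) \<partial>count_space (Z_atoms M c0 c1))"
  proof -
    interpret sigma_finite_measure \<mu> using M_plus_1D(4)[OF \<mu>] by (rule sigma_finite_poisson_measure)
    have fin: "emeasure \<mu> {\<alpha>} < \<infinity>" for \<alpha>
      using \<mu> by (auto simp: M_plus_def)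
    have "emeasure \<mu> {\<alpha>} = ennreal (if \<alpha> \<in> Z_atoms M c0 c1 then mu_weight M c1 \<alpha> else 0)" for \<alpha>
      using measure_atom_eq[OF M \<open>0 \<le> c1\<close> B, of \<alpha>] fin[of \<alpha>] by (simp add: emeasure_eq_ennreal_measure less_top)
    then have "(\<integral>\<^sup>+\<alpha>. emeasure \<mu> {\<alpha>} \<partial>count_space (A \<inter> Z)) =
      (\<integral>\<^sup>+\<alpha>. (ennreal (if \<alpha> \<in> Z_atoms M c0 c1 then mu_weight M c1 \<alpha> else 0)) * indicator (A \<inter> Z) \<alpha> \<partial>count_space UNIV)"
      by (simp add: nn_integral_count_space_indicator)
    also have "\<dots> = (\<integral>\<^sup>+\<alpha>. (ennreal (mu_weight M c1 \<alpha>) * indicator A \<alpha>) * indicator (Z_atoms M c0 c1) \<alpha> \<partial>count_space UNIV)"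
      using Z_atoms_subset_Z_prime[of M c0 c1]
      by (intro nn_integral_cong) (auto simp: indicator_def Z_def)
    also have "\<dots> = (\<integral>\<^sup>+\<alpha>\<in>A. ennreal (mu_weight M c1 \<alpha>) \<partial>count_space (Z_atoms M c0 c1))"
      by (simp add: nn_integral_count_space_indicator)
    finally show ?thesis .
  qed
  finally have 1: "emeasure \<sigma> A = (\<integral>\<^sup>+\<alpha>\<in>A. ennreal (mu_weight M c1 \<alpha>) \<partial>count_space (Z_atoms M c0 c1))" .
  have "emeasure D A = (\<integral>\<^sup>+s\<in>A. ennreal (f s) \<partial>lborel)" unfolding D_def by (subst emeasure_density) auto
  also have "\<dots> = (\<integral>\<^sup>+s\<in>A. ennreal (mu_density M \<rho> c0 c1 s) \<partial>lborel)"
    using AE_density_eq_mu_density[OF M1 \<open>0 \<le> c1\<close> cd B f]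
    by (intro nn_integral_cong_AE) (auto elim: eventually_mono)
  finally show ?thesis using 1 add[OF A] by (simp add: D_def)
qed

text \<open>\<open>Lim\<close> has the same unspecified value at all points where the limit does not exist.\<close>

lemma measurable_Lim_at_right:
  fixes \<phi> :: "real \<Rightarrow> real \<Rightarrow> real"
  assumes cont: "\<And>\<epsilon>. 0 < \<epsilon> \<Longrightarrow> continuous_on UNIV (\<phi> \<epsilon>)"
  shows "(\<lambda>t. Lim (at_right 0) (\<lambda>\<epsilon>. \<phi> \<epsilon> t)) \<in> borel_measurable borel"
proof -
  \<comment> \<open>\<open>E\<close> is the set where the Cauchy criterion at 0 holds. The union
    over uncountably many p and q causes no measurability problem because continuity makes
    \<open>W k n\<close> open.\<close>
  define W where "W k n = (\<Union>p\<in>{0<..<1 / Suc n}. \<Union>q\<in>{0<..<1 / Suc n}. {t. 1 / Suc k < \<bar>\<phi> p t - \<phi> q t\<bar>})" for k n :: nat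
  define E where "E = (\<Inter>k. \<Union>n. - W k n)"
  define e where "e n = 1 / (real n + 2)" for n
  have e: "0 < e n" for n by (simp add: e_def)
  have e_lim: "filterlim e (at_right 0) sequentially"
    unfolding e_def[abs_def] by real_asymp
  have "open (W k n)" for k n
    unfolding W_def by (intro open_UN ballI open_Collect_less continuous_intros cont) auto
  then have E [measurable]: "E \<in> sets borel" unfolding E_def by auto
  have conv: "((\<lambda>\<epsilon>. \<phi> \<epsilon> t) \<longlongrightarrow> lim (\<lambda>n. \<phi> (e n) t)) (at_right 0)" if "t \<in> E" for t
  proof -
    have "\<exists>n. \<forall>p q. 0 < p \<and> p < 1 / Suc n \<and> 0 < q \<and> q < 1 / Suc n \<longrightarrow> \<bar>\<phi> p t - \<phi> q t\<bar> \<le> 1 / Suc k" for k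
    proof -
      have "\<exists>n. t \<notin> W k n" using that unfolding E_def by blast
      then obtain n where n: "t \<notin> W k n" ..
      have "\<bar>\<phi> p t - \<phi> q t\<bar> \<le> 1 / Suc k" if "p \<in> {0<..<1 / Suc n}" "q \<in> {0<..<1 / Suc n}" for p q
      proof (rule ccontr)
        assume "\<not> ?thesis"
        then have "t \<in> W k n" unfolding W_def using that by (intro UN_I[of p] UN_I[of q]) auto
        then show False using n by simp
      qed
      then show ?thesis by (intro exI[of _ n]) auto
    qed
    then obtain n where n: "\<And>k p q. 0 < p \<Longrightarrow> p < 1 / Suc (n k) \<Longrightarrow> 0 < q \<Longrightarrow> q < 1 / Suc (n k) \<Longrightarrow> \<bar>\<phi> p t - \<phi> q t\<bar> \<le> 1 / Suc k"
      by metis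
    have e_small: "\<forall>\<^sub>F j in sequentially. 0 < e j \<and> e j < d" if "0 < d" for d
    proof -
      have "\<forall>\<^sub>F x in at_right 0. 0 < x \<and> x < d"
        using that by (auto simp: eventually_at_right_field)
      then show ?thesis by (rule eventually_compose_filterlim[OF _ e_lim])
    qed
    have "Cauchy (\<lambda>j. \<phi> (e j) t)"
    proof (rule metric_CauchyI)
      fix r :: real assume "0 < r"
      then obtain k where k: "1 / Suc k < r" using nat_approx_posE by blast
      obtain J where J: "\<And>j. j \<ge> J \<Longrightarrow> 0 < e j \<and> e j < 1 / Suc (n k)"
        using e_small[of "1 / Suc (n k)"] by (auto simp: eventually_sequentially)
      have "dist (\<phi> (e i) t) (\<phi> (e j) t) < r" if "i \<ge> J" "j \<ge> J" for i j
        using n[of "e i" k "e j"] J[OF that(1)] J[OF that(2)] k by (simp add: dist_real_def)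
      then show "\<exists>J. \<forall>i\<ge>J. \<forall>j\<ge>J. dist (\<phi> (e i) t) (\<phi> (e j) t) < r" by blast
    qed
    then have L: "(\<lambda>j. \<phi> (e j) t) \<longlonglongrightarrow> lim (\<lambda>j. \<phi> (e j) t)"
      by (simp add: Cauchy_convergent_iff convergent_LIMSEQ_iff)
    show ?thesis
    proof (rule tendstoI)
      fix r :: real assume "0 < r"
      then obtain k where k: "1 / Suc k < r" using nat_approx_posE by blast
      have "dist (\<phi> p t) (lim (\<lambda>j. \<phi> (e j) t)) < r" if p: "0 < p" "p < 1 / Suc (n k)" for p
      proof -
        have "(\<lambda>j. \<bar>\<phi> p t - \<phi> (e j) t\<bar>) \<longlonglongrightarrow> \<bar>\<phi> p t - lim (\<lambda>j. \<phi> (e j) t)\<bar>" by (intro tendsto_intros L)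
        moreover have "\<forall>\<^sub>F j in sequentially. \<bar>\<phi> p t - \<phi> (e j) t\<bar> \<le> 1 / Suc k"
        proof -
          have "0 < 1 / real (Suc (n k))" by simp
          from e_small[OF this] show ?thesis by eventually_elim (use n p in blast)
        qed
        ultimately have "\<bar>\<phi> p t - lim (\<lambda>j. \<phi> (e j) t)\<bar> \<le> 1 / Suc k"
          by (intro tendsto_upperbound) auto
        then show ?thesis using k by (simp add: dist_real_def)
      qed
      then show "\<forall>\<^sub>F p in at_right 0. dist (\<phi> p t) (lim (\<lambda>j. \<phi> (e j) t)) < r"
        unfolding eventually_at_right_field by (intro exI[of _ "1 / Suc (n k)"]) auto
    qed
  qed
  have not_conv: "\<not> ((\<lambda>\<epsilon>. \<phi> \<epsilon> t) \<longlongrightarrow> l) (at_right 0)" if "t \<notin> E" for t l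
  proof
    assume l: "((\<lambda>\<epsilon>. \<phi> \<epsilon> t) \<longlongrightarrow> l) (at_right 0)"
    have "\<exists>k. \<forall>n. t \<in> W k n" using that by (auto simp: E_def)
    then obtain k where k: "\<And>n. t \<in> W k n" by blast
    have "\<forall>\<^sub>F \<epsilon> in at_right 0. dist (\<phi> \<epsilon> t) l < 1 / Suc k / 2" using l by (rule tendstoD) simp
    then obtain d where d: "0 < d" "\<And>\<epsilon>. 0 < \<epsilon> \<Longrightarrow> \<epsilon> < d \<Longrightarrow> dist (\<phi> \<epsilon> t) l < 1 / Suc k / 2"
      unfolding eventually_at_right_field by auto
    obtain n where "1 / Suc n < d" using nat_approx_posE[OF d(1)] by blast
    moreover obtain p q where pq: "0 < p" "p < 1 / Suc n" "0 < q" "q < 1 / Suc n" "1 / Suc k < \<bar>\<phi> p t - \<phi> q t\<bar>"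
      using k[of n] unfolding W_def by auto
    ultimately have "dist (\<phi> p t) l < 1 / Suc k / 2" "dist (\<phi> q t) l < 1 / Suc k / 2" by (intro d(2); simp)+
    then have "\<bar>\<phi> p t - \<phi> q t\<bar> < 1 / Suc k / 2 + 1 / Suc k / 2" 
      using abs_triangle_ineq4[of "\<phi> p t - l" "\<phi> q t - l"] by (simp add: dist_real_def)
    then show False using pq(5) field_sum_of_halves[of "1 / real (Suc k)"] by linarith
  qed
  have "Lim (at_right 0) (\<lambda>\<epsilon>. \<phi> \<epsilon> t) = (if t \<in> E then lim (\<lambda>n. \<phi> (e n) t) else (THE l. False))" for t
  proof (cases "t \<in> E")
    case True
    then show ?thesis using tendsto_Lim[OF _ conv[OF True]] by simp
  next
    case False
    then show ?thesis using not_conv[OF False] by (simp add: Topological_Spaces.Lim_def)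
  qed
  moreover have "(\<lambda>t. if t \<in> E then lim (\<lambda>n. \<phi> (e n) t) else (THE l. False)) \<in> borel_measurable borel"
  proof -
    have [measurable]: "\<phi> (e n) \<in> borel_measurable borel" for n using cont[OF e] by (rule borel_measurable_continuous_onI)
    have [measurable]: "(\<lambda>t. lim (\<lambda>n. \<phi> (e n) t)) \<in> borel_measurable borel"
      by (rule borel_measurable_lim_metric) measurable
    show ?thesis by measurable
  qed
  ultimately show ?thesis by (simp only:)
qed

lemma measurable_hilbert:
  assumes "M \<in> M_plus 1"
  shows "hilbert M \<in> borel_measurable borel"
  unfolding hilbert_def[abs_def]
proof (rule measurable_Lim_at_right)
  fix \<epsilon> :: real assume "0 < \<epsilon>"
  have "continuous_on {z. 0 < Im z} (Q_trans M)"
    using holomorphic_Q_trans[OF assms] by (rule holomorphic_on_imp_continuous_on)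
  moreover have "continuous_on UNIV (\<lambda>t. Complex t \<epsilon>)"
    unfolding Complex_eq by (intro continuous_intros)
  ultimately have "continuous_on UNIV (\<lambda>t. Q_trans M (Complex t \<epsilon>))"
    by (rule continuous_on_compose2) (use \<open>0 < \<epsilon>\<close> in auto)
  then show "continuous_on UNIV (\<lambda>t. Im (Q_trans M (Complex t \<epsilon>)))"
    by (rule continuous_on_Im)
qed

section \<open>Existence of the transform\<close>

text \<open>If the Herglotz measure of \<open>1 / F\<close> vanished, \<open>1 / F\<close> would be affine and \<open>M\<close> a point mass.\<close>

lemma point_mass_of_affine_inverse:
  assumes M: "M \<in> M_plus 1" and "0 \<le> c1"
    and eq: "\<And>z. 0 < Im z \<Longrightarrow> 1 / B_factor M c0 c1 z = \<i> * of_real b - \<i> * of_real \<zeta> * z"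
  shows "c0 = 0 \<and> c1 = 0 \<and> (\<exists>a. msupp M = {a})"
proof -
  define F where "F = B_factor M c0 c1"
  have F: "F z = 1 / (\<i> * of_real b - \<i> * of_real \<zeta> * z)" if "0 < Im z" for z
    using eq[OF that] by (metis F_def div_by_1 divide_divide_eq_right mult.left_neutral)
  have ReF: "0 < Re (F z)" if "0 < Im z" for z
    unfolding F_def using M \<open>0 \<le> c1\<close> that by (rule Re_B_factor_pos)
  have \<zeta>: "0 < \<zeta>"
  proof -
    have "0 < Re (F \<i>)" by (rule ReF) simp
    then have "0 < \<zeta> / (\<zeta>\<^sup>2 + b\<^sup>2)" using F[of \<i>] by (simp add: Re_divide)
    then show ?thesis by (smt (verit) divide_nonpos_nonneg zero_le_power2 add_nonneg_nonneg)
  qed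
  have F0: "((\<lambda>y. F (Complex 0 y)) \<longlongrightarrow> 0) at_top"
  proof (rule tendsto_norm_zero_cancel, rule tendsto_sandwich)
    show "\<forall>\<^sub>F y in at_top. 0 \<le> norm (F (Complex 0 y))" by simp
    show "\<forall>\<^sub>F y in at_top. norm (F (Complex 0 y)) \<le> 1 / (\<zeta> * y)"
      using eventually_gt_at_top[of "0::real"]
    proof eventually_elim
      case (elim y)
      have eq1: "\<i> * of_real b - \<i> * of_real \<zeta> * Complex 0 y = Complex (\<zeta> * y) b" by (simp add: complex_eq_iff)
      have "0 < \<zeta> * y" using \<zeta> elim by simp
      moreover have "\<bar>\<zeta> * y\<bar> \<le> norm (Complex (\<zeta> * y) b)" using abs_Re_le_cmod[of "Complex (\<zeta> * y) b"] by simp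
      ultimately have "1 / norm (Complex (\<zeta> * y) b) \<le> 1 / (\<zeta> * y)" by (intro frac_le) auto
      then show ?case using F[of "Complex 0 y"] elim by (simp only: eq1) (simp add: norm_divide)
    qed
    show "((\<lambda>y. 1 / (\<zeta> * y)) \<longlongrightarrow> 0) at_top" using \<zeta> by real_asymp
  qed simp
  have "((\<lambda>y. F (Complex 0 y) * of_real (inverse y)) \<longlongrightarrow> 0 * of_real 0) at_top"
    by (intro tendsto_mult F0 tendsto_of_real tendsto_inverse_0_at_top filterlim_ident)
  then have "((\<lambda>y. F (Complex 0 y) / of_real y) \<longlongrightarrow> 0) at_top" by (simp add: divide_inverse)
  from tendsto_unique[OF trivial_limit_at_top_linorder this tendsto_B_factor_over_y[OF M, of c0 c1, folded F_def]]
  have c1: "c1 = 0" by simp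
  have "((\<lambda>y. F (Complex 0 y)) \<longlongrightarrow> - \<i> * of_real (c0 / pi)) at_top"
    using tendsto_B_factor_minus[OF M, of c0 c1] by (simp add: c1 F_def)
  from tendsto_unique[OF trivial_limit_at_top_linorder F0 this] have c0: "c0 = 0" by simp
  have poisson: "poisson M t \<epsilon> = \<zeta> * \<epsilon> / ((\<zeta> * \<epsilon>)\<^sup>2 + (b - \<zeta> * t)\<^sup>2)" if "0 < \<epsilon>" for t \<epsilon>
    using Re_B_factor[OF M that, of c0 c1 t] F[of "Complex t \<epsilon>"] that by (simp add: F_def c1 Re_divide)
  \<comment> \<open>The closed form above is the Poisson integral of a point mass of size pi /
    \<zeta> at this point.\<close>
  define a where "a = b / \<zeta>"
  have "t \<notin> msupp M" if "t \<noteq> a" for t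
  proof -
    \<comment> \<open>This neighbourhood of t avoids a. The Poisson integral tends to 0 at each of
      its points, so M is dominated on it by arbitrarily small multiples of Lebesgue
      measure.\<close>
    define U where "U = ball t \<bar>t - a\<bar>"
    have U: "open U" "t \<in> U" "a \<notin> U" using that by (auto simp: U_def dist_real_def abs_minus_commute)
    have "\<exists>\<^sub>F \<epsilon> in at_right 0. poisson M u \<epsilon> \<le> C" if "u \<in> U" "0 < C" for u C
    proof (rule eventually_frequently[OF trivial_limit_at_right_real])
      have "u \<noteq> a" using that(1) U(3) by auto
      then have ne: "b - \<zeta> * u \<noteq> 0" using \<zeta> by (auto simp: a_def field_simps)
      then have "((\<lambda>\<epsilon>. \<zeta> * \<epsilon> / ((\<zeta> * \<epsilon>)\<^sup>2 + (b - \<zeta> * u)\<^sup>2)) \<longlongrightarrow> \<zeta> * 0 / ((\<zeta> * 0)\<^sup>2 + (b - \<zeta> * u)\<^sup>2)) (at_right 0)"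
        by (intro tendsto_intros) auto
      then have "\<forall>\<^sub>F \<epsilon> in at_right 0. \<zeta> * \<epsilon> / ((\<zeta> * \<epsilon>)\<^sup>2 + (b - \<zeta> * u)\<^sup>2) < C"
        by (rule order_tendstoD) (use that in simp)
      with eventually_at_right_less[of "0::real"] show "\<forall>\<^sub>F \<epsilon> in at_right 0. poisson M u \<epsilon> \<le> C"
        by eventually_elim (simp add: poisson)
    qed
    then have bound: "emeasure M U \<le> ennreal (2 * pi * C) * emeasure lborel U" if "0 < C" for C
      using that U by (intro emeasure_le_lborel_of_poisson_bound M_plus_1D(4)[OF M]) auto
    define l where "l = 2 * \<bar>t - a\<bar>"
    have l: "0 < l" using \<open>t \<noteq> a\<close> by (simp add: l_def)
    have lU: "emeasure lborel U = ennreal l" by (simp add: U_def ball_eq_greaterThanLessThan l_def)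
    have "emeasure M U \<le> 0 + ennreal e" if "0 < e" for e
    proof -
      define C where "C = e / (2 * pi * l)"
      have C: "0 < C" using that l by (simp add: C_def)
      have "emeasure M U \<le> ennreal (2 * pi * C) * ennreal l" using bound[OF C] by (simp add: lU)
      also have "\<dots> = ennreal (2 * pi * C * l)" using C l by (intro ennreal_mult[symmetric]) auto
      also have "2 * pi * C * l = e" using l by (simp add: C_def)
      finally show ?thesis by simp
    qed
    then have "emeasure M U \<le> 0" by (rule ennreal_le_epsilon) blast
    then show ?thesis using U by (auto simp: msupp_def)
  qed
  then have "msupp M \<subseteq> {a}" by blast
  moreover have "msupp M \<noteq> {}"
  proof
    assume "msupp M = {}"
    then have "emeasure M UNIV = 0" using AE_in_msupp(1)[OF M_plus_1D(1)[OF M]] by simp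
    then show False using M by (simp add: M_plus_def)
  qed
  ultimately have "msupp M = {a}" by blast
  then show ?thesis using c0 c1 by blast
qed

text \<open>Herglotz' theorem for 1 / F provides \<mu> only as a Poisson measure. It remains to
  place \<mu> in \<open>M_plus 1\<close>, to exclude \<mu> = 0, and to split the regularized kernel
  into the Cauchy kernel and a constant that joins \<zeta>0.\<close>

lemma ex_is_B:
  assumes M: "M \<in> M_plus (-1)" and "0 \<le> c1"
    and nondegenerate: "\<not> (c0 = 0 \<and> c1 = 0 \<and> (\<exists>a. msupp M = {a}))"
  shows "\<exists>\<mu> \<zeta>0 \<zeta>1. is_B M c0 c1 \<mu> \<zeta>0 \<zeta>1"
proof -
  note M0 = M_plus_minus_1D[OF M]
  define F where "F = B_factor M c0 c1"
  define G where "G z = 1 / F z" for z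
  have ReF: "0 < Re (F z)" if "0 < Im z" for z
    unfolding F_def using M0(2) \<open>0 \<le> c1\<close> that by (rule Re_B_factor_pos)
  have nz: "F z \<noteq> 0" if "0 < Im z" for z using ReF[OF that] by auto
  have holG: "G holomorphic_on {z. 0 < Im z}"
    unfolding G_def[abs_def] F_def using nz by (intro holomorphic_intros holomorphic_B_factor M0) (auto simp: F_def)
  have ReG: "0 < Re (G z)" if "0 < Im z" for z
  proof -
    have "Re (G z) = Re (F z) / ((Re (F z))\<^sup>2 + (Im (F z))\<^sup>2)" by (simp add: G_def Re_divide)
    moreover have "0 < (Re (F z))\<^sup>2 + (Im (F z))\<^sup>2" using ReF[OF that] by (simp add: add_pos_nonneg)
    ultimately show ?thesis using ReF[OF that] by simp
  qed
  obtain b \<zeta> and \<kappa> :: "real measure" where "0 \<le> \<zeta>" and \<kappa>: "sets \<kappa> = sets borel" "finite_measure \<kappa>"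
    and rep: "\<And>z. 0 < Im z \<Longrightarrow> G z = \<i> * of_real b - \<i> * of_real \<zeta> * z + (LINT s|\<kappa>. \<i> * (1 + of_real s * z) / (z - of_real s))"
  proof (rule Herglotz_half_plane[OF holG ReG])
    fix b \<zeta> and \<kappa> :: "real measure"
    assume "0 \<le> \<zeta>" "sets \<kappa> = sets borel" "finite_measure \<kappa>"
      "\<And>z. 0 < Im z \<Longrightarrow> G z = \<i> * of_real b - \<i> * of_real \<zeta> * z + (LINT s|\<kappa>. \<i> * (1 + of_real s * z) / (z - of_real s))"
    then show thesis by (rule that)
  qed
  note [measurable_cong] = \<kappa>(1)
  interpret \<kappa>: finite_measure \<kappa> by fact
  define \<mu> where "\<mu> = herglotz_measure \<kappa>"
  have pm: "poisson_measure \<mu>" unfolding \<mu>_def by (rule poisson_herglotz_measure(1)[OF \<kappa>])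
  have sets\<mu>: "sets \<mu> = sets borel" using pm by auto
  have ReG_eq: "Re (G (Complex x y)) = \<zeta> * y + poisson \<mu> x y" if "0 < y" for x y
    using rep[of "Complex x y"] that by (simp add: poisson_herglotz_measure(2)[OF \<kappa>] \<mu>_def)
  have pow: "filterlim (\<lambda>k. 2^k :: real) at_top sequentially" by real_asymp
  \<comment> \<open>If c0 or c1 is nonzero, the Poisson integral at \<i> y is of order 1 / y, which
    gives a geometric majorant. In the remaining case it is dominated by the cut-off moment.\<close>
  have summ: "summable (\<lambda>k. poisson \<mu> 0 (2^k))"
  proof (cases "c0 = 0 \<and> c1 = 0")
    case False
    then obtain C where C: "\<forall>\<^sub>F y in at_top. y * Re (1 / B_factor M c0 c1 (Complex 0 y)) \<le> C"
      using y_Re_inverse_B_factor_bounded[OF M0(1) \<open>0 \<le> c1\<close>, of c0] by auto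
    have "\<forall>\<^sub>F k in sequentially. norm (poisson \<mu> 0 (2^k)) \<le> C * (1/2)^k"
      using eventually_compose_filterlim[OF C pow]
    proof eventually_elim
      case (elim k)
      have "2^k * poisson \<mu> 0 (2^k) \<le> 2^k * Re (G (Complex 0 (2^k)))"
        using \<open>0 \<le> \<zeta>\<close> by (subst ReG_eq) auto
      also have "\<dots> \<le> C" using elim by (simp add: G_def F_def)
      finally show ?case using poisson_nonneg[of "2^k" \<mu> 0] by (simp add: power_divide field_simps)
    qed
    then show ?thesis by (rule summable_comparison_test_ev) (intro summable_mult summable_geometric, simp)
  next
    case True
    \<comment> \<open>The bound on Re (1 / F) subtracts pi y / m, so \<zeta> must equal pi / m for
      it to say anything about \<mu>. This follows because the Poisson part is of smaller order than
      y.\<close>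
    define m where "m = measure M UNIV"
    have m: "0 < m" unfolding m_def by (rule measure_pos_M_plus_0[OF M0(1)])
    have "((\<lambda>y. Re (1 / (of_real y * F (Complex 0 y)))) \<longlongrightarrow> Re (1 / of_real (m / pi))) at_top"
      using m tendsto_y_B_factor_0[OF M0(1)] True by (intro tendsto_Re tendsto_divide tendsto_const) (auto simp: m_def F_def)
    moreover have "\<forall>\<^sub>F y in at_top. Re (1 / (of_real y * F (Complex 0 y))) = \<zeta> + poisson \<mu> 0 y / y"
      using eventually_gt_at_top[of "0::real"]
    proof eventually_elim
      case (elim y)
      have "1 / (of_real y * F (Complex 0 y)) = G (Complex 0 y) / of_real y" by (simp add: G_def)
      then have "Re (1 / (of_real y * F (Complex 0 y))) = Re (G (Complex 0 y)) / y" by (simp only: Re_divide_of_real)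
      then show ?case using ReG_eq[OF elim] elim by (simp add: add_divide_distrib)
    qed
    ultimately have "((\<lambda>y. \<zeta> + poisson \<mu> 0 y / y) \<longlongrightarrow> Re (1 / of_real (m / pi))) at_top"
      by (rule Lim_transform_eventually)
    moreover have "((\<lambda>y. \<zeta> + poisson \<mu> 0 y / y) \<longlongrightarrow> \<zeta> + 0) at_top"
      by (intro tendsto_intros tendsto_poisson_over_y pm)
    ultimately have "Re (1 / of_real (m / pi)) = \<zeta> + 0" by (rule tendsto_unique[OF trivial_limit_at_top_linorder])
    moreover have "1 / complex_of_real (m / pi) = of_real (pi / m)" by simp
    ultimately have \<zeta>: "\<zeta> = pi / m" by (simp only: Re_complex_of_real add_0_right)
    have ev: "\<forall>\<^sub>F y in at_top. 0 < y \<and> Re (1 / B_factor M 0 0 (Complex 0 y)) - pi / m * y \<le> 2 * pi / m\<^sup>2 * cut_off_moment M y"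
      using eventually_gt_at_top[of "0::real"] Re_inverse_B_factor_le[OF M0(1), folded m_def] by eventually_elim auto
    have "\<forall>\<^sub>F k in sequentially. norm (poisson \<mu> 0 (2^k)) \<le> 2 * pi / m\<^sup>2 * cut_off_moment M (2^k)"
      using eventually_compose_filterlim[OF ev pow]
    proof eventually_elim
      case (elim k)
      have "Re (1 / B_factor M 0 0 (Complex 0 (2^k))) = pi / m * 2^k + poisson \<mu> 0 (2^k)"
        using ReG_eq[of "2^k" 0] True \<zeta> by (simp add: G_def F_def)
      then show ?case using elim poisson_nonneg[of "2^k" \<mu> 0] by simp
    qed
    then show ?thesis by (rule summable_comparison_test_ev) (intro summable_mult summable_D_fun M)
  qed
  have int1: "(\<integral>\<^sup>+s. ennreal ((1 + s\<^sup>2) powr (- 1 / 2)) \<partial>\<mu>) < \<infinity>"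
    using pm summ by (rule M_plus_1_of_summable_poisson)
  have \<mu>_nonzero: "emeasure \<mu> UNIV \<noteq> 0"
  proof
    assume z: "emeasure \<mu> UNIV = 0"
    have pos: "0 < pi * (1 + s\<^sup>2)" for s :: real by (simp add: add_pos_nonneg)
    have "(\<integral>\<^sup>+s. ennreal (pi * (1 + s\<^sup>2)) \<partial>\<kappa>) = 0"
      using z \<kappa>(1) unfolding \<mu>_def herglotz_measure_def by (subst (asm) emeasure_density) auto
    then have "AE s in \<kappa>. ennreal (pi * (1 + s\<^sup>2)) = 0" by (subst (asm) nn_integral_0_iff_AE) auto
    then have "AE s in \<kappa>. False"
    proof eventually_elim
      case (elim s)
      then show ?case using pos[of s] by (simp only: ennreal_eq_0_iff)
    qed
    then have "(LINT s|\<kappa>. \<i> * (1 + of_real s * z) / (z - of_real s)) = 0" for z :: complex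
      by (intro integral_eq_zero_AE) (auto elim: eventually_mono)
    then have "1 / B_factor M c0 c1 z = \<i> * of_real b - \<i> * of_real \<zeta> * z" if "0 < Im z" for z
      using rep[OF that] by (simp add: G_def F_def)
    from point_mass_of_affine_inverse[OF M0(2) \<open>0 \<le> c1\<close> this] nondegenerate show False by blast
  qed
  have \<mu>1: "\<mu> \<in> M_plus 1"
    using sets\<mu> \<mu>_nonzero int1 emeasure_compact_poisson_measure[OF pm] by (simp add: M_plus_def)
  have pos: "0 < 1 + s\<^sup>2" for s :: real by (simp add: add_pos_nonneg)
  \<comment> \<open>In terms of \<kappa> this is integrability of pi
    \<open>sqrt (1 + s\<^sup>2)\<close>. So \<kappa> has a first moment, and the term \<i> s of the
    regularized kernel can be integrated separately.\<close>
  have "integrable \<mu> (\<lambda>s. (1 + s\<^sup>2) powr (-1/2))" by (rule M_plus_1D(3)[OF \<mu>1])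
  then have "integrable \<kappa> (\<lambda>s. (pi * (1 + s\<^sup>2)) *\<^sub>R (1 + s\<^sup>2) powr (-1/2))"
    unfolding \<mu>_def herglotz_measure_def
    by (subst (asm) integrable_density) (auto simp: less_imp_le[OF pos])
  then have "integrable \<kappa> (\<lambda>s. complex_of_real s)"
  proof (rule Bochner_Integration.integrable_bound)
    show "AE s in \<kappa>. norm (complex_of_real s) \<le> norm ((pi * (1 + s\<^sup>2)) *\<^sub>R (1 + s\<^sup>2) powr (-1/2))"
    proof (intro AE_I2)
      fix s
      have "\<bar>s\<bar> = sqrt (s\<^sup>2)" by simp
      also have "\<dots> \<le> 1 * sqrt (1 + s\<^sup>2)"
        using real_sqrt_le_mono[of "s\<^sup>2" "1 + s\<^sup>2"] by simp
      also have "1 * sqrt (1 + s\<^sup>2) \<le> pi * sqrt (1 + s\<^sup>2)"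
        using pi_gt3 pos[of s] by (intro mult_right_mono) auto
      also have "sqrt (1 + s\<^sup>2) = (1 + s\<^sup>2) * (1 + s\<^sup>2) powr (-1/2)"
        using pos[of s] by (simp add: powr_minus powr_half_sqrt real_div_sqrt flip: divide_inverse)
      finally show "norm (complex_of_real s) \<le> norm ((pi * (1 + s\<^sup>2)) *\<^sub>R (1 + s\<^sup>2) powr (-1/2))"
        using pos[of s] by (simp add: abs_mult)
    qed
  qed measurable
  then have ints: "integrable \<kappa> (\<lambda>s. \<i> * complex_of_real s)" by (rule integrable_mult_right)
  define t where "t = (LINT s|\<kappa>. s)"
  have Q: "(LINT s|\<kappa>. \<i> * (1 + of_real s * z) / (z - of_real s)) = Q_trans \<mu> z + \<i> * of_real t" if "0 < Im z" for z
  proof -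
    have zs: "z - of_real s \<noteq> 0" for s using that by (auto simp: complex_eq_iff)
    have iQ: "integrable \<mu> (\<lambda>s. \<i> / (of_real pi * (z - of_real s)))"
      using integrable_mult_right[OF integrable_Cauchy_kernel_M_plus_1[OF \<mu>1, of z], of "\<i> / of_real pi"] that by simp
    have i\<kappa>: "integrable \<kappa> (\<lambda>s. (pi * (1 + s\<^sup>2)) *\<^sub>R (\<i> / (of_real pi * (z - of_real s))))"
      using iQ unfolding \<mu>_def herglotz_measure_def
      by (subst (asm) integrable_density) (auto simp: less_imp_le[OF pos])
    have "Q_trans \<mu> z = (LINT s|\<kappa>. (pi * (1 + s\<^sup>2)) *\<^sub>R (\<i> / (of_real pi * (z - of_real s))))"
      unfolding Q_trans_def \<mu>_def herglotz_measure_def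
      by (subst integral_density) (auto simp: less_imp_le[OF pos])
    then have "Q_trans \<mu> z + \<i> * of_real t = (LINT s|\<kappa>. (pi * (1 + s\<^sup>2)) *\<^sub>R (\<i> / (of_real pi * (z - of_real s))) + \<i> * of_real s)"
      using i\<kappa> ints by (simp add: t_def)
    also have "\<dots> = (LINT s|\<kappa>. \<i> * (1 + of_real s * z) / (z - of_real s))"
    proof (intro Bochner_Integration.integral_cong refl)
      fix s
      define w where "w = z - of_real s"
      have w: "w \<noteq> 0" using zs by (simp add: w_def)
      have "(pi * (1 + s\<^sup>2)) *\<^sub>R (\<i> / (of_real pi * w)) + \<i> * of_real s = \<i> * (1 + (of_real s)\<^sup>2) / w + \<i> * of_real s * w / w"
        using w by (simp add: scaleR_conv_of_real)
      also have "\<dots> = \<i> * (1 + of_real s * z) / w"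
        unfolding add_divide_distrib[symmetric] by (simp add: w_def algebra_simps power2_eq_square)
      finally show "(pi * (1 + s\<^sup>2)) *\<^sub>R (\<i> / (of_real pi * (z - of_real s))) + \<i> * of_real s = \<i> * (1 + of_real s * z) / (z - of_real s)"
        by (simp add: w_def)
    qed
    finally show ?thesis by simp
  qed
  \<comment> \<open>\<open>B_factor\<close> subtracts its constants and divides them by pi, which
    explains the sign and the factors pi; t is the first moment of \<kappa> split off from the
    kernel.\<close>
  have "is_B M c0 c1 \<mu> (- pi * (b + t)) (pi * \<zeta>)"
    unfolding is_B_iff
  proof (intro conjI allI impI \<mu>1)
    show "0 \<le> pi * \<zeta>" using \<open>0 \<le> \<zeta>\<close> by simp
    fix z assume z: "0 < Im z"
    have "B_factor \<mu> (- pi * (b + t)) (pi * \<zeta>) z = G z"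
    proof -
      have "\<i> * of_real (- pi * (b + t)) / of_real pi = - \<i> * of_real b - \<i> * of_real t"
        by (simp add: field_simps)
      moreover have "\<i> * of_real (pi * \<zeta>) * z / of_real pi = \<i> * of_real \<zeta> * z" by simp
      ultimately show ?thesis unfolding rep[OF z] Q[OF z] B_factor_def by (simp only:) simp
    qed
    then show "B_factor M c0 c1 z * B_factor \<mu> (- pi * (b + t)) (pi * \<zeta>) z = 1"
      using nz[OF z] by (simp add: G_def F_def)
  qed
  then show ?thesis by blast
qed

text \<open>It suffices that \<mu> is finite, since its absolutely continuous part is then finite as
  well. Finiteness follows once y times the Poisson integral at \<i> y stays bounded. For c0 = c1 =
  0 the linear growth of 1 / F cancels exactly against \<zeta>1, and the second moment bounds y
  times the cut-off moment.\<close>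

lemma integrable_mu_density:
  assumes M: "M \<in> M_plus (-1)" and "0 \<le> c1" and cd: "continuous_density M \<rho>"
    and B: "is_B M c0 c1 \<mu> \<zeta>0 \<zeta>1"
    and mom: "c0 \<noteq> 0 \<or> c1 \<noteq> 0 \<or> integrable M (\<lambda>s. s\<^sup>2)"
  shows "integrable lborel (mu_density M \<rho> c0 c1)"
proof -
  note M0 = M_plus_minus_1D[OF M]
  have \<mu>: "\<mu> \<in> M_plus 1" "0 \<le> \<zeta>1" and eq: "\<And>z. 0 < Im z \<Longrightarrow> B_factor M c0 c1 z * B_factor \<mu> \<zeta>0 \<zeta>1 z = 1"
    using B by (auto simp: is_B_iff)
  have inv: "Re (1 / B_factor M c0 c1 (Complex 0 y)) = poisson \<mu> 0 y + \<zeta>1 * y / pi" if "0 < y" for y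
  proof -
    have "B_factor M c0 c1 (Complex 0 y) * B_factor \<mu> \<zeta>0 \<zeta>1 (Complex 0 y) = 1" using that by (intro eq) simp
    then have "1 / B_factor M c0 c1 (Complex 0 y) = B_factor \<mu> \<zeta>0 \<zeta>1 (Complex 0 y)"
      by (metis mult_zero_left nonzero_mult_div_cancel_left zero_neq_one)
    then show ?thesis using Re_B_factor[OF \<mu>(1) that] by simp
  qed
  have "\<exists>C. \<forall>\<^sub>F y in at_top. y * poisson \<mu> 0 y \<le> C"
  proof (cases "c0 = 0 \<and> c1 = 0")
    case False
    then obtain C where C: "\<forall>\<^sub>F y in at_top. y * Re (1 / B_factor M c0 c1 (Complex 0 y)) \<le> C"
      using y_Re_inverse_B_factor_bounded[OF M0(1) \<open>0 \<le> c1\<close>, of c0] by auto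
    with eventually_gt_at_top[of "0::real"] have "\<forall>\<^sub>F y in at_top. y * poisson \<mu> 0 y \<le> C"
    proof eventually_elim
      case (elim y)
      have "y * poisson \<mu> 0 y \<le> y * (poisson \<mu> 0 y + \<zeta>1 * y / pi)"
        using elim(1) \<mu>(2) by (intro mult_left_mono) auto
      also have "\<dots> \<le> C" using elim(2) unfolding inv[OF elim(1)] .
      finally show ?case .
    qed
    then show ?thesis by blast
  next
    case True
    define m where "m = measure M UNIV"
    have m: "0 < m" unfolding m_def by (rule measure_pos_M_plus_0[OF M0(1)])
    have i2: "integrable M (\<lambda>s. s\<^sup>2)" using mom True by simp
    have \<zeta>1: "\<zeta>1 = pi\<^sup>2 / m" using is_B_zeta(3)[OF M B] True by (simp add: m_def)
    have "\<forall>\<^sub>F y in at_top. y * poisson \<mu> 0 y \<le> 2 * pi / m\<^sup>2 * (LINT s|M. s\<^sup>2)"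
      using eventually_gt_at_top[of "0::real"] Re_inverse_B_factor_le[OF M0(1), folded m_def]
    proof eventually_elim
      case (elim y)
      have "poisson \<mu> 0 y \<le> 2 * pi / m\<^sup>2 * cut_off_moment M y"
        using elim inv[OF elim(1)] True by (simp add: \<zeta>1 power2_eq_square)
      then have "y * poisson \<mu> 0 y \<le> y * (2 * pi / m\<^sup>2 * cut_off_moment M y)" using elim(1) by (intro mult_left_mono) auto
      also have "\<dots> = 2 * pi / m\<^sup>2 * (y * cut_off_moment M y)" by simp
      also have "\<dots> \<le> 2 * pi / m\<^sup>2 * (LINT s|M. s\<^sup>2)"
        using y_D_fun_le[OF M0(1) i2 elim(1)] by (intro mult_left_mono) auto
      finally show ?case .
    qed
    then show ?thesis by blast
  qed
  then have fin: "emeasure \<mu> UNIV < \<infinity>" using finite_of_bounded_poisson[OF M_plus_1D(4)[OF \<mu>(1)]] by blast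
  obtain f where f: "continuous_density \<mu> f" using ex_continuous_density[OF M_plus_1D(4)[OF \<mu>(1)]] by blast
  then have fm [measurable]: "f \<in> borel_measurable borel" and f0: "\<And>s. 0 \<le> f s"
    by (auto simp: continuous_density_def)
  have "emeasure (density lborel (\<lambda>s. ennreal (f s))) UNIV \<le> emeasure \<mu> UNIV"
    using f unfolding continuous_density_def by auto
  then have "(\<integral>\<^sup>+s. ennreal (f s) \<partial>lborel) < \<infinity>"
    using fin by (subst (asm) emeasure_density) auto
  then have intf: "integrable lborel f" using f0 by (intro integrableI_bounded) auto
  have [measurable]: "\<rho> \<in> borel_measurable borel" using cd by (simp add: continuous_density_def)
  \<comment> \<open>Almost everywhere equality with the integrable f transfers integrability only
    between measurable functions, so \<open>hilbert M\<close> has to be measurable on the whole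
    line, including points where the limit fails to exist.\<close>
  have [measurable]: "hilbert M \<in> borel_measurable borel" by (rule measurable_hilbert[OF M0(2)])
  have "mu_density M \<rho> c0 c1 \<in> borel_measurable borel" unfolding mu_density_def[abs_def] by measurable
  then show ?thesis
    using intf AE_density_eq_mu_density[OF M0(2) \<open>0 \<le> c1\<close> cd B f]
    by (subst integrable_cong_AE[where g=f]) (auto elim: eventually_mono)
qed

theorem theorem4p10:
  fixes M :: "real measure" and c0 c1 :: real and \<rho> :: "real \<Rightarrow> real"
  assumes "M \<in> L_star_plus_M_c"
    and "0 \<le> c1"
    and "discrete (Z_prime M c0 c1)"
    and "continuous_density M \<rho>"
    and nondegenerate: "\<not> (c0 = 0 \<and> c1 = 0 \<and> (\<exists>a. msupp M = {a}))"
  shows "M \<in> M_plus (-1) \<and>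
    B_well_defined M c0 c1 \<and>
    discrete (Z_atoms M c0 c1) \<and>
    ((c0 \<noteq> 0 \<or> c1 \<noteq> 0 \<or> integrable M (\<lambda>s. s\<^sup>2)) \<longrightarrow>
       integrable lborel (mu_density M \<rho> c0 c1)) \<and>
    (\<forall>\<mu> \<zeta>0 \<zeta>1. is_B M c0 c1 \<mu> \<zeta>0 \<zeta>1 \<longrightarrow>
       (\<forall>A \<in> sets borel. emeasure \<mu> A =
          (\<integral>\<^sup>+s\<in>A. ennreal (mu_density M \<rho> c0 c1 s) \<partial>lborel) +
          (\<integral>\<^sup>+\<alpha>\<in>A. ennreal (mu_weight M c1 \<alpha>) \<partial>count_space (Z_atoms M c0 c1))) \<and>
       (c1 \<noteq> 0 \<longrightarrow> \<zeta>0 = 0 \<and> \<zeta>1 = 0) \<and>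
       (c1 = 0 \<and> c0 \<noteq> 0 \<longrightarrow> \<zeta>1 = 0 \<and> \<zeta>0 = - pi\<^sup>2 / c0) \<and>
       (c0 = 0 \<and> c1 = 0 \<longrightarrow>
          \<zeta>0 = - (pi\<^sup>2 / (measure M UNIV)\<^sup>2) * (LINT \<tau>|M. \<tau>) \<and>
          \<zeta>1 = pi\<^sup>2 / measure M UNIV))"
proof -
  have M: "M \<in> M_plus (-1)" using assms(1) by (rule L_star_plus_M_c_imp_M_plus)
  note M0 = M_plus_minus_1D[OF M]
  \<comment> \<open>Besides witnessing existence, this triple serves for the integrability of
    \<open>mu_density\<close>, an assertion that mentions no \<mu>.\<close>
  obtain \<mu>' \<zeta>0' \<zeta>1' where B: "is_B M c0 c1 \<mu>' \<zeta>0' \<zeta>1'"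
    using ex_is_B[OF M assms(2) nondegenerate] by blast
  have "countable (Z_prime M c0 c1)" using assms(3) by (rule countable_discrete)
  note decomposition = is_B_decomposition[OF M0(1) assms(2) this assms(4)]
  show ?thesis
  proof (intro conjI impI allI ballI)
    show "M \<in> M_plus (-1)" by (rule M)
    show "B_well_defined M c0 c1" using B unfolding B_well_defined_def by blast
    show "discrete (Z_atoms M c0 c1)"
      using assms(3) Z_atoms_subset_Z_prime by (rule discrete_mono)
    show "integrable lborel (mu_density M \<rho> c0 c1)" if "c0 \<noteq> 0 \<or> c1 \<noteq> 0 \<or> integrable M (\<lambda>s. s\<^sup>2)"
      using M assms(2,4) B that by (rule integrable_mu_density)
    fix \<mu> \<zeta>0 \<zeta>1 assume B': "is_B M c0 c1 \<mu> \<zeta>0 \<zeta>1"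
    show "emeasure \<mu> A = (\<integral>\<^sup>+s\<in>A. ennreal (mu_density M \<rho> c0 c1 s) \<partial>lborel) +
        (\<integral>\<^sup>+\<alpha>\<in>A. ennreal (mu_weight M c1 \<alpha>) \<partial>count_space (Z_atoms M c0 c1))" if "A \<in> sets borel" for A
      using B' that by (rule decomposition)
    show "\<zeta>0 = 0" "\<zeta>1 = 0" if "c1 \<noteq> 0" using is_B_zeta(1)[OF M B' that] by auto
    show "\<zeta>1 = 0" "\<zeta>0 = - pi\<^sup>2 / c0" if "c1 = 0 \<and> c0 \<noteq> 0"
      using is_B_zeta(2)[OF M B'] that by auto
    show "\<zeta>0 = - (pi\<^sup>2 / (measure M UNIV)\<^sup>2) * (LINT \<tau>|M. \<tau>)" "\<zeta>1 = pi\<^sup>2 / measure M UNIV"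
      if "c0 = 0 \<and> c1 = 0"
      using is_B_zeta(3)[OF M B'] that by auto
  qed
qed

end
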